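(* Let $\Gamma$ be an M-metric graph or an M-tropical curve. Then each real effective divisor on $\Gamma$ is linearly equivalent to a totally real effective divisor.
   Context: A metric graph is a compact connected metric space locally isometric to star-shaped sets $\{te^{2k\pi i/n}:0\le t<r\}\subset\mathbb C$; vertices are points of local valence $\ne2$, edges are the components of the complement. A tropical curve is the union of a metric graph and finitely many unbounded edges isometric to $[0,\infty]$, each attached at its point $0$. $g(\Gamma)$ is the first Betti number. A real structure is an isometric involution $\iota$; $\overline p=\iota(p)$; $\Gamma(\mathbb R)$ is the fixed point set, with connected components $\Gamma_1,\dots,\Gamma_{s'}$, and $s(\Gamma)=\sum_i(g(\Gamma_i)+1)$ with $g(\Gamma_i)$ the first Betti number of $\Gamma_i$. $\Gamma$ (with real structure) is an M-metric graph, resp. M-tropical curve, if $s(\Gamma)=g(\Gamma)+1$. A divisor is a finite formal $\mathbb Z$-combination of points; it is real if $D(\overline p)=D(p)$ for all $p$, and totally real if moreover its support lies in $\Gamma(\mathbb R)$. A rational function is a continuous $f:\Gamma\to\mathbb R$, piecewise affine with integer slopes and finitely many pieces on each edge; $\Delta(f)(p)$ is the sum of the outgoing slopes at $p$; $D_1\sim D_2$ iff $D_2-D_1=\Delta(f)$ for some rational function $f$.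
   Formalization: On unbounded edges, rational functions may be unbounded (values ±∞ at points at infinity), and the outgoing slope there is minus the eventual slope; with real-valued f the claim fails, e.g. for the sum of the two infinite points of a segment with two legs swapped by reflection. *)

theory Defs
  imports "HOL-Homology.Homology" "HOL-Library.Extended_Real"
begin

text \<open>A tropical curve is presented by a finite graph: finite vertices (verts),
  points at infinity (infv), edges with a source and a target and a length in
  (0, infinity].  Bounded edges have finite length and both ends in verts; an
  unbounded edge (leg) has infinite length, its source in verts and its target
  a point at infinity; each point at infinity is the end of exactly one leg.
  A metric graph is the case infv = {}.\<close>

record ('v, 'e) tgraph =
  verts :: "'v set"
  infv  :: "'v set"
  edges :: "'e set"
  src   :: "'e \<Rightarrow> 'v"
  tgt   :: "'e \<Rightarrow> 'v"
  len   :: "'e \<Rightarrow> ereal"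

datatype ('v, 'e) gpt = Vtx 'v | Inr 'e real

definition pts :: "('v, 'e) tgraph \<Rightarrow> ('v, 'e) gpt set" where
  "pts G = Vtx ` (verts G \<union> infv G) \<union>
     {Inr e t | e t. e \<in> edges G \<and> 0 < t \<and> ereal t < len G e}"

definition pos_pt :: "('v, 'e) tgraph \<Rightarrow> 'e \<Rightarrow> ereal \<Rightarrow> ('v, 'e) gpt" where
  "pos_pt G e a = (if a = 0 then Vtx (src G e) else if a = len G e then Vtx (tgt G e)
               else Inr e (real_of_ereal a))"

text \<open>Topology: the quotient topology of the disjoint union of the closed edges
  [0, len e] (with [0,\<infinity>] for legs).\<close>
definition gtop :: "('v, 'e) tgraph \<Rightarrow> ('v, 'e) gpt topology" where
  "gtop G = topology (\<lambda>U. U \<subseteq> pts G \<and>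
     (\<forall>e\<in>edges G. openin (top_of_set {0..len G e}) {a \<in> {0..len G e}. pos_pt G e a \<in> U}))"

definition ldist :: "('v, 'e) tgraph \<Rightarrow> ('v, 'e) gpt \<Rightarrow> ('v, 'e) gpt \<Rightarrow> ereal" where
  "ldist G x y = Inf {if a = b then 0 else \<bar>a - b\<bar> | e a b.
      e \<in> edges G \<and> a \<in> {0..len G e} \<and> b \<in> {0..len G e} \<and> pos_pt G e a = x \<and> pos_pt G e b = y}"

definition gdist :: "('v, 'e) tgraph \<Rightarrow> ('v, 'e) gpt \<Rightarrow> ('v, 'e) gpt \<Rightarrow> ereal" where
  "gdist G x y = (if x = y then 0 else
     Inf {sum_list (map2 (ldist G) (x # zs) (zs @ [y])) | zs. set zs \<subseteq> pts G})"

definition tropical_curve :: "('v, 'e) tgraph \<Rightarrow> bool" where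
  "tropical_curve G \<longleftrightarrow>
     finite (verts G) \<and> finite (infv G) \<and> finite (edges G) \<and> verts G \<noteq> {} \<and>
     verts G \<inter> infv G = {} \<and>
     (\<forall>e\<in>edges G. src G e \<in> verts G \<and> tgt G e \<in> verts G \<union> infv G \<and> 0 < len G e \<and>
        (len G e = \<infinity> \<longleftrightarrow> tgt G e \<in> infv G)) \<and>
     (\<forall>v\<in>infv G. \<exists>!e. e \<in> edges G \<and> tgt G e = v) \<and>
     connected_space (gtop G)"

definition metric_graph :: "('v, 'e) tgraph \<Rightarrow> bool" where
  "metric_graph G \<longleftrightarrow> tropical_curve G \<and> infv G = {}"

definition real_structure :: "('v, 'e) tgraph \<Rightarrow> (('v, 'e) gpt \<Rightarrow> ('v, 'e) gpt) \<Rightarrow> bool" where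
  "real_structure G \<iota> \<longleftrightarrow>
     (\<forall>p\<in>pts G. \<iota> p \<in> pts G \<and> \<iota> (\<iota> p) = p) \<and>
     continuous_map (gtop G) (gtop G) \<iota> \<and>
     (\<forall>p\<in>pts G. \<forall>q\<in>pts G. gdist G (\<iota> p) (\<iota> q) = gdist G p q)"

definition realpts :: "('v, 'e) tgraph \<Rightarrow> (('v, 'e) gpt \<Rightarrow> ('v, 'e) gpt) \<Rightarrow> ('v, 'e) gpt set" where
  "realpts G \<iota> = {p \<in> pts G. \<iota> p = p}"

definition betti1 :: "'a topology \<Rightarrow> nat" where
  "betti1 X = (THE n. \<exists>S :: nat set. finite S \<and> card S = n \<and>
                        homology_group 1 X \<cong> free_Abelian_group S)"

definition genus :: "('v, 'e) tgraph \<Rightarrow> nat" where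
  "genus G = betti1 (gtop G)"

definition s_inv :: "('v, 'e) tgraph \<Rightarrow> (('v, 'e) gpt \<Rightarrow> ('v, 'e) gpt) \<Rightarrow> nat" where
  "s_inv G \<iota> = (\<Sum>C \<in> connected_components_of (subtopology (gtop G) (realpts G \<iota>)).
                   betti1 (subtopology (gtop G) C) + 1)"

definition M_curve :: "('v, 'e) tgraph \<Rightarrow> (('v, 'e) gpt \<Rightarrow> ('v, 'e) gpt) \<Rightarrow> bool" where
  "M_curve G \<iota> \<longleftrightarrow> s_inv G \<iota> = genus G + 1"

definition divisor :: "('v, 'e) tgraph \<Rightarrow> (('v, 'e) gpt \<Rightarrow> int) \<Rightarrow> bool" where
  "divisor G D \<longleftrightarrow> finite {p. D p \<noteq> 0} \<and> {p. D p \<noteq> 0} \<subseteq> pts G"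

definition effective :: "(('v, 'e) gpt \<Rightarrow> int) \<Rightarrow> bool" where
  "effective D \<longleftrightarrow> (\<forall>p. 0 \<le> D p)"

definition real_divisor ::
  "('v, 'e) tgraph \<Rightarrow> (('v, 'e) gpt \<Rightarrow> ('v, 'e) gpt) \<Rightarrow> (('v, 'e) gpt \<Rightarrow> int) \<Rightarrow> bool" where
  "real_divisor G \<iota> D \<longleftrightarrow> divisor G D \<and> (\<forall>p\<in>pts G. D (\<iota> p) = D p)"

definition totally_real_divisor ::
  "('v, 'e) tgraph \<Rightarrow> (('v, 'e) gpt \<Rightarrow> ('v, 'e) gpt) \<Rightarrow> (('v, 'e) gpt \<Rightarrow> int) \<Rightarrow> bool" where
  "totally_real_divisor G \<iota> D \<longleftrightarrow> real_divisor G \<iota> D \<and> {p. D p \<noteq> 0} \<subseteq> realpts G \<iota>"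

definition affine_int_on :: "real set \<Rightarrow> (real \<Rightarrow> real) \<Rightarrow> bool" where
  "affine_int_on I \<phi> \<longleftrightarrow> (\<exists>m::int. \<exists>c::real. \<forall>t\<in>I. \<phi> t = of_int m * t + c)"

definition edom :: "('v, 'e) tgraph \<Rightarrow> 'e \<Rightarrow> real set" where
  "edom G e = {t. 0 \<le> t \<and> ereal t \<le> len G e}"

text \<open>Piecewise affine with integer slopes and finitely many pieces (hence continuous).\<close>
definition pw_affine_int :: "real set \<Rightarrow> (real \<Rightarrow> real) \<Rightarrow> bool" where
  "pw_affine_int I \<phi> \<longleftrightarrow> (\<exists>S. finite S \<and>
     (\<forall>x\<in>I. \<forall>y\<in>I. x \<le> y \<longrightarrow> {x<..<y} \<inter> S = {} \<longrightarrow> affine_int_on {x..y} \<phi>))"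

definition along :: "('v, 'e) tgraph \<Rightarrow> (('v, 'e) gpt \<Rightarrow> real) \<Rightarrow> 'e \<Rightarrow> real \<Rightarrow> real" where
  "along G f e t = f (pos_pt G e (ereal t))"

definition rational_fun :: "('v, 'e) tgraph \<Rightarrow> (('v, 'e) gpt \<Rightarrow> real) \<Rightarrow> bool" where
  "rational_fun G f \<longleftrightarrow> (\<forall>e\<in>edges G. pw_affine_int (edom G e) (along G f e))"

definition slope_fwd :: "(real \<Rightarrow> real) \<Rightarrow> real \<Rightarrow> real" where
  "slope_fwd \<phi> t = Lim (at_right 0) (\<lambda>h. (\<phi> (t + h) - \<phi> t) / h)"

definition slope_bwd :: "(real \<Rightarrow> real) \<Rightarrow> real \<Rightarrow> real" where
  "slope_bwd \<phi> t = Lim (at_right 0) (\<lambda>h. (\<phi> (t - h) - \<phi> t) / h)"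

text \<open>Outgoing slope at the point at infinity of a leg (minus the eventual slope).\<close>
definition slope_inf :: "(real \<Rightarrow> real) \<Rightarrow> real" where
  "slope_inf \<phi> = Lim at_top (\<lambda>t. \<phi> t - \<phi> (t + 1))"

definition Delta :: "('v, 'e) tgraph \<Rightarrow> (('v, 'e) gpt \<Rightarrow> real) \<Rightarrow> ('v, 'e) gpt \<Rightarrow> real" where
  "Delta G f p = (if p \<notin> pts G then 0 else
     (case p of
        Inr e t \<Rightarrow> slope_fwd (along G f e) t + slope_bwd (along G f e) t
      | Vtx v \<Rightarrow>
          (\<Sum>e\<in>{e\<in>edges G. src G e = v}. slope_fwd (along G f e) 0) +
          (\<Sum>e\<in>{e\<in>edges G. tgt G e = v}.
              (if len G e = \<infinity> then slope_inf (along G f e)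
               else slope_bwd (along G f e) (real_of_ereal (len G e))))))"

definition lin_equiv ::
  "('v, 'e) tgraph \<Rightarrow> (('v, 'e) gpt \<Rightarrow> int) \<Rightarrow> (('v, 'e) gpt \<Rightarrow> int) \<Rightarrow> bool" where
  "lin_equiv G D1 D2 \<longleftrightarrow>
     (\<exists>f. rational_fun G f \<and> (\<forall>p\<in>pts G. real_of_int (D2 p - D1 p) = Delta G f p))"

end

theory Submission
  imports Defs "HOL-Analysis.Abstract_Topological_Spaces"
begin

text \<open>Subdivide \<open>\<Gamma>\<close> at a finite \<open>\<iota>\<close>-invariant set of points so fine that every \<open>\<iota>\<close>-invariant
  open arc is fixed pointwise.  For a connected finite graph the first Betti number is
  \<open>#arcs - #vertices + 1\<close>, so \<open>s(\<Gamma>) = g(\<Gamma>) + 1\<close> becomes a count: the multigraph whose vertices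
  are the components of \<open>\<Gamma>(\<real>)\<close> together with the conjugate pairs of non-real vertices, and whose
  edges are the conjugate pairs of non-real arcs, has one more vertex than edges.  It is connected,
  hence a tree, and each of its edges is a bridge.  For a non-real arc \<open>a\<close> from \<open>u\<close> to \<open>v\<close> there is
  thus a rational function of slope \<open>\<plusminus>1\<close> on \<open>a\<close> and \<open>\<iota>(a)\<close> (which have equal length) and
  constant elsewhere; it shows \<open>u + \<iota>(u) \<sim> v + \<iota>(v)\<close>.  Walking along non-real arcs until
  \<open>\<Gamma>(\<real>)\<close> is reached moves each non-real pair \<open>p + \<iota>(p)\<close> of the divisor to some \<open>2r\<close> with \<open>r\<close> real.\<close>


section \<open>Attaching an arc to a Hausdorff space\<close>

text \<open>The count: let \<open>c\<close> be the number of components of \<Gamma>(\<real>), and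
  let \<open>F\<close>, \<open>V\<close> pick one member of each conjugate pair of non-real arcs and
  of non-real vertices. Summing the Betti formula over the components gives
  \<open>s = #ER - #(W \<inter> R) + 2c\<close>, while \<open>g + 1 = #E - #W + 2\<close>. As
  \<open>#E - #ER = 2#F\<close> and \<open>#W - #(W \<inter> R) = 2#V\<close>, the equality
  \<open>s = g + 1\<close> says exactly \<open>c + #V = #F + 1\<close>. An arc reversed by \<iota>
  would spoil the halving; such an arc carries exactly one real point, and making it a vertex turns
  the arc into a conjugate pair. The isometry enters through lengths: a bridge gives a cut into two
  \<iota>-invariant vertex sets which both \<open>a\<close> and \<iota>(\<open>a\<close>) cross, so
  a function equal to 0 on one side and to \<open>l\<close> on the other must climb by the same
  \<open>l\<close> along both. On legs the climb is infinite, and there it has to be shown instead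
  that \<iota> matches infinite ends with infinite ends. Betti numbers are given by singular
  homology, so the Euler count itself has to be derived from the effect of attaching one
  arc.\<close>

lemma glue_continuous_map:
  assumes "Hausdorff_space X" "closedin X Y" "compact_space K" "continuous_map K X \<gamma>"
    and cover: "topspace X = Y \<union> \<gamma> ` topspace K"
    and f: "continuous_map (subtopology X Y) Z f" and g: "continuous_map K Z g"
    and compat: "\<And>t. t \<in> topspace K \<Longrightarrow> \<gamma> t \<in> Y \<Longrightarrow> g t = f (\<gamma> t)"
    and inj: "\<And>t u. t \<in> topspace K \<Longrightarrow> u \<in> topspace K \<Longrightarrow> \<gamma> t = \<gamma> u \<Longrightarrow> g t = g u"
  obtains F where "continuous_map X Z F" "\<And>y. y \<in> Y \<Longrightarrow> F y = f y"
    "\<And>t. t \<in> topspace K \<Longrightarrow> F (\<gamma> t) = g t"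
proof -
  define F where "F x = (if x \<in> Y then f x else g (SOME t. t \<in> topspace K \<and> \<gamma> t = x))" for x
  have FY: "F y = f y" if "y \<in> Y" for y
    using that by (simp add: F_def)
  have FK: "F (\<gamma> t) = g t" if "t \<in> topspace K" for t
  proof (cases "\<gamma> t \<in> Y")
    case True
    then show ?thesis using that by (simp add: FY compat)
  next
    case False
    let ?u = "SOME u. u \<in> topspace K \<and> \<gamma> u = \<gamma> t"
    have "?u \<in> topspace K \<and> \<gamma> ?u = \<gamma> t"
      by (rule someI[of _ t]) (use that in auto)
    then have "g ?u = g t"
      using inj that by blast
    with False show ?thesis by (simp add: F_def)
  qed
  have Ysub: "Y \<subseteq> topspace X"
    using assms(2) closedin_subset by blast
  \<comment> \<open>A continuous map from a compact space to a Hausdorff space is closed. With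
    \<open>Y\<close> closed as well, \<open>X\<close> carries the quotient topology of the disjoint
    union of \<open>Y\<close> and \<open>K\<close>, so preimages of closed sets can be tested on the
    two pieces.\<close>
  have "closed_map K X \<gamma>"
    using assms continuous_imp_closed_map by blast
  have "continuous_map X Z F"
    unfolding continuous_map_closedin
  proof (intro conjI allI impI funcsetI)
    fix x assume "x \<in> topspace X"
    then consider "x \<in> Y" | t where "t \<in> topspace K" "x = \<gamma> t"
      using cover by auto
    then show "F x \<in> topspace Z"
    proof cases
      case 1
      then show ?thesis
        using FY f Ysub by (fastforce simp: continuous_map_def Pi_iff)
    next
      case 2
      then show ?thesis
        using FK g by (fastforce simp: continuous_map_def Pi_iff)
    qed
  next
    fix C assume C: "closedin Z C"
    have "closedin (subtopology X Y) {x \<in> topspace (subtopology X Y). f x \<in> C}"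
      using C f by (simp add: continuous_map_closedin)
    then have 1: "closedin X {x \<in> topspace (subtopology X Y). f x \<in> C}"
      using assms(2) closedin_trans_full by blast
    have 2: "closedin X (\<gamma> ` {t \<in> topspace K. g t \<in> C})"
      using C g \<open>closed_map K X \<gamma>\<close> by (simp add: continuous_map_closedin closed_map_def)
    have "{x \<in> topspace X. F x \<in> C} = {x \<in> topspace (subtopology X Y). f x \<in> C} \<union> \<gamma> ` {t \<in> topspace K. g t \<in> C}"
      using cover Ysub by (auto simp: FY FK image_iff)
    then show "closedin X {x \<in> topspace X. F x \<in> C}"
      using 1 2 by auto
  qed
  then show thesis
    using that FY FK by blast
qed

text \<open>The deformation of \<open>K\<close> is stationary on the parameters lying over
  \<open>Y\<close>, and a point outside \<open>Y\<close> has only one parameter; so it descends to a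
  deformation of \<open>X\<close> that fixes \<open>Y\<close> and ends in \<open>Y\<close>.
  Continuity on the product with the unit interval is again a gluing.\<close>

lemma homology_group_deform_cell:
  assumes "Hausdorff_space X" "closedin X Y" "compact_space K" "continuous_map K X \<gamma>"
    and cover: "topspace X = Y \<union> \<gamma> ` topspace K"
    and inj: "\<And>t u. t \<in> topspace K \<Longrightarrow> u \<in> topspace K \<Longrightarrow> \<gamma> t = \<gamma> u \<Longrightarrow> \<gamma> t \<notin> Y \<Longrightarrow> t = u"
    and \<phi>: "continuous_map (prod_topology (top_of_set {0..1::real}) K) K \<phi>"
    and \<phi>0: "\<And>t. t \<in> topspace K \<Longrightarrow> \<phi> (0,t) = t"
    and \<phi>1: "\<And>t. t \<in> topspace K \<Longrightarrow> \<gamma> (\<phi> (1,t)) \<in> Y"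
    and \<phi>Y: "\<And>s t. t \<in> topspace K \<Longrightarrow> \<gamma> t \<in> Y \<Longrightarrow> s \<in> {0..1} \<Longrightarrow> \<phi> (s,t) = t"
  shows "homology_group p X \<cong> homology_group p (subtopology X Y)"
proof -
  let ?I = "top_of_set {0..1::real}"
  have Ysub: "Y \<subseteq> topspace X"
    using assms(2) closedin_subset by blast
  have sub: "subtopology (prod_topology ?I X) ({0..1} \<times> Y) = prod_topology ?I (subtopology X Y)"
    by (simp add: prod_topology_subtopology subtopology_subtopology inf_commute Times_Int_Times)
  obtain H where H: "continuous_map (prod_topology ?I X) X H"
    and HY: "\<And>z. z \<in> {0..1} \<times> Y \<Longrightarrow> H z = snd z"
    and HK: "\<And>z. z \<in> topspace (prod_topology ?I K) \<Longrightarrow> H ((\<lambda>(s,t). (s, \<gamma> t)) z) = (\<gamma> \<circ> \<phi>) z"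
  proof (rule glue_continuous_map[of "prod_topology ?I X" "{0..1} \<times> Y" "prod_topology ?I K" "\<lambda>(s,t). (s, \<gamma> t)" X snd "\<gamma> \<circ> \<phi>"])
    show "Hausdorff_space (prod_topology ?I X)"
      by (simp add: Hausdorff_space_prod_topology assms Hausdorff_space_subtopology)
    show "closedin (prod_topology ?I X) ({0..1} \<times> Y)"
      by (simp add: closedin_prod_Times_iff assms)
    show "compact_space (prod_topology ?I K)"
      by (simp add: compact_space_prod_topology assms compact_space_subtopology)
    show "continuous_map (prod_topology ?I K) (prod_topology ?I X) (\<lambda>(s, t). (s, \<gamma> t))"
      using assms(4) by (simp add: continuous_map_prod_top)
    show "topspace (prod_topology ?I X) = {0..1} \<times> Y \<union> (\<lambda>(s, t). (s, \<gamma> t)) ` topspace (prod_topology ?I K)"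
      using cover by (auto simp: image_iff)
    show "continuous_map (subtopology (prod_topology ?I X) ({0..1} \<times> Y)) X snd"
      by (simp add: continuous_map_from_subtopology continuous_map_snd)
    show "continuous_map (prod_topology ?I K) X (\<gamma> \<circ> \<phi>)"
      using \<phi> assms(4) continuous_map_compose by blast
  next
    fix t assume "t \<in> topspace (prod_topology ?I K)" "(case t of (s, t) \<Rightarrow> (s, \<gamma> t)) \<in> {0..1} \<times> Y"
    then show "(\<gamma> \<circ> \<phi>) t = snd (case t of (s, t) \<Rightarrow> (s, \<gamma> t))"
      by (auto simp: \<phi>Y)
  next
    fix t u assume "t \<in> topspace (prod_topology ?I K)" "u \<in> topspace (prod_topology ?I K)"
     "(case t of (s, t) \<Rightarrow> (s, \<gamma> t)) = (case u of (s, t) \<Rightarrow> (s, \<gamma> t))"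
    then show "(\<gamma> \<circ> \<phi>) t = (\<gamma> \<circ> \<phi>) u"
      using inj \<phi>Y by (auto split: prod.splits) (metis atLeastAtMost_iff)
  qed blast
  have H0: "H (0,x) = x" if "x \<in> topspace X" for x
    using that cover HY[of "(0,x)"] HK[of "(0,_)"] \<phi>0 by auto
  have H1: "H (1,x) \<in> Y" if "x \<in> topspace X" for x
    using that cover HY[of "(1,x)"] HK[of "(1,_)"] \<phi>1 by auto
  define r where "r x = H (1,x)" for x
  have contr: "continuous_map X X r"
  proof -
    have "continuous_map X (prod_topology ?I X) (\<lambda>x. (1,x))"
      by (simp add: continuous_map_pairwise o_def)
    then have "continuous_map X X (H \<circ> (\<lambda>x. (1,x)))"
      using H continuous_map_compose by blast
    then show ?thesis by (simp add: r_def[abs_def] o_def)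
  qed
  have ret: "retraction_maps X (subtopology X Y) r id"
    unfolding retraction_maps_def
    using contr H1 HY Ysub by (auto simp: continuous_map_in_subtopology r_def continuous_map_from_subtopology)
  have "homotopic_with (\<lambda>h. True) X X id r"
    unfolding homotopic_with_def
    \<comment> \<open>\<open>homotopic_with\<close> prescribes the values at times 0 and 1 at all
      points of the type, so \<open>H\<close> is redefined outside the product space.\<close>
    by (rule exI[of _ "\<lambda>z. if z \<in> topspace (prod_topology ?I X) then H z else (if fst z = 0 then snd z else r (snd z))"])
      (use H0 H in \<open>auto simp: r_def intro: continuous_map_eq\<close>)
  then have "homotopic_with (\<lambda>h. True) X X r id"
    by (simp add: homotopic_with_sym)
  then show ?thesis
    using deformation_retract_imp_isomorphic_homology_groups[OF ret] by blast
qed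

text \<open>Scaling the parameter by \<open>1 - s\<close> pulls the arc back to its foot
  \<open>\<gamma> 0\<close>, and 0 is the only parameter lying over \<open>Y\<close>.\<close>

lemma homology_group_attach_leaf:
  assumes "Hausdorff_space X" "closedin X Y" "continuous_map (top_of_set {0..1::real}) X \<gamma>"
    and cover: "topspace X = Y \<union> \<gamma> ` {0..1}"
    and "\<gamma> 0 \<in> Y" "\<And>t. t \<in> {0<..1} \<Longrightarrow> \<gamma> t \<notin> Y" "inj_on \<gamma> {0<..1}"
  shows "homology_group p X \<cong> homology_group p (subtopology X Y)"
proof (rule homology_group_deform_cell[where K = "top_of_set {0..1::real}" and \<gamma> = \<gamma> and \<phi> = "\<lambda>(s,t). (1 - s) * t"])
  have Y0: "t = 0" if "t \<in> {0..1}" "\<gamma> t \<in> Y" for t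
    using assms(6)[of t] that by (cases "t = 0") auto
  show "continuous_map (prod_topology (top_of_set {0..1}) (top_of_set {0..1::real})) (top_of_set {0..1::real}) (\<lambda>(s, t). (1 - s) * t)"
    by (auto simp: prod_topology_subtopology_eu continuous_map_in_subtopology case_prod_unfold mult_le_one
        intro!: continuous_intros)
  show "t = u" if "t \<in> topspace (top_of_set {0..1})" "u \<in> topspace (top_of_set {0..1})"
     "\<gamma> t = \<gamma> u" "\<gamma> t \<notin> Y" for t u :: real
    using that assms(5,7) by (cases "t = 0"; cases "u = 0") (auto simp: inj_on_def)
  show "(case (s, t) of (s, t) \<Rightarrow> (1 - s) * t) = t" if "t \<in> topspace (top_of_set {0..1})" "\<gamma> t \<in> Y" "s \<in> {0..1}" for s t :: real
    using Y0[of t] that by auto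
qed (use assms in \<open>auto simp: compact_space_subtopology\<close>)

text \<open>Each interval contracts to its inner end point, so the set has the homotopy type of the
  0-sphere: \<open>f\<close> records the interval as a sign, and \<open>g\<close> turns the sign
  back into \<open>1/3\<close> or \<open>2/3\<close>.\<close>

lemma reduced_homology_group_two_intervals:
  fixes A :: "real set"
  assumes A: "A = {0<..1/3} \<union> {2/3..<1}"
  shows "reduced_homology_group 0 (top_of_set A) \<cong> integer_group"
proof -
  define f :: "real \<Rightarrow> nat \<Rightarrow> real" where "f x = (\<lambda>i. if i = 0 then (if x \<le> 1/2 then -1 else 1) else 0)" for x
  define g :: "(nat \<Rightarrow> real) \<Rightarrow> real" where "g y = 1/2 + y 0 / 6" for y
  have cs: "continuous_on A (\<lambda>x. if x \<le> 1/2 then -1 else (1::real))"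
    unfolding A
  proof (rule continuous_on_cases_local)
    show "closedin (top_of_set ({0<..1 / 3} \<union> {2 / 3..<1})) {0<..1 / 3::real}"
      unfolding closedin_closed by (rule exI[of _ "{..1/2}"]) auto
    show "closedin (top_of_set ({0<..1 / 3} \<union> {2 / 3..<1})) {2 / 3..<1::real}"
      unfolding closedin_closed by (rule exI[of _ "{1/2..}"]) auto
  qed auto
  have y0: "y 0 = 1 \<or> y 0 = -1" "\<And>i. i > 0 \<Longrightarrow> y i = 0" if "y \<in> topspace (nsphere 0)" for y
    using that by (auto simp: nsphere power2_eq_1_iff)
  have contf: "continuous_map (top_of_set A) (nsphere 0) f"
    using cs by (auto simp: continuous_map_in_subtopology nsphere f_def continuous_map_componentwise_UNIV)
  have contg: "continuous_map (nsphere 0) (top_of_set A) g"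
    unfolding continuous_map_in_subtopology
  proof
    show "continuous_map (nsphere 0) euclidean g"
      unfolding g_def[abs_def] by (intro continuous_intros continuous_map_nsphere_projection) auto
    have "g y \<in> A" if "y \<in> topspace (nsphere 0)" for y
      using y0(1)[OF that] by (auto simp: g_def A)
    then show "g \<in> topspace (nsphere 0) \<rightarrow> A" by blast
  qed
  have fg: "(f \<circ> g) y = y" if "y \<in> topspace (nsphere 0)" for y
    using y0[OF that] by (force simp: f_def g_def)
  have "homotopic_with_canon (\<lambda>x. True) A A (g \<circ> f) id"
  proof (rule homotopic_with_linear)
    show "continuous_on A (g \<circ> f)"
      using continuous_map_compose[OF contf contg] by (simp add: continuous_map_in_subtopology)
    show "closed_segment ((g \<circ> f) x) (id x) \<subseteq> A" if "x \<in> A" for x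
    proof (cases "x \<le> 1/2")
      case True
      then have "(g \<circ> f) x \<in> {0<..1/3}" "id x \<in> {0<..1/3}"
        using that by (auto simp: A g_def f_def)
      then have "closed_segment ((g \<circ> f) x) (id x) \<subseteq> {0<..1/3}"
        by (intro closed_segment_subset) auto
      then show ?thesis using A by auto
    next
      case False
      then have "(g \<circ> f) x \<in> {2/3..<1}" "id x \<in> {2/3..<1}"
        using that by (auto simp: A g_def f_def)
      then have "closed_segment ((g \<circ> f) x) (id x) \<subseteq> {2/3..<1}"
        by (intro closed_segment_subset) auto
      then show ?thesis using A by auto
    qed
  qed auto
  moreover have "homotopic_with (\<lambda>x. True) (nsphere 0) (nsphere 0) (f \<circ> g) id"
    using fg continuous_map_compose[OF contg contf] by (intro homotopic_with_equal) auto
  ultimately have "top_of_set A homotopy_equivalent_space nsphere 0"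
    unfolding homotopy_equivalent_space_def using contf contg by blast
  then have "reduced_homology_group 0 (top_of_set A) \<cong> reduced_homology_group 0 (nsphere 0)"
    by (rule homotopy_equivalent_space_imp_isomorphic_reduced_homology_groups)
  also have "\<dots> \<cong> integer_group"
    using reduced_homology_group_nsphere(1)[of 0] by simp
  finally show ?thesis .
qed

text \<open>The open interval is contractible, so the connecting map of the pair identifies this
  group with the reduced \<open>H\<^sub>0\<close> of the two end pieces.\<close>

lemma relative_homology_interval:
  "relative_homology_group 1 (top_of_set {0<..<1::real}) ({0<..1/3} \<union> {2/3..<1}) \<cong> integer_group"
proof -
  let ?A = "{0<..1/3} \<union> {2/3..<1::real}"
  have "contractible_space (top_of_set {0<..<1::real})"
    using convex_imp_contractible[of "{0<..<1::real}"] by (simp add: contractible_space_top_of_set)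
  moreover have "topspace (top_of_set {0<..<1::real}) \<inter> ?A \<noteq> {}"
  proof -
    have "1/3 \<in> topspace (top_of_set {0<..<1::real}) \<inter> ?A" by simp
    then show ?thesis by blast
  qed
  ultimately have "relative_homology_group 1 (top_of_set {0<..<1::real}) ?A
     \<cong> reduced_homology_group (1 - 1) (subtopology (top_of_set {0<..<1}) ?A)"
    by (rule isomorphic_group_relative_homology_of_contractible)
  also have "subtopology (top_of_set {0<..<1::real}) ?A = top_of_set ?A"
  proof -
    have "{0<..<1} \<inter> ?A = ?A" by auto
    then show ?thesis by (simp add: subtopology_subtopology)
  qed
  also have "reduced_homology_group (1 - 1) (top_of_set ?A) \<cong> integer_group"
    using reduced_homology_group_two_intervals[OF refl] by simp
  finally show ?thesis .
qed

text \<open>The conditions on the ends make \<open>{0<..<1}\<close> the full preimage of the open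
  arc, and a closed map stays closed when restricted to a full preimage. The two ends may coincide,
  so loops are covered.\<close>

lemma homeomorphic_map_open_arc:
  assumes "Hausdorff_space X" "continuous_map (top_of_set {0..1::real}) X \<gamma>" "inj_on \<gamma> {0<..<1}"
    and ends: "\<gamma> 0 \<notin> \<gamma> ` {0<..<1}" "\<gamma> 1 \<notin> \<gamma> ` {0<..<1}"
  shows "homeomorphic_map (top_of_set {0<..<1}) (subtopology X (\<gamma> ` {0<..<1})) \<gamma>"
proof -
  have "closed_map (top_of_set {0..1::real}) X \<gamma>"
    using assms continuous_imp_closed_map compact_space_subtopology compactin_euclidean_iff by blast
  moreover have "{t \<in> topspace (top_of_set {0..1}). \<gamma> t \<in> \<gamma> ` {0<..<1}} = {0<..<1}"
    using ends by (auto simp: less_le)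
  ultimately have "closed_map (subtopology (top_of_set {0..1}) {0<..<1}) (subtopology X (\<gamma> ` {0<..<1})) \<gamma>"
    by (rule closed_map_restriction)
  moreover have "subtopology (top_of_set {0..1}) {0<..<1::real} = top_of_set {0<..<1}"
    by (simp add: subtopology_subtopology) (metis inf.absorb2 greaterThanLessThan_subseteq_atLeastAtMost_iff order_refl)
  ultimately have "closed_map (top_of_set {0<..<1}) (subtopology X (\<gamma> ` {0<..<1})) \<gamma>"
    by simp
  moreover have "continuous_map (top_of_set {0<..<1}) X \<gamma>"
    using assms(2) by (rule continuous_map_from_subtopology_mono) auto
  moreover have "\<gamma> ` {0<..<1} \<subseteq> topspace X"
    using assms(2) by (auto simp: continuous_map_def)
  ultimately show ?thesis
    using assms(3) by (intro bijective_closed_imp_homeomorphic_map) (auto simp: continuous_map_in_subtopology)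
qed

lemma DirProd_iso_cong:
  "\<lbrakk>group G; G \<cong> G'; H \<cong> H'\<rbrakk> \<Longrightarrow> G \<times>\<times> H \<cong> G' \<times>\<times> H'"
  unfolding is_iso_def using group.DirProd_iso_set_trans by blast

text \<open>The closed subspace \<open>Y\<close> together with the two outer thirds of the arc is a retract of \<open>X\<close>,
  since the middle third can be sent to a path through \<open>Y\<close>; so \<open>H\<^sub>1(X)\<close> splits without any
  diagram chase.  The thirds leave room for excising \<open>Y\<close>.\<close>

lemma homology_group_attach_cycle:
  assumes "Hausdorff_space X" "closedin X Y" "continuous_map (top_of_set {0..1::real}) X \<gamma>"
    and cover: "topspace X = Y \<union> \<gamma> ` {0..1}"
    and ends: "\<gamma> 0 \<in> Y" "\<gamma> 1 \<in> Y" and disj: "\<And>t. t \<in> {0<..<1} \<Longrightarrow> \<gamma> t \<notin> Y"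
    and inj: "inj_on \<gamma> {0<..<1}" and pc: "path_connectedin X Y"
  shows "homology_group 1 X \<cong> homology_group 1 (subtopology X Y) \<times>\<times> integer_group"
proof -
  let ?I = "top_of_set {0..1::real}"
  define K where "K = {0..1/3} \<union> {2/3..1::real}"
  define S where "S = Y \<union> \<gamma> ` K"
  have Ysub: "Y \<subseteq> topspace X"
    using assms(2) closedin_subset by blast
  have im: "\<gamma> ` {0..1} \<subseteq> topspace X"
    using assms(3) by (auto simp: continuous_map_def)
  have Y01: "t = 0 \<or> t = 1" if "t \<in> {0..1}" "\<gamma> t \<in> Y" for t
    using that disj[of t] by force
  have inj': "t = u" if "t \<in> {0..1}" "u \<in> {0..1}" "\<gamma> t = \<gamma> u" "\<gamma> t \<notin> Y" for t u
  proof -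
    have "t \<in> {0<..<1}" "u \<in> {0<..<1}"
      using that ends by (auto simp: less_le)
    then show ?thesis using inj that by (simp add: inj_on_def)
  qed
  have cmap: "closed_map ?I X \<gamma>"
    using assms continuous_imp_closed_map compact_space_subtopology compactin_euclidean_iff by blast
  have cl: "closedin X (\<gamma> ` C)" if "closed C" "C \<subseteq> {0..1}" for C
    using cmap that by (simp add: closed_map_def closed_subset)
  have Kcl: "closed K" "K \<subseteq> {0..1}" "compact K"
    by (auto simp: K_def)
  have Scl: "closedin X S"
    unfolding S_def using cl[of K] Kcl assms(2) by auto
  have contK: "continuous_map (top_of_set A) X \<gamma>" if "A \<subseteq> {0..1}" for A
    using assms(3) that by (rule continuous_map_from_subtopology_mono)
  have pcA: "path_connectedin X (\<gamma> ` {a..b})" if "{a..b} \<subseteq> {0..1}" for a b :: real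
  proof (rule path_connectedin_continuous_map_image[OF assms(3)])
    show "path_connectedin (top_of_set {0..1}) {a..b}"
      using that by (auto simp: path_connectedin_subtopology convex_imp_path_connected)
  qed
  have pcS: "path_connectedin X S"
  proof -
    have "\<gamma> 0 \<in> Y \<inter> \<gamma> ` {0..1/3}" "\<gamma> 1 \<in> (Y \<union> \<gamma> ` {0..1/3}) \<inter> \<gamma> ` {2/3..1}"
      using ends by auto
    moreover have "{0..1/3} \<subseteq> {0..1::real}" "{2/3..1} \<subseteq> {0..1::real}"
      by auto
    ultimately have "path_connectedin X ((Y \<union> \<gamma> ` {0..1/3}) \<union> \<gamma> ` {2/3..1})"
      by (metis path_connectedin_Un pc pcA empty_iff)
    then show ?thesis by (simp add: S_def K_def image_Un Un_assoc)
  qed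
  have "S retract_of_space X"
  proof -
    have "\<gamma> (1/3) \<in> S" "\<gamma> (2/3) \<in> S"
      by (auto simp: S_def K_def)
    moreover have "path_connected_space (subtopology X S)"
      using pcS by (simp add: path_connectedin_def)
    moreover have "topspace (subtopology X S) = S"
      using Scl closedin_subset by fastforce
    ultimately obtain q where q: "pathin (subtopology X S) q" "q 0 = \<gamma> (1/3)" "q 1 = \<gamma> (2/3)"
      unfolding path_connected_space_def by blast
    \<comment> \<open>The substitution \<open>3 * t - 1\<close> rescales the middle third to the
      domain of the path \<open>q\<close>.\<close>
    have cq: "continuous_map (top_of_set {1/3..2/3::real}) (subtopology X S) (q \<circ> (\<lambda>t. 3 * t - 1))"
      using q(1) unfolding pathin_def
      by (intro continuous_map_compose[of _ "top_of_set {0..1}"]) (auto simp: continuous_map_in_subtopology intro!: continuous_intros)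
    have YS: "t = 1/3 \<or> t = 2/3" if "t \<in> {1/3..2/3}" "\<gamma> t \<in> S" for t
    proof -
      have t: "t \<in> {0..1}" using that by auto
      have "\<gamma> t \<notin> Y" using Y01[of t] that by auto
      with that obtain u where "u \<in> K" "\<gamma> t = \<gamma> u" by (auto simp: S_def)
      with inj'[OF t, of u] Kcl \<open>\<gamma> t \<notin> Y\<close> have "t \<in> K" by auto
      then show ?thesis using that by (auto simp: K_def)
    qed
    obtain F where "continuous_map X (subtopology X S) F" "\<And>y. y \<in> S \<Longrightarrow> F y = id y"
    proof (rule glue_continuous_map[of X S "top_of_set {1/3..2/3::real}" \<gamma> "subtopology X S" id "q \<circ> (\<lambda>t. 3 * t - 1)"])
      show "topspace X = S \<union> \<gamma> ` topspace (top_of_set {1 / 3..2 / 3})"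
      proof -
        have "{0..1} = K \<union> {1/3..2/3}" by (auto simp: K_def)
        then have "\<gamma> ` {0..1} = \<gamma> ` K \<union> \<gamma> ` {1/3..2/3}" by blast
        with cover show ?thesis by (auto simp: S_def)
      qed
      show "(q \<circ> (\<lambda>t. 3 * t - 1)) t = (q \<circ> (\<lambda>t. 3 * t - 1)) u"
        if "t \<in> topspace (top_of_set {1 / 3..2 / 3})" "u \<in> topspace (top_of_set {1 / 3..2 / 3})" "\<gamma> t = \<gamma> u" for t u
      proof -
        have "\<gamma> t \<notin> Y" using Y01[of t] that by auto
        with inj'[of t u] that have "t = u" by auto
        then show ?thesis by simp
      qed
      show "(q \<circ> (\<lambda>t. 3 * t - 1)) t = id (\<gamma> t)"
        if "t \<in> topspace (top_of_set {1 / 3..2 / 3})" "\<gamma> t \<in> S" for t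
      proof -
        have "t = 1/3 \<or> t = 2/3" using YS[of t] that by auto
        then show ?thesis by (elim disjE) (hypsubst, simp add: q)+
      qed
    qed (use assms Scl contK cq in \<open>auto simp: compact_space_subtopology\<close>)
    then show ?thesis
      unfolding retract_of_space_def using Scl closedin_subset by fastforce
  qed
  then have "homology_group 1 X \<cong> homology_group 1 (subtopology X S) \<times>\<times> relative_homology_group 1 X S"
    by (intro isomorphic_group_homology_group_prod_retract) auto
  moreover have "homology_group 1 (subtopology X S) \<cong> homology_group 1 (subtopology X Y)"
  proof -
    \<comment> \<open>\<open>c\<close> sends each outer third to the end of the arc on its side, so
      the linear homotopy from the identity to \<open>c\<close> stays in \<open>K\<close> and
      collapses both thirds into \<open>Y\<close>.\<close>
    define c where "c t = (if t \<le> 1/2 then 0 else 1::real)" for t :: real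
    have cc: "continuous_on K c"
      unfolding K_def c_def
    proof (rule continuous_on_cases_local)
      show "closedin (top_of_set ({0..1 / 3} \<union> {2 / 3..1})) {0..1 / 3::real}"
        unfolding closedin_closed by (rule exI[of _ "{..1/2}"]) auto
      show "closedin (top_of_set ({0..1 / 3} \<union> {2 / 3..1})) {2 / 3..1::real}"
        unfolding closedin_closed by (rule exI[of _ "{1/2..}"]) auto
    qed auto
    have "homology_group 1 (subtopology X S) \<cong> homology_group 1 (subtopology (subtopology X S) Y)"
    proof (rule homology_group_deform_cell[where K = "top_of_set K" and \<gamma> = \<gamma> and \<phi> = "\<lambda>(s,t). (1 - s) * t + s * c t"])
      show "Hausdorff_space (subtopology X S)"
        using assms(1) by (rule Hausdorff_space_subtopology)
      show "closedin (subtopology X S) Y"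
        using assms(2) by (simp add: closedin_subset_topspace S_def)
      show "compact_space (top_of_set K)"
        using Kcl by (simp add: compact_space_subtopology)
      show "continuous_map (top_of_set K) (subtopology X S) \<gamma>"
        using contK[of K] Kcl by (auto simp: continuous_map_in_subtopology S_def)
      show "topspace (subtopology X S) = Y \<union> \<gamma> ` topspace (top_of_set K)"
        using Scl closedin_subset by (fastforce simp: S_def)
      show "t = u" if "t \<in> topspace (top_of_set K)" "u \<in> topspace (top_of_set K)" "\<gamma> t = \<gamma> u" "\<gamma> t \<notin> Y" for t u
        using that Kcl(2) inj'[of t u] by (auto simp: subset_iff)
      show "continuous_map (prod_topology (top_of_set {0..1}) (top_of_set K)) (top_of_set K) (\<lambda>(s, t). (1 - s) * t + s * c t)"
      proof -
        have "continuous_on ({0..1} \<times> K) (\<lambda>z. c (snd z))"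
          by (rule continuous_on_compose2[OF cc continuous_on_snd]) (auto intro!: continuous_intros)
        moreover have "(1 - s) * t + s * c t \<in> K" if "0 \<le> s" "s \<le> 1" "t \<in> K" for s t
        proof (cases "t \<le> 1/2")
          case True
          have "(1 - s) * t \<le> 1 * (1/3)"
            by (rule mult_mono) (use that True in \<open>auto simp: K_def\<close>)
          moreover have "0 \<le> (1 - s) * t"
            using that by (auto simp: K_def)
          ultimately show ?thesis using True by (auto simp: K_def c_def)
        next
          case False
          have "(1 - s) * (1 - t) \<le> 1 * (1/3)"
            by (rule mult_mono) (use that False in \<open>auto simp: K_def\<close>)
          moreover have "0 \<le> (1 - s) * (1 - t)"
            using that by (auto simp: K_def)
          ultimately show ?thesis using False by (auto simp: K_def c_def algebra_simps)
        qed
        ultimately show ?thesis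
          by (auto simp: prod_topology_subtopology_eu continuous_map_in_subtopology case_prod_unfold
             intro!: continuous_intros)
      qed
      show "\<gamma> (case (1, t) of (s, t) \<Rightarrow> (1 - s) * t + s * c t) \<in> Y" if "t \<in> topspace (top_of_set K)" for t
        using ends by (simp add: c_def)
      show "(case (s, t) of (s, t) \<Rightarrow> (1 - s) * t + s * c t) = t"
        if "t \<in> topspace (top_of_set K)" "\<gamma> t \<in> Y" "s \<in> {0..1}" for s t
        using Y01[of t] Kcl(2) that by (auto simp: c_def subset_iff)
    qed auto
    moreover have "subtopology (subtopology X S) Y = subtopology X Y"
      by (simp add: subtopology_subtopology S_def inf.absorb2)
    ultimately show ?thesis by simp
  qed
  moreover have "relative_homology_group 1 X S \<cong> integer_group"
  proof -
    have oa: "\<gamma> ` {0<..<1} = topspace X - Y"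
      using cover ends disj im by (force simp: less_le)
    have "hom_induced 1 (subtopology X (topspace X - Y)) (S - Y) (subtopology X (topspace X)) S id
      \<in> iso (relative_homology_group 1 (subtopology X (topspace X - Y)) (S - Y))
            (relative_homology_group 1 (subtopology X (topspace X)) S)"
    proof (rule homology_excision_axiom)
      \<comment> \<open>The complement of the closed middle third is an open set between
        \<open>Y\<close> and \<open>S\<close>; this is the room that excision of \<open>Y\<close>
        asks for.\<close>
      let ?O = "topspace X - \<gamma> ` {1/3..2/3}"
      have "openin X ?O"
        using cl[of "{1/3..2/3}"] by auto
      moreover have "?O \<subseteq> S"
      proof -
        have "{0..1} = K \<union> {1/3..2/3}" by (auto simp: K_def)
        then have "\<gamma> ` {0..1} = \<gamma> ` K \<union> \<gamma> ` {1/3..2/3}" by blast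
        with cover show ?thesis by (auto simp: S_def)
      qed
      moreover have "Y \<subseteq> ?O"
      proof
        fix y assume "y \<in> Y"
        moreover have "y \<noteq> \<gamma> t" if "t \<in> {1/3..2/3}" for t
          using Y01[of t] that \<open>y \<in> Y\<close> by auto
        ultimately show "y \<in> ?O" using Ysub by blast
      qed
      ultimately have "Y \<subseteq> X interior_of S"
        by (meson interior_of_maximal subset_trans)
      then show "X closure_of Y \<subseteq> X interior_of S"
        using assms(2) by (simp add: closure_of_closedin)
      show "S \<subseteq> topspace X"
        using Scl closedin_subset by blast
    qed
    then have 1: "relative_homology_group 1 (subtopology X (topspace X - Y)) (S - Y) \<cong> relative_homology_group 1 X S"
      unfolding subtopology_topspace by (rule is_isoI)
    have "homeomorphic_map (top_of_set {0<..<1}) (subtopology X (\<gamma> ` {0<..<1})) \<gamma>"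
      using assms disj ends by (intro homeomorphic_map_open_arc) auto
    then have "hom_induced 1 (top_of_set {0<..<1}) ({0<..1/3} \<union> {2/3..<1}) (subtopology X (\<gamma> ` {0<..<1})) (S - Y) \<gamma>
       \<in> iso (relative_homology_group 1 (top_of_set {0<..<1}) ({0<..1/3} \<union> {2/3..<1}))
             (relative_homology_group 1 (subtopology X (\<gamma> ` {0<..<1})) (S - Y))"
    proof (rule homeomorphic_map_relative_homology_iso)
      have "{0<..1/3} \<union> {2/3..<1} = {t \<in> K. \<gamma> t \<notin> Y}"
        using disj ends by (auto simp: K_def less_le)
      then show "\<gamma> ` ({0<..1/3} \<union> {2/3..<1}) = S - Y"
        by (auto simp: S_def)
    qed auto
    then have "relative_homology_group 1 (top_of_set {0<..<1::real}) ({0<..1/3} \<union> {2/3..<1})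
      \<cong> relative_homology_group 1 (subtopology X (topspace X - Y)) (S - Y)"
      unfolding oa[symmetric] by (rule is_isoI)
    then show ?thesis
      using 1 relative_homology_interval by (meson group.iso_sym group_relative_homology_group iso_trans)
  qed
  ultimately show ?thesis
    by (rule iso_trans[OF _ DirProd_iso_cong[OF group_relative_homology_group]])
qed

lemma free_Abelian_group_Suc:
  assumes "A \<cong> free_Abelian_group {..<n}" and "group A"
  shows "A \<times>\<times> integer_group \<cong> free_Abelian_group {..<Suc n}"
proof -
  have "A \<times>\<times> integer_group \<cong> free_Abelian_group {..<n} \<times>\<times> integer_group"
    using DirProd_iso_cong[OF assms(2,1)] iso_refl by blast
  also have "\<dots> \<cong> free_Abelian_group {..<Suc n}"
  proof -
    let ?h = "\<lambda>(a, k). a + frag_cmul k (frag_of n)"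
    have closed: "?h x \<in> carrier (free_Abelian_group {..<Suc n})" if "x \<in> carrier (free_Abelian_group {..<n} \<times>\<times> integer_group)" for x
      using that keys_add[of "fst x" "frag_cmul (snd x) (frag_of n)"] keys_cmul[of "snd x" "frag_of n"]
      by (fastforce simp: DirProd_def case_prod_unfold)
    have "?h \<in> iso (free_Abelian_group {..<n} \<times>\<times> integer_group) (free_Abelian_group {..<Suc n})"
    proof (rule isoI [OF homI])
      fix x y assume "x \<in> carrier (free_Abelian_group {..<n} \<times>\<times> integer_group)"
        "y \<in> carrier (free_Abelian_group {..<n} \<times>\<times> integer_group)"
      then show "?h (x \<otimes>\<^bsub>free_Abelian_group {..<n} \<times>\<times> integer_group\<^esub> y) = ?h x \<otimes>\<^bsub>free_Abelian_group {..<Suc n}\<^esub> ?h y"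
        by (auto simp: frag_cmul_distrib algebra_simps)
    next
      have "\<exists>x \<in> carrier (free_Abelian_group {..<n} \<times>\<times> integer_group). ?h x = c"
        if "c \<in> carrier (free_Abelian_group {..<Suc n})" for c
      proof -
        let ?k = "Poly_Mapping.lookup c n"
        let ?a = "c - frag_cmul ?k (frag_of n)"
        have "Poly_Mapping.keys ?a \<subseteq> {..<n}"
          using that by (auto simp: in_keys_iff lookup_minus subset_iff less_Suc_eq split: if_splits)
        then show ?thesis
          by (intro bexI[of _ "(?a, ?k)"]) (auto simp: DirProd_def integer_group_def)
      qed
      moreover have "inj_on ?h (carrier (free_Abelian_group {..<n} \<times>\<times> integer_group))"
      proof (rule inj_onI, clarsimp)
        fix a k b l
        assume ab: "Poly_Mapping.keys (a::nat \<Rightarrow>\<^sub>0 int) \<subseteq> {..<n}" "Poly_Mapping.keys b \<subseteq> {..<n}"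
          and eq: "a + frag_cmul k (frag_of n) = b + frag_cmul l (frag_of n)"
        have "Poly_Mapping.lookup a n = 0" "Poly_Mapping.lookup b n = 0"
          using ab by (auto simp: in_keys_iff subset_iff)
        with arg_cong[OF eq, of "\<lambda>c. Poly_Mapping.lookup c n"] have "k = l"
          by (simp add: lookup_add)
        with eq show "a = b \<and> k = l" by simp
      qed
      moreover note closed
      ultimately show "bij_betw ?h (carrier (free_Abelian_group {..<n} \<times>\<times> integer_group)) (carrier (free_Abelian_group {..<Suc n}))"
        unfolding bij_betw_def by (intro conjI subset_antisym image_subsetI) (assumption, blast, metis (no_types, lifting) image_eqI subsetI)
    qed (use closed in blast)
    then show ?thesis unfolding is_iso_def by blast
  qed
  finally show ?thesis .
qed

section \<open>The first Betti number of a finite topological graph\<close>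

text \<open>Isomorphic free abelian groups have bases of the same size, so the definite description
  in \<open>betti1\<close> is settled by any one basis.\<close>

lemma betti1_eqI:
  assumes "homology_group 1 X \<cong> free_Abelian_group {..<n}"
  shows "betti1 X = n"
  unfolding betti1_def
proof (rule the_equality)
  show "\<exists>S::nat set. finite S \<and> card S = n \<and> homology_group 1 X \<cong> free_Abelian_group S"
    using assms by (intro exI[of _ "{..<n}"]) auto
next
  fix m assume "\<exists>S::nat set. finite S \<and> card S = m \<and> homology_group 1 X \<cong> free_Abelian_group S"
  then obtain S :: "nat set" where S: "finite S" "card S = m" "homology_group 1 X \<cong> free_Abelian_group S"
    by blast
  then have "free_Abelian_group S \<cong> free_Abelian_group {..<n}"
    using assms group.iso_sym iso_trans group_relative_homology_group by blast
  then have "S \<approx> {..<n}"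
    by (simp add: isomorphic_free_Abelian_groups)
  then show "m = n"
    using S by (metis card_lessThan finite_lessThan eqpoll_iff_card)
qed

lemma homology_group_1_singleton:
  assumes "topspace X = {a}"
  shows "homology_group 1 X \<cong> free_Abelian_group {..<0::nat}"
proof -
  have "trivial_group (homology_group 1 X)"
    using assms by (rule homology_dimension_axiom) simp
  moreover have "trivial_group (free_Abelian_group {..<0::nat})"
    using group_free_Abelian_group[of "{..<0::nat}"] by (simp add: trivial_group_def free_Abelian_group_def)
  ultimately show ?thesis
    by (intro is_isoI[of "\<lambda>_. 0"])
      (auto simp: trivial_group_def iso_def hom_def bij_betw_def group.is_monoid dest: monoid.one_closed)
qed

text \<open>A finite one-dimensional cell structure with 0-cells \<open>W\<close> and open 1-cells
  indexed by \<open>E\<close>. Injectivity and disjointness concern the open arcs only, so loops and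
  parallel arcs are allowed. Closed arcs are compact in a Hausdorff space, hence the topology is
  that of the cell complex.\<close>

locale graph_space =
  fixes X :: "'a topology" and W :: "'a set" and E :: "'e set" and \<gamma> :: "'e \<Rightarrow> real \<Rightarrow> 'a"
  assumes Hausdorff: "Hausdorff_space X"
    and finite_W: "finite W" and finite_E: "finite E" and W_sub: "W \<subseteq> topspace X"
    and path: "e \<in> E \<Longrightarrow> continuous_map (top_of_set {0..1}) X (\<gamma> e)"
    and ends_in_W: "e \<in> E \<Longrightarrow> \<gamma> e 0 \<in> W" "e \<in> E \<Longrightarrow> \<gamma> e 1 \<in> W"
    and arc_W: "e \<in> E \<Longrightarrow> t \<in> {0<..<1} \<Longrightarrow> \<gamma> e t \<notin> W"
    and arc_inj: "e \<in> E \<Longrightarrow> e' \<in> E \<Longrightarrow> t \<in> {0<..<1} \<Longrightarrow> t' \<in> {0<..<1} \<Longrightarrow> \<gamma> e t = \<gamma> e' t' \<Longrightarrow> e = e' \<and> t = t'"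
    and cover: "topspace X \<subseteq> W \<union> (\<Union>e\<in>E. \<gamma> e ` {0<..<1})"
begin

definition oarc :: "'e \<Rightarrow> 'a set" where "oarc e = \<gamma> e ` {0<..<1}"
definition carc :: "'e \<Rightarrow> 'a set" where "carc e = \<gamma> e ` {0..1}"
definition ends :: "'e \<Rightarrow> 'a set" where "ends e = {\<gamma> e 0, \<gamma> e 1}"
definition span :: "'a set \<Rightarrow> 'e set \<Rightarrow> 'a set" where "span W' E' = W' \<union> (\<Union>e\<in>E'. carc e)"

lemma carc_eq: "carc e = ends e \<union> oarc e"
proof -
  have "{0..1} = {0,1} \<union> {0<..<1::real}" by auto
  then show ?thesis by (auto simp: carc_def ends_def oarc_def)
qed

lemma ends_W: "e \<in> E \<Longrightarrow> ends e \<subseteq> W"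
  using ends_in_W by (auto simp: ends_def)

lemma oarc_W: "e \<in> E \<Longrightarrow> oarc e \<inter> W = {}"
  using arc_W by (auto simp: oarc_def)

lemma oarc_disjoint: "e \<in> E \<Longrightarrow> e' \<in> E \<Longrightarrow> x \<in> oarc e \<Longrightarrow> x \<in> oarc e' \<Longrightarrow> e = e'"
  using arc_inj by (auto simp: oarc_def)

lemma oarc_nonempty: "oarc e \<noteq> {}"
  by (auto simp: oarc_def)

lemma carc_sub: "e \<in> E \<Longrightarrow> carc e \<subseteq> topspace X"
  using path[of e] by (auto simp: carc_def continuous_map_def)

lemma oarc_sub: "e \<in> E \<Longrightarrow> oarc e \<subseteq> topspace X"
  using carc_sub carc_eq by blast

lemma topspace_eq: "topspace X = W \<union> (\<Union>e\<in>E. oarc e)"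
  using cover W_sub oarc_sub unfolding oarc_def by blast

lemma closed_carc: assumes "e \<in> E" shows "closedin X (carc e)"
proof -
  have "closed_map (top_of_set {0..1::real}) X (\<gamma> e)"
    using Hausdorff path[OF assms] continuous_imp_closed_map compact_space_subtopology compactin_euclidean_iff by blast
  then show ?thesis by (auto simp: closed_map_def carc_def)
qed

lemma span_alt:
  assumes "W' \<subseteq> W" "E' \<subseteq> E" "\<And>e. e \<in> E' \<Longrightarrow> ends e \<subseteq> W'"
  shows "span W' E' = W' \<union> (\<Union>e\<in>E'. oarc e)"
  using assms by (auto simp: span_def carc_eq)

lemma closed_span:
  assumes "W' \<subseteq> W" "E' \<subseteq> E"
  shows "closedin X (span W' E')"
proof -
  have "closedin X W'"
    using Hausdorff assms W_sub finite_W
    by (meson Hausdorff_imp_t1_space finite_subset t1_space_closedin_finite order_trans)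
  moreover have "finite E'"
    using assms(2) finite_E by (rule finite_subset)
  ultimately show ?thesis
    unfolding span_def using closed_carc assms
    by (intro closedin_Un closedin_Union) auto
qed

lemma span_all: "span W E = topspace X"
  using span_alt[of W E] ends_W topspace_eq by auto

lemma inj_on_arc: "e \<in> E \<Longrightarrow> inj_on (\<gamma> e) {0<..<1}"
  using arc_inj by (auto simp: inj_on_def)

lemma homeomorphic_oarc:
  assumes "e \<in> E" shows "homeomorphic_map (top_of_set {0<..<1}) (subtopology X (oarc e)) (\<gamma> e)"
proof -
  have "\<gamma> e 0 \<notin> oarc e" "\<gamma> e 1 \<notin> oarc e"
    using ends_in_W[OF assms] oarc_W[OF assms] by blast+
  then show ?thesis
    unfolding oarc_def using Hausdorff path[OF assms] inj_on_arc[OF assms] homeomorphic_map_open_arc by blast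
qed

lemma openin_oarc: assumes "e \<in> E" shows "openin X (oarc e)"
proof -
  have "oarc e = topspace X - span W (E - {e})"
  proof -
    have "span W (E - {e}) = W \<union> (\<Union>e'\<in>E - {e}. oarc e')"
      by (rule span_alt) (use ends_W in auto)
    then show ?thesis
      using oarc_W[OF assms] oarc_disjoint[OF assms] assms unfolding topspace_eq by blast
  qed
  then show ?thesis
    using closed_span[of W "E - {e}"] by auto
qed

lemma connected_oarc: assumes "e \<in> E" shows "connectedin X (oarc e)"
proof -
  have "connectedin (top_of_set {0..1}) {0<..<1::real}"
    by (auto simp: connectedin_subtopology)
  then show ?thesis
    unfolding oarc_def using path[OF assms] connectedin_continuous_map_image by blast
qed

lemma path_connected_carc: assumes "e \<in> E" shows "path_connectedin X (carc e)"
proof -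
  have "path_connectedin (top_of_set {0..1}) {0..1::real}"
    by (auto simp: path_connectedin_subtopology convex_imp_path_connected)
  then show ?thesis
    unfolding carc_def using path[OF assms] path_connectedin_continuous_map_image by blast
qed

text \<open>The open arcs partition the complement of \<open>W\<close> into open sets, so a
  connected set that avoids \<open>W\<close> cannot meet two of them.\<close>

lemma connected_sub_oarc:
  assumes "connectedin X S" "S \<inter> W = {}" "e \<in> E" "x \<in> S" "x \<in> oarc e"
  shows "S \<subseteq> oarc e"
proof (rule ccontr)
  assume "\<not> S \<subseteq> oarc e"
  let ?B = "\<Union>e'\<in>E - {e}. oarc e'"
  have "openin X (oarc e)" "openin X ?B"
    using openin_oarc assms(3) by auto
  moreover have "S \<subseteq> oarc e \<union> ?B"
    using assms connectedin_subset_topspace topspace_eq by fastforce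
  moreover have "oarc e \<inter> ?B \<inter> S = {}"
    using oarc_disjoint assms(3) by blast
  moreover have "oarc e \<inter> S \<noteq> {}" "?B \<inter> S \<noteq> {}"
    using assms \<open>\<not> S \<subseteq> oarc e\<close> \<open>S \<subseteq> oarc e \<union> ?B\<close> by auto
  ultimately show False
    using assms(1) unfolding connectedin by blast
qed

text \<open>This is the only passage from topological to combinatorial connectedness: if no arc
  leaves \<open>U\<close>, then \<open>U\<close> with its arcs and \<open>W - U\<close> with its
  arcs are disjoint closed sets covering \<open>X\<close>.\<close>

lemma connected_vertices:
  assumes conn: "connected_space X" and U: "U \<subseteq> W" "U \<noteq> {}"
    and cl: "\<And>e. e \<in> E \<Longrightarrow> \<gamma> e 0 \<in> U \<longleftrightarrow> \<gamma> e 1 \<in> U"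
  shows "U = W"
proof -
  define E1 where "E1 = {e\<in>E. \<gamma> e 0 \<in> U}"
  have s1: "span U E1 = U \<union> (\<Union>e\<in>E1. oarc e)"
    by (rule span_alt) (use U cl in \<open>auto simp: E1_def ends_def\<close>)
  have s2: "span (W - U) (E - E1) = (W - U) \<union> (\<Union>e\<in>E - E1. oarc e)"
    by (rule span_alt) (use U cl ends_in_W in \<open>auto simp: E1_def ends_def\<close>)
  have "E1 \<subseteq> E" by (auto simp: E1_def)
  have d: "span U E1 \<inter> span (W - U) (E - E1) = {}"
    unfolding s1 s2 using U(1) oarc_W oarc_disjoint \<open>E1 \<subseteq> E\<close> by blast
  have c: "topspace X \<subseteq> span U E1 \<union> span (W - U) (E - E1)"
    unfolding s1 s2 topspace_eq by blast
  have "span U E1 \<noteq> {}"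
    using U by (auto simp: span_def)
  then have "span (W - U) (E - E1) = {}"
    using conn d c closed_span[of U E1] closed_span[of "W - U" "E - E1"] U(1) \<open>E1 \<subseteq> E\<close>
    unfolding connected_space_closedin by blast
  then show ?thesis
    using U(1) by (auto simp: span_def)
qed

text \<open>The invariant of the growth argument. The rank formula is written additively because the
  counts are natural numbers.\<close>

definition good_subgraph :: "'a set \<Rightarrow> 'e set \<Rightarrow> bool" where
  "good_subgraph W' E' \<longleftrightarrow> W' \<subseteq> W \<and> W' \<noteq> {} \<and> E' \<subseteq> E \<and> (\<forall>e\<in>E'. ends e \<subseteq> W') \<and> path_connectedin X (span W' E') \<and>
     (\<exists>n. n + card W' = card E' + 1 \<and>
       homology_group 1 (subtopology X (span W' E')) \<cong> free_Abelian_group {..<n})"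

lemma good_subgraph_singleton: assumes "w \<in> W" shows "good_subgraph {w} {}"
proof -
  have "homology_group 1 (subtopology X {w}) \<cong> free_Abelian_group {..<0::nat}"
    using assms W_sub by (intro homology_group_1_singleton[of _ w]) auto
  then show ?thesis
    unfolding good_subgraph_def span_def using assms W_sub by (auto simp: path_connectedin_singleton)
qed

lemma good_subgraph_step:
  assumes g: "good_subgraph W' E'" and e: "e \<in> E" "e \<notin> E'" and inc: "ends e \<inter> W' \<noteq> {}"
  shows "good_subgraph (W' \<union> ends e) (insert e E')"
proof -
  define Y where "Y = span W' E'"
  define T where "T = span (W' \<union> ends e) (insert e E')"
  have W': "W' \<subseteq> W" "W' \<noteq> {}" and E': "E' \<subseteq> E" "\<And>e. e \<in> E' \<Longrightarrow> ends e \<subseteq> W'" and pcY: "path_connectedin X Y"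
    using g by (auto simp: good_subgraph_def Y_def)
  obtain n where n: "n + card W' = card E' + 1" "homology_group 1 (subtopology X Y) \<cong> free_Abelian_group {..<n}"
    using g by (auto simp: good_subgraph_def Y_def)
  have fin: "finite W'" "finite E'"
    using W'(1) E'(1) finite_W finite_E by (auto intro: finite_subset)
  have Yalt: "Y = W' \<union> (\<Union>e\<in>E'. oarc e)"
    unfolding Y_def using W' E' by (intro span_alt) auto
  have TY: "T = Y \<union> carc e"
    by (auto simp: T_def Y_def span_def carc_eq)
  have YT: "Y \<subseteq> T" using TY by blast
  have clT: "closedin X T" and clY: "closedin X Y"
    unfolding T_def Y_def using W' E' e ends_W[OF e(1)] by (auto intro!: closed_span)
  let ?Z = "subtopology X T"
  have Ztop: "topspace ?Z = Y \<union> \<gamma> e ` {0..1}"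
    using clT closedin_subset TY by (fastforce simp: carc_def)
  have sub: "subtopology ?Z Y = subtopology X Y"
    using YT by (simp add: subtopology_subtopology inf.absorb2)
  have HZ: "Hausdorff_space ?Z"
    using Hausdorff by (rule Hausdorff_space_subtopology)
  have clYZ: "closedin ?Z Y"
    using clY YT by (simp add: closedin_subset_topspace)
  have cont: "continuous_map (top_of_set {0..1}) ?Z (\<gamma> e)"
    using path[OF e(1)] TY by (auto simp: continuous_map_in_subtopology carc_def)
  have oY: "\<gamma> e t \<notin> Y" if "t \<in> {0<..<1}" for t
  proof -
    have "\<gamma> e t \<in> oarc e" using that by (auto simp: oarc_def)
    then show ?thesis
      unfolding Yalt using W' E' oarc_W oarc_disjoint e by blast
  qed
  have wY: "w \<in> Y \<longleftrightarrow> w \<in> W'" if "w \<in> W" for w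
    unfolding Yalt using that oarc_W E' by blast
  have pcT: "path_connectedin X T"
    unfolding TY
  proof (rule path_connectedin_Un[OF pcY path_connected_carc[OF e(1)]])
    show "Y \<inter> carc e \<noteq> {}"
      using inc Yalt carc_eq by blast
  qed
  have H: "\<exists>m. m + card (W' \<union> ends e) = card (insert e E') + 1 \<and> homology_group 1 ?Z \<cong> free_Abelian_group {..<m}"
  proof (cases "ends e \<subseteq> W'")
    case True
    have "homology_group 1 ?Z \<cong> homology_group 1 (subtopology ?Z Y) \<times>\<times> integer_group"
    proof (rule homology_group_attach_cycle[OF HZ clYZ cont Ztop])
      show "\<gamma> e 0 \<in> Y" "\<gamma> e 1 \<in> Y"
        using True Yalt by (auto simp: ends_def)
      show "inj_on (\<gamma> e) {0<..<1}" using inj_on_arc e(1) .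
      show "path_connectedin ?Z Y" using pcY YT by (simp add: path_connectedin_subtopology)
    qed (use oY in auto)
    then have "homology_group 1 ?Z \<cong> free_Abelian_group {..<Suc n}"
      using free_Abelian_group_Suc[OF n(2)] iso_trans by (auto simp: sub)
    moreover have "W' \<union> ends e = W'" using True by blast
    ultimately show ?thesis
      using n(1) fin e(2) by (intro exI[of _ "Suc n"]) auto
  next
    case False
    \<comment> \<open>Stated for any parametrisation \<open>g\<close> of the arc, so that the arc
      can be run backwards when \<open>\<gamma> e 1\<close> is its end in \<open>W'\<close>.\<close>
    have leaf: "homology_group 1 ?Z \<cong> homology_group 1 (subtopology ?Z Y)"
      if c: "continuous_map (top_of_set {0..1}) ?Z g" and im: "g ` {0..1} = \<gamma> e ` {0..1}"
        and g0: "g 0 \<in> W'" and g1: "g 1 \<in> W - W'" and go: "g ` {0<..<1} \<subseteq> oarc e" and gi: "inj_on g {0<..<1}" for g :: "real \<Rightarrow> 'a"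
    proof (rule homology_group_attach_leaf[OF HZ clYZ c])
      show "topspace ?Z = Y \<union> g ` {0..1}" using Ztop im by simp
      show "g 0 \<in> Y" using g0 Yalt by blast
      have g1': "g 1 \<notin> oarc e" using g1 oarc_W[OF e(1)] by blast
      have ieq: "{0<..1} = insert 1 {0<..<1::real}" by auto
      show "inj_on g {0<..1}"
        unfolding ieq inj_on_insert using gi g1' go by fastforce
      have goY: "oarc e \<inter> Y = {}" using oY by (auto simp: oarc_def)
      show "g t \<notin> Y" if "t \<in> {0<..1}" for t
      proof (cases "t = 1")
        case True then show ?thesis using g1 wY by blast
      next
        case False then show ?thesis using that go goY by (auto simp: image_subset_iff)
      qed
    qed
    have "homology_group 1 ?Z \<cong> homology_group 1 (subtopology ?Z Y)"
    proof (cases "\<gamma> e 0 \<in> W'")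
      case True
      then show ?thesis
        using leaf[of "\<gamma> e"] cont False ends_in_W[OF e(1)] inj_on_arc[OF e(1)] by (auto simp: ends_def oarc_def)
    next
      case False
      let ?g = "\<gamma> e \<circ> (\<lambda>t. 1 - t)"
      have "continuous_map (top_of_set {0..1}) ?Z ?g"
        by (rule continuous_map_compose[OF _ cont]) (auto simp: continuous_map_in_subtopology intro!: continuous_intros)
      moreover have "(\<lambda>t. 1 - t) ` {0..1::real} = {0..1}" "(\<lambda>t. 1 - t) ` {0<..<1::real} = {0<..<1}"
        by (auto simp: image_iff intro!: bexI[of _ "1 - _"])
      moreover have "inj_on ?g {0<..<1}"
        by (rule comp_inj_on) (use inj_on_arc[OF e(1)] calculation(3) in auto)
      moreover have "?g ` {0..1} = \<gamma> e ` {0..1}" "?g ` {0<..<1} = \<gamma> e ` {0<..<1}"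
        using calculation(2,3) by (metis image_comp)+
      moreover have "?g 0 \<in> W'" "?g 1 \<in> W - W'"
        using False inc ends_in_W[OF e(1)] by (auto simp: ends_def)
      ultimately show ?thesis
        using leaf[of ?g] by (simp add: oarc_def)
    qed
    moreover have "card (W' \<union> ends e) = card W' + 1"
    proof -
      obtain a where "a \<notin> W'" "W' \<union> ends e = insert a W'"
        using inc False by (auto simp: ends_def)
      then show ?thesis using fin by simp
    qed
    ultimately show ?thesis
      using n fin e(2) iso_trans by (intro exI[of _ n]) (auto simp: sub)
  qed
  show ?thesis
    unfolding good_subgraph_def
  proof (intro conjI)
    show "W' \<union> ends e \<subseteq> W" using W' ends_W e by blast
    show "\<forall>e'\<in>insert e E'. ends e' \<subseteq> W' \<union> ends e" using E' by blast
  qed (use W' E' e pcT H in \<open>auto simp: T_def\<close>)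
qed

text \<open>Grow a path-connected subgraph arc by arc: an arc with a new endpoint does not change \<open>H\<^sub>1\<close>,
  an arc with both endpoints in the subgraph adds a summand \<open>\<int>\<close>.\<close>

theorem homology_group_1_graph:
  assumes conn: "connected_space X" and ne: "topspace X \<noteq> {}"
  shows "\<exists>n. n + card W = card E + 1 \<and> homology_group 1 X \<cong> free_Abelian_group {..<n}"
proof -
  have "W \<noteq> {}"
    using ne topspace_eq ends_in_W by fastforce
  then obtain w where "w \<in> W" by blast
  \<comment> \<open>A good subgraph with the largest number of arcs is taken. An arc outside it that
    touches it could be added, so its vertex set is closed under adjacency and
    \<open>connected_vertices\<close> applies.\<close>
  define P where "P k \<longleftrightarrow> (\<exists>W' E'. good_subgraph W' E' \<and> card E' = k)" for k
  have "P 0" unfolding P_def using good_subgraph_singleton[OF \<open>w \<in> W\<close>] by force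
  moreover have "\<forall>k. P k \<longrightarrow> k \<le> card E"
    unfolding P_def good_subgraph_def using finite_E card_mono by blast
  ultimately obtain k where "P k" and max: "\<And>k'. P k' \<Longrightarrow> k' \<le> k"
    using GreatestI_nat[of P 0 "card E"] Greatest_le_nat[of P _ "card E"] by blast
  then obtain W' E' where g: "good_subgraph W' E'" "card E' = k" unfolding P_def by blast
  then have W': "W' \<subseteq> W" "W' \<noteq> {}" and E': "E' \<subseteq> E" "\<And>e. e \<in> E' \<Longrightarrow> ends e \<subseteq> W'"
    by (auto simp: good_subgraph_def)
  have fin: "finite E'" using E'(1) finite_E by (rule finite_subset)
  have no: "ends e \<inter> W' = {}" if "e \<in> E - E'" for e
  proof (rule ccontr)
    assume "ends e \<inter> W' \<noteq> {}"
    then have "good_subgraph (W' \<union> ends e) (insert e E')"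
      using good_subgraph_step g(1) that by blast
    then have "P (card (insert e E'))" unfolding P_def by blast
    then show False using max[of "card (insert e E')"] g(2) fin that by auto
  qed
  have WW: "W' = W"
  proof (rule connected_vertices[OF conn W'])
    show "\<gamma> e 0 \<in> W' \<longleftrightarrow> \<gamma> e 1 \<in> W'" if "e \<in> E" for e
      using no[of e] E'(2)[of e] that by (auto simp: ends_def)
  qed
  have EE: "E' = E"
  proof (rule ccontr)
    assume "E' \<noteq> E"
    then obtain e where "e \<in> E - E'" using E' by blast
    then show False using no[of e] WW ends_W[of e] by (auto simp: ends_def)
  qed
  show ?thesis
    using g(1) unfolding good_subgraph_def WW EE span_all by simp
qed

corollary betti1_graph:
  assumes "connected_space X" "topspace X \<noteq> {}"
  shows "betti1 X + card W = card E + 1"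
  using homology_group_1_graph[OF assms] betti1_eqI by blast

lemma subgraph_space:
  assumes "W' \<subseteq> W" "E' \<subseteq> E" "\<And>e. e \<in> E' \<Longrightarrow> ends e \<subseteq> W'" and C: "C = span W' E'"
  shows "graph_space (subtopology X C) W' E' \<gamma>"
proof unfold_locales
  have Csub: "C \<subseteq> topspace X"
    using closed_span closedin_subset assms by blast
  show "Hausdorff_space (subtopology X C)"
    using Hausdorff by (rule Hausdorff_space_subtopology)
  show "finite W'" "finite E'"
    using assms(1,2) finite_W finite_E by (auto intro: finite_subset)
  show "W' \<subseteq> topspace (subtopology X C)"
    using Csub C by (auto simp: span_def)
  show "continuous_map (top_of_set {0..1}) (subtopology X C) (\<gamma> e)" if "e \<in> E'" for e
    using path[of e] that assms by (auto simp: continuous_map_in_subtopology span_def carc_def)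
  show "\<gamma> e 0 \<in> W'" "\<gamma> e 1 \<in> W'" if "e \<in> E'" for e
    using assms(3)[OF that] by (auto simp: ends_def)
  show "\<gamma> e t \<notin> W'" if "e \<in> E'" "t \<in> {0<..<1}" for e t
    using arc_W that assms by blast
  show "e = e' \<and> t = t'" if "e \<in> E'" "e' \<in> E'" "t \<in> {0<..<1}" "t' \<in> {0<..<1}" "\<gamma> e t = \<gamma> e' t'" for e e' t t'
    using arc_inj that assms by blast
  show "topspace (subtopology X C) \<subseteq> W' \<union> (\<Union>e\<in>E'. \<gamma> e ` {0<..<1})"
    using span_alt[OF assms(1-3)] C by (auto simp: oarc_def)
qed

end

section \<open>Involutions on finite graphs\<close>

text \<open>The spanning tree bound. Connectedness is given in cut form: no proper non-empty vertex
  set is left by no edge. A largest subgraph with at most one more vertex than edges is extended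
  across a cut, where each edge brings at most one new vertex.\<close>

lemma connected_multigraph_card:
  assumes fin: "finite Q" "finite F" and ne: "Q \<noteq> {}"
    and Q: "\<And>f. f \<in> F \<Longrightarrow> a f \<in> Q \<and> b f \<in> Q"
    and conn: "\<And>A. A \<subseteq> Q \<Longrightarrow> A \<noteq> {} \<Longrightarrow> (\<And>f. f \<in> F \<Longrightarrow> a f \<in> A \<longleftrightarrow> b f \<in> A) \<Longrightarrow> A = Q"
  shows "card Q \<le> card F + 1"
proof -
  define good where "good A F' \<longleftrightarrow> A \<subseteq> Q \<and> A \<noteq> {} \<and> F' \<subseteq> F \<and> (\<forall>f\<in>F'. a f \<in> A \<and> b f \<in> A) \<and> card A \<le> card F' + 1" for A F'
  define P where "P k \<longleftrightarrow> (\<exists>A F'. good A F' \<and> card F' = k)" for k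
  obtain q where "q \<in> Q" using ne by blast
  then have "good {q} {}" by (simp add: good_def)
  then have "P 0" unfolding P_def by force
  moreover have "\<forall>k. P k \<longrightarrow> k \<le> card F"
    unfolding P_def good_def using fin card_mono by blast
  ultimately obtain k where "P k" and max: "\<And>k'. P k' \<Longrightarrow> k' \<le> k"
    using GreatestI_nat[of P 0 "card F"] Greatest_le_nat[of P _ "card F"] by blast
  then obtain A F' where g: "good A F'" "card F' = k" unfolding P_def by blast
  then have A: "A \<subseteq> Q" "A \<noteq> {}" "F' \<subseteq> F" "\<forall>f\<in>F'. a f \<in> A \<and> b f \<in> A" "card A \<le> card F' + 1"
    by (auto simp: good_def)
  have fin': "finite A" "finite F'" using A fin finite_subset by blast+
  have "A = Q"
  proof (rule conn[OF A(1,2)], rule ccontr)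
    fix f assume f: "f \<in> F" "(a f \<in> A) \<noteq> (b f \<in> A)"
    then have "f \<notin> F'" using A(4) by blast
    obtain c where c: "A \<union> {a f, b f} = insert c A" using f by auto
    have "card (A \<union> {a f, b f}) \<le> card A + 1"
      unfolding c using fin' by (simp add: card_insert_if)
    moreover have "card (insert f F') = card F' + 1" using fin' \<open>f \<notin> F'\<close> by simp
    ultimately have "good (A \<union> {a f, b f}) (insert f F')"
      unfolding good_def using A f(1) Q[OF f(1)] by auto
    then have "P (card (insert f F'))" unfolding P_def by blast
    then show False using max[of "card (insert f F')"] g(2) fin' \<open>f \<notin> F'\<close> by auto
  qed
  moreover have "card F' \<le> card F" using A(3) fin(2) card_mono by blast
  ultimately show ?thesis using A(5) by simp
qed

text \<open>Without \<open>f0\<close> there are too few edges for the spanning tree bound, so some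
  cut is crossed by no other edge; it must be crossed by \<open>f0\<close>, since the whole
  multigraph is connected.\<close>

lemma tree_multigraph_bridge:
  assumes fin: "finite Q" "finite F" and Q: "\<And>f. f \<in> F \<Longrightarrow> a f \<in> Q \<and> b f \<in> Q"
    and conn: "\<And>A. A \<subseteq> Q \<Longrightarrow> A \<noteq> {} \<Longrightarrow> (\<And>f. f \<in> F \<Longrightarrow> a f \<in> A \<longleftrightarrow> b f \<in> A) \<Longrightarrow> A = Q"
    and card: "card Q = card F + 1" and f0: "f0 \<in> F"
  shows "\<exists>A\<subseteq>Q. (\<forall>f\<in>F - {f0}. a f \<in> A \<longleftrightarrow> b f \<in> A) \<and> \<not> (a f0 \<in> A \<longleftrightarrow> b f0 \<in> A)"
proof -
  have "card (F - {f0}) + 1 < card Q"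
    using card f0 fin(2) card_Diff1_less[of F f0] by linarith
  moreover have "Q \<noteq> {}" using card by auto
  ultimately have "\<exists>A\<subseteq>Q. A \<noteq> {} \<and> A \<noteq> Q \<and> (\<forall>f\<in>F - {f0}. a f \<in> A \<longleftrightarrow> b f \<in> A)"
  proof (rule_tac ccontr)
    assume no: "\<not> ?thesis"
    have "card Q \<le> card (F - {f0}) + 1"
    proof (rule connected_multigraph_card)
      show "A = Q" if "A \<subseteq> Q" "A \<noteq> {}" "\<And>f. f \<in> F - {f0} \<Longrightarrow> a f \<in> A \<longleftrightarrow> b f \<in> A" for A
        using no that by blast
    qed (use fin Q \<open>Q \<noteq> {}\<close> in auto)
    then show False using \<open>card (F - {f0}) + 1 < card Q\<close> by simp
  qed
  then obtain A where A: "A \<subseteq> Q" "A \<noteq> {}" "A \<noteq> Q" "\<And>f. f \<in> F - {f0} \<Longrightarrow> a f \<in> A \<longleftrightarrow> b f \<in> A"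
    by blast
  have "\<not> (a f0 \<in> A \<longleftrightarrow> b f0 \<in> A)"
  proof
    assume "a f0 \<in> A \<longleftrightarrow> b f0 \<in> A"
    then have "A = Q" using A(4) by (intro conn[OF A(1,2)]) (metis DiffI singletonD)
    then show False using A(3) by simp
  qed
  then show ?thesis using A by (intro exI[of _ A]) simp
qed

lemma involution_representatives:
  assumes "finite S" "\<And>x. x \<in> S \<Longrightarrow> \<tau> x \<in> S" "\<And>x. x \<in> S \<Longrightarrow> \<tau> (\<tau> x) = x" "\<And>x. x \<in> S \<Longrightarrow> \<tau> x \<noteq> x"
  shows "\<exists>F\<subseteq>S. (\<forall>x\<in>S. x \<in> F \<longleftrightarrow> \<tau> x \<notin> F) \<and> card S = 2 * card F"
  using assms
proof (induction S rule: finite_psubset_induct)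
  case (psubset S)
  show ?case
  proof (cases "S = {}")
    case False
    then obtain x where x: "x \<in> S" by blast
    let ?S = "S - {x, \<tau> x}"
    have "\<exists>F\<subseteq>?S. (\<forall>y\<in>?S. y \<in> F \<longleftrightarrow> \<tau> y \<notin> F) \<and> card ?S = 2 * card F"
    proof (rule psubset.IH)
      show "?S \<subset> S" using x by blast
      show "\<tau> y \<in> ?S" if "y \<in> ?S" for y
        using that psubset.prems x by (metis Diff_iff insert_iff empty_iff)
    qed (use psubset.prems in auto)
    then obtain F where F: "F \<subseteq> ?S" "\<forall>y\<in>?S. y \<in> F \<longleftrightarrow> \<tau> y \<notin> F" "card ?S = 2 * card F"
      by blast
    have fF: "finite F" "x \<notin> F" using F(1) psubset.hyps finite_subset by auto
    have "card S = card ?S + 2"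
    proof -
      have "S = insert x (insert (\<tau> x) ?S)" using x psubset.prems by blast
      then have "card S = card (insert x (insert (\<tau> x) ?S))" by simp
      then show ?thesis
        using psubset.hyps psubset.prems(3)[OF x] by (auto simp: card_insert_if)
    qed
    moreover have "card (insert x F) = card F + 1" using fF by simp
    moreover have "\<forall>y\<in>S. y \<in> insert x F \<longleftrightarrow> \<tau> y \<notin> insert x F"
    proof
      fix y assume y: "y \<in> S"
      consider "y = x" | "y = \<tau> x" | "y \<in> ?S" using y by blast
      then show "y \<in> insert x F \<longleftrightarrow> \<tau> y \<notin> insert x F"
      proof cases
        case 1 then show ?thesis using F(1) psubset.prems(3)[OF x] by auto
      next
        case 2 then show ?thesis using F(1) psubset.prems(2,3)[OF x] by auto
      next
        case 3
        then have "\<tau> y \<noteq> x" using psubset.prems(2) y by force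
        with 3 show ?thesis using F(2) by auto
      qed
    qed
    ultimately show ?thesis
      using F x by (intro exI[of _ "insert x F"]) auto
  qed auto
qed

section \<open>The action of a continuous involution on the arcs\<close>

locale inv_graph = graph_space +
  fixes \<iota> :: "'a \<Rightarrow> 'a"
  assumes cont_inv: "continuous_map X X \<iota>" and inv_inv: "x \<in> topspace X \<Longrightarrow> \<iota> (\<iota> x) = x"
    and inv_W: "w \<in> W \<Longrightarrow> \<iota> w \<in> W"
begin

definition R :: "'a set" where "R = {x \<in> topspace X. \<iota> x = x}"

lemma inv_in: "x \<in> topspace X \<Longrightarrow> \<iota> x \<in> topspace X"
  using cont_inv by (auto simp: continuous_map_def)

lemma closed_R: "closedin X R"
  unfolding R_def by (rule closedin_continuous_maps_eq[OF Hausdorff cont_inv]) auto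

text \<open>Only invariance of the vertex set is assumed. As \<iota> permutes \<open>W\<close>, the
  image of an open arc is a connected set avoiding \<open>W\<close>, hence it stays inside a single
  open arc.\<close>

lemma inv_oarc_sub:
  assumes e: "e \<in> E" "e' \<in> E" and x: "x \<in> oarc e" "\<iota> x \<in> oarc e'"
  shows "\<iota> ` oarc e \<subseteq> oarc e'"
proof (rule connected_sub_oarc[OF _ _ e(2)])
  show "connectedin X (\<iota> ` oarc e)"
    using connectedin_continuous_map_image[OF cont_inv connected_oarc[OF e(1)]] .
  show "\<iota> ` oarc e \<inter> W = {}"
  proof -
    have "\<iota> y \<notin> W" if "y \<in> oarc e" for y
      using that inv_W[of "\<iota> y"] inv_inv[of y] oarc_W[OF e(1)] oarc_sub[OF e(1)] by (metis disjoint_iff subsetD)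
    then show ?thesis by blast
  qed
qed (use x in auto)

lemma ex_tau: assumes e: "e \<in> E" shows "\<exists>e'\<in>E. \<iota> ` oarc e = oarc e'"
proof -
  obtain x where x: "x \<in> oarc e" using oarc_nonempty by blast
  then have xt: "x \<in> topspace X" using oarc_sub e by blast
  have "\<iota> x \<notin> W"
    using inv_W inv_inv[OF xt] x oarc_W[OF e] by (metis disjoint_iff)
  then obtain e' where e': "e' \<in> E" "\<iota> x \<in> oarc e'"
    using topspace_eq inv_in[OF xt] by blast
  have 1: "\<iota> ` oarc e \<subseteq> oarc e'"
    using inv_oarc_sub e e' x by blast
  have 2: "\<iota> ` oarc e' \<subseteq> oarc e"
    using inv_oarc_sub[OF e'(1) e e'(2)] inv_inv[OF xt] x by simp
  have "oarc e' \<subseteq> \<iota> ` oarc e"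
    using 2 inv_inv oarc_sub[OF e'(1)] by (force simp: image_iff)
  then show ?thesis using 1 e' by blast
qed

definition tau :: "'b \<Rightarrow> 'b" where "tau e = (SOME e'. e' \<in> E \<and> \<iota> ` oarc e = oarc e')"

lemma tau: assumes "e \<in> E" shows tau_E: "tau e \<in> E" and inv_oarc: "\<iota> ` oarc e = oarc (tau e)"
  using someI_ex[of "\<lambda>e'. e' \<in> E \<and> \<iota> ` oarc e = oarc e'"] ex_tau[OF assms] unfolding tau_def by blast+

lemma inv_inv_image: "A \<subseteq> topspace X \<Longrightarrow> \<iota> ` \<iota> ` A = A"
  using inv_inv by (force simp: image_iff)

lemma oarc_eq: "e \<in> E \<Longrightarrow> e' \<in> E \<Longrightarrow> oarc e = oarc e' \<Longrightarrow> e = e'"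
  using oarc_disjoint oarc_nonempty by blast

lemma tau_tau: assumes "e \<in> E" shows "tau (tau e) = e"
  using tau[OF assms] tau[OF tau_E[OF assms]] inv_inv_image[OF oarc_sub[OF assms]] oarc_eq assms by metis

lemma tau_eq_iff: "e \<in> E \<Longrightarrow> tau e = e \<longleftrightarrow> \<iota> ` oarc e = oarc e"
  using tau oarc_eq by metis

lemma carc_subset_closed:
  assumes e: "e \<in> E" and S: "closedin X S" "oarc e \<subseteq> S"
  shows "carc e \<subseteq> S"
proof -
  have "closedin (top_of_set {0..1}) {t \<in> topspace (top_of_set {0..1::real}). \<gamma> e t \<in> S}"
    using path[OF e] S(1) by (rule closedin_continuous_map_preimage)
  then have "closed {t \<in> {0..1}. \<gamma> e t \<in> S}"
    using closedin_closed_trans by fastforce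
  moreover have "{0<..<1} \<subseteq> {t \<in> {0..1}. \<gamma> e t \<in> S}"
    using S(2) by (auto simp: oarc_def)
  ultimately have "closure {0<..<1} \<subseteq> {t \<in> {0..1}. \<gamma> e t \<in> S}"
    by (rule closure_minimal[rotated])
  then show ?thesis by (auto simp: carc_def)
qed

text \<open>Passing to closures extends the correspondence of open arcs to closed arcs, and among
  the points of a closed arc exactly the ends lie in \<open>W\<close>.\<close>

lemma inv_ends_sub: assumes e: "e \<in> E" shows "\<iota> ` ends e \<subseteq> ends (tau e)"
proof -
  let ?S = "{x \<in> topspace X. \<iota> x \<in> carc (tau e)}"
  have "carc e \<subseteq> ?S"
  proof (rule carc_subset_closed[OF e])
    show "closedin X ?S"
      using cont_inv closed_carc[OF tau_E[OF e]] by (rule closedin_continuous_map_preimage)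
    show "oarc e \<subseteq> ?S"
      using inv_oarc[OF e] oarc_sub[OF e] carc_eq by blast
  qed
  moreover have "ends e \<subseteq> carc e" by (simp add: carc_eq)
  ultimately have "\<iota> ` ends e \<subseteq> carc (tau e) \<inter> W"
    using ends_W[OF e] inv_W by blast
  then show ?thesis
    unfolding carc_eq using oarc_W[OF tau_E[OF e]] by blast
qed

lemma inv_ends: assumes e: "e \<in> E" shows "ends (tau e) = \<iota> ` ends e"
proof -
  have "\<iota> ` ends (tau e) \<subseteq> ends e"
    using inv_ends_sub[OF tau_E[OF e]] tau_tau[OF e] by simp
  then have "\<iota> ` \<iota> ` ends (tau e) \<subseteq> \<iota> ` ends e" by blast
  moreover have "ends (tau e) \<subseteq> topspace X"
    using ends_W[OF tau_E[OF e]] W_sub by blast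
  ultimately have "ends (tau e) \<subseteq> \<iota> ` ends e"
    using inv_inv_image[of "ends (tau e)"] by simp
  then show ?thesis using inv_ends_sub[OF e] by (rule subset_antisym)
qed

lemma tau_ends:
  assumes "e \<in> E"
  shows "\<gamma> (tau e) 0 = \<iota> (\<gamma> e 0) \<and> \<gamma> (tau e) 1 = \<iota> (\<gamma> e 1) \<or> \<gamma> (tau e) 0 = \<iota> (\<gamma> e 1) \<and> \<gamma> (tau e) 1 = \<iota> (\<gamma> e 0)"
  using inv_ends[OF assms] by (auto simp: ends_def doubleton_eq_iff)

text \<open>Conjugating by the homeomorphism from the open interval turns \<iota> on an invariant
  arc into a continuous involution of \<open>{0<..<1}\<close>, to which one-variable analysis
  applies.\<close>

lemma invariant_arc_coordinate:
  assumes e: "e \<in> E" and inv: "\<iota> ` oarc e = oarc e"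
  obtains \<phi> :: "real \<Rightarrow> real" where "continuous_on {0<..<1} \<phi>" "\<And>t. t \<in> {0<..<1} \<Longrightarrow> \<phi> t \<in> {0<..<1}"
    "\<And>t. t \<in> {0<..<1} \<Longrightarrow> \<gamma> e (\<phi> t) = \<iota> (\<gamma> e t)" "\<And>t. t \<in> {0<..<1} \<Longrightarrow> \<phi> (\<phi> t) = t"
proof -
  obtain g where g: "homeomorphic_maps (top_of_set {0<..<1::real}) (subtopology X (oarc e)) (\<gamma> e) g"
    using homeomorphic_oarc[OF e] homeomorphic_map_maps by blast
  have top: "topspace (subtopology X (oarc e)) = oarc e" using oarc_sub[OF e] by auto
  have cg: "continuous_map (subtopology X (oarc e)) (top_of_set {0<..<1}) g"
    and c\<gamma>: "continuous_map (top_of_set {0<..<1}) (subtopology X (oarc e)) (\<gamma> e)"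
    and gl: "\<And>t. t \<in> {0<..<1} \<Longrightarrow> g (\<gamma> e t) = t" and gr: "\<And>x. x \<in> oarc e \<Longrightarrow> \<gamma> e (g x) = x"
    using g top by (auto simp: homeomorphic_maps_def)
  have c\<iota>: "continuous_map (subtopology X (oarc e)) (subtopology X (oarc e)) \<iota>"
    using cont_inv inv by (auto simp: continuous_map_in_subtopology continuous_map_from_subtopology)
  have "continuous_map (top_of_set {0<..<1}) (top_of_set {0<..<1}) (g \<circ> \<iota> \<circ> \<gamma> e)"
    using c\<gamma> c\<iota> cg by (meson continuous_map_compose)
  then have 1: "continuous_on {0<..<1} (g \<circ> \<iota> \<circ> \<gamma> e)" and 2: "(g \<circ> \<iota> \<circ> \<gamma> e) \<in> {0<..<1} \<rightarrow> {0<..<1}"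
    by (auto simp: continuous_map_in_subtopology)
  have 3: "\<gamma> e ((g \<circ> \<iota> \<circ> \<gamma> e) t) = \<iota> (\<gamma> e t)" if "t \<in> {0<..<1}" for t
  proof -
    have "\<iota> (\<gamma> e t) \<in> oarc e" using that inv by (auto simp: oarc_def)
    then show ?thesis using gr by simp
  qed
  have "(g \<circ> \<iota> \<circ> \<gamma> e) ((g \<circ> \<iota> \<circ> \<gamma> e) t) = t" if t: "t \<in> {0<..<1}" for t
  proof -
    have "\<gamma> e t \<in> topspace X" using t oarc_sub[OF e] by (auto simp: oarc_def)
    then show ?thesis using 3[OF t] inv_inv gl[OF t] by simp
  qed
  then show thesis using that[OF 1] 2 3 by blast
qed

text \<open>The involution swaps \<open>a\<close> and \<open>b\<close>, so
  \<open>\<phi> t - t\<close> has opposite signs there and vanishes in between; the starting point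
  \<open>1/2\<close> is arbitrary.\<close>

lemma invariant_arc_fixpoint:
  assumes e: "e \<in> E" and inv: "\<iota> ` oarc e = oarc e"
  shows "\<exists>x\<in>oarc e. \<iota> x = x"
proof -
  obtain \<phi> :: "real \<Rightarrow> real" where c: "continuous_on {0<..<1} \<phi>" and im: "\<And>t. t \<in> {0<..<1} \<Longrightarrow> \<phi> t \<in> {0<..<1}"
    and \<phi>: "\<And>t. t \<in> {0<..<1} \<Longrightarrow> \<gamma> e (\<phi> t) = \<iota> (\<gamma> e t)" "\<And>t. t \<in> {0<..<1} \<Longrightarrow> \<phi> (\<phi> t) = t"
    by (rule invariant_arc_coordinate[OF e inv]) blast
  define a b where "a = (1/2::real)" and "b = \<phi> a"
  have ab: "a \<in> {0<..<1}" "b \<in> {0<..<1}" "\<phi> a = b" "\<phi> b = a"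
    using im[of a] \<phi>(2)[of a] by (auto simp: a_def b_def)
  have ch: "continuous_on {x..y} (\<lambda>t. \<phi> t - t)" if "x \<in> {0<..<1}" "y \<in> {0<..<1}" for x y
    by (intro continuous_intros continuous_on_subset[OF c]) (use that in auto)
  have "\<exists>t\<in>{0<..<1}. \<phi> t - t = 0"
  proof (cases "a \<le> b")
    case True
    then show ?thesis
      using IVT2'[of "\<lambda>t. \<phi> t - t" b 0 a] ch[of a b] ab by fastforce
  next
    case False
    then show ?thesis
      using IVT'[of "\<lambda>t. \<phi> t - t" b 0 a] ch[of b a] ab IVT2'[of "\<lambda>t. \<phi> t - t" a 0 b] by fastforce
  qed
  then obtain t where "t \<in> {0<..<1}" "\<phi> t = t" by auto
  then show ?thesis using \<phi>(1)[of t] by (intro bexI[of _ "\<gamma> e t"]) (auto simp: oarc_def)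
qed

text \<open>A continuous injection of an interval is strictly monotone. A decreasing one has at most
  one fixed point, and an increasing involution is the identity.\<close>

lemma two_fixpoints_arc:
  assumes e: "e \<in> E" and xy: "x \<in> oarc e" "y \<in> oarc e" "\<iota> x = x" "\<iota> y = y" "x \<noteq> y"
  shows "oarc e \<subseteq> R"
proof -
  have "\<iota> ` oarc e \<subseteq> oarc e"
    using inv_oarc_sub[OF e e, of x] xy by simp
  then have inv: "\<iota> ` oarc e = oarc e"
    using inv_inv_image[OF oarc_sub[OF e]] by blast
  obtain \<phi> :: "real \<Rightarrow> real" where c: "continuous_on {0<..<1} \<phi>" and im: "\<And>t. t \<in> {0<..<1} \<Longrightarrow> \<phi> t \<in> {0<..<1}"
    and \<phi>: "\<And>t. t \<in> {0<..<1} \<Longrightarrow> \<gamma> e (\<phi> t) = \<iota> (\<gamma> e t)" "\<And>t. t \<in> {0<..<1} \<Longrightarrow> \<phi> (\<phi> t) = t"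
    by (rule invariant_arc_coordinate[OF e inv]) blast
  have "inj_on \<phi> {0<..<1}"
    using \<phi>(2) by (metis inj_onI)
  then have "strict_mono_on {0<..<1} \<phi> \<or> strict_antimono_on {0<..<1} \<phi>"
    using injective_eq_monotone_map[of "{0<..<1}" \<phi>] c is_interval_oo by blast
  moreover have "\<not> strict_antimono_on {0<..<1} \<phi>"
  proof
    assume anti: "strict_antimono_on {0<..<1} \<phi>"
    obtain s t where st: "s \<in> {0<..<1}" "t \<in> {0<..<1}" "x = \<gamma> e s" "y = \<gamma> e t"
      using xy by (auto simp: oarc_def)
    have "\<phi> s = s" "\<phi> t = t"
      using arc_inj[OF e e, of "\<phi> s" s] arc_inj[OF e e, of "\<phi> t" t] \<phi>(1) st xy im[of s] im[of t] by auto
    moreover have "s \<noteq> t" using st xy by auto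
    ultimately show False
      using monotone_onD[OF anti, of s t] monotone_onD[OF anti, of t s] st by fastforce
  qed
  ultimately have mono: "strict_mono_on {0<..<1} \<phi>" by blast
  have "\<phi> t = t" if t: "t \<in> {0<..<1}" for t
  proof -
    have "\<phi> t \<in> {0<..<1}" using im[OF t] .
    then show ?thesis
      using strict_mono_onD[OF mono t, of "\<phi> t"] strict_mono_onD[OF mono _ t, of "\<phi> t"] \<phi>(2)[OF t] by fastforce
  qed
  then show ?thesis
    using \<phi>(1) oarc_sub[OF e] by (auto simp: oarc_def R_def)
qed

end


section \<open>Counting real components and conjugate pairs when no arc is reversed\<close>

locale real_graph = inv_graph +
  assumes conn: "connected_space X"
    and norev: "e \<in> E \<Longrightarrow> \<iota> ` oarc e = oarc e \<Longrightarrow> oarc e \<subseteq> R"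
begin

definition ER :: "'b set" where "ER = {e \<in> E. oarc e \<subseteq> R}"

lemma ER_E: "ER \<subseteq> E" by (auto simp: ER_def)

lemma carc_R: "e \<in> ER \<Longrightarrow> carc e \<subseteq> R"
  using carc_subset_closed closed_R by (auto simp: ER_def)

text \<open>A real point inside an arc makes the arc invariant, and then \<open>norev\<close> makes
  it real. So \<Gamma>(\<real>) is a subgraph: every arc is either real throughout or has no real
  interior point.\<close>

lemma nonreal_oarc: assumes "e \<in> E - ER" shows "oarc e \<inter> R = {}"
proof (rule ccontr)
  assume "oarc e \<inter> R \<noteq> {}"
  then obtain x where x: "x \<in> oarc e" "\<iota> x = x" by (auto simp: R_def)
  have e: "e \<in> E" using assms by blast
  have "\<iota> ` oarc e \<subseteq> oarc e"
    using inv_oarc_sub[OF e e] x by simp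
  then have "\<iota> ` oarc e = oarc e"
    using inv_inv_image[OF oarc_sub[OF e]] by blast
  then show False using norev[OF e] assms by (auto simp: ER_def)
qed

lemma inv_R: "x \<in> topspace X \<Longrightarrow> \<iota> x \<in> R \<longleftrightarrow> x \<in> R"
  using inv_inv inv_in by (auto simp: R_def)

lemma tau_nonreal: assumes "e \<in> E - ER" shows "tau e \<in> E - ER" "tau e \<noteq> e"
proof -
  have e: "e \<in> E" using assms by blast
  have "oarc (tau e) \<inter> R = {}"
  proof -
    have "\<iota> x \<notin> R" if "x \<in> oarc e" for x
      using that nonreal_oarc[OF assms] oarc_sub[OF e] inv_R[of x] by auto
    then show ?thesis unfolding inv_oarc[OF e, symmetric] by blast
  qed
  then show "tau e \<in> E - ER"
    using tau_E[OF e] oarc_nonempty by (auto simp: ER_def)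
  show "tau e \<noteq> e"
    using tau_eq_iff[OF e] norev[OF e] assms by (auto simp: ER_def)
qed

abbreviation comps :: "'a set set" where "comps \<equiv> connected_components_of (subtopology X R)"

lemma R_top: "topspace (subtopology X R) = R"
  using closed_R closedin_subset by fastforce

definition EC :: "'a set \<Rightarrow> 'b set" where "EC C = {e \<in> ER. carc e \<subseteq> C}"

lemma comp_sub: "C \<in> comps \<Longrightarrow> C \<subseteq> R"
  using connected_components_of_subset R_top by metis

lemma carc_comp:
  assumes "C \<in> comps" "e \<in> ER" "x \<in> carc e" "x \<in> C"
  shows "carc e \<subseteq> C"
proof (rule connected_components_of_maximal[OF assms(1)])
  have "connectedin X (carc e)"
    using path_connected_carc ER_E assms(2) path_connectedin_imp_connectedin by blast
  then show "connectedin (subtopology X R) (carc e)"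
    using carc_R[OF assms(2)] by (simp add: connectedin_subtopology)
qed (use assms in \<open>auto simp: disjnt_def\<close>)

text \<open>A point of \<open>C\<close> inside an arc forces the whole closed arc to be real, and
  being connected it lies in \<open>C\<close>. Each component is thus a graph space of its own and
  obeys the Betti formula.\<close>

lemma comp_span: assumes C: "C \<in> comps" shows "C = span (W \<inter> C) (EC C)"
proof
  show "span (W \<inter> C) (EC C) \<subseteq> C" by (auto simp: span_def EC_def)
  show "C \<subseteq> span (W \<inter> C) (EC C)"
  proof
    fix x assume x: "x \<in> C"
    then have xR: "x \<in> R" using comp_sub C by blast
    then have "x \<in> topspace X" by (simp add: R_def)
    then consider "x \<in> W" | e where "e \<in> E" "x \<in> oarc e" using topspace_eq by blast
    then show "x \<in> span (W \<inter> C) (EC C)"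
    proof cases
      case 1 then show ?thesis using x by (simp add: span_def)
    next
      case 2
      then have e: "e \<in> ER" using nonreal_oarc[of e] xR by blast
      have xc: "x \<in> carc e" using 2 carc_eq by blast
      have "e \<in> EC C" using carc_comp[OF C e xc x] e by (simp add: EC_def)
      then show ?thesis using xc by (auto simp: span_def)
    qed
  qed
qed

lemma betti1_comp:
  assumes C: "C \<in> comps"
  shows "betti1 (subtopology X C) + card (W \<inter> C) = card (EC C) + 1"
proof -
  interpret C: graph_space "subtopology X C" "W \<inter> C" "EC C" \<gamma>
  proof (rule subgraph_space[OF _ _ _ comp_span[OF C]])
    show "ends e \<subseteq> W \<inter> C" if "e \<in> EC C" for e
      using that ends_W[of e] ER_E carc_eq[of e] by (auto simp: EC_def)
  qed (use ER_E in \<open>auto simp: EC_def\<close>)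
  have CR: "C \<subseteq> R" using comp_sub[OF C] .
  have "connectedin (subtopology X R) C"
    using connectedin_connected_components_of[OF C] .
  then have "connectedin X C" by (simp add: connectedin_subtopology)
  then have "connected_space (subtopology X C)" by (simp add: connectedin_def)
  moreover have "topspace (subtopology X C) \<noteq> {}"
    using nonempty_connected_components_of[OF C] CR by (auto simp: R_def)
  ultimately show ?thesis by (rule C.betti1_graph)
qed

lemma comp_vertex: assumes C: "C \<in> comps" shows "W \<inter> C \<noteq> {}"
proof
  assume "W \<inter> C = {}"
  then have "EC C = {}"
    using ends_W ER_E carc_eq by (fastforce simp: EC_def ends_def)
  then have "C = {}" using comp_span[OF C] \<open>W \<inter> C = {}\<close> by (simp add: span_def)
  then show False using nonempty_connected_components_of[OF C] by simp
qed

lemma comp_unique: "C \<in> comps \<Longrightarrow> C' \<in> comps \<Longrightarrow> x \<in> C \<Longrightarrow> x \<in> C' \<Longrightarrow> C = C'"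
  using pairwise_disjoint_connected_components_of[of "subtopology X R"] by (auto simp: pairwise_def disjnt_def)

lemma comp_ex: "x \<in> R \<Longrightarrow> \<exists>C\<in>comps. x \<in> C"
  using Union_connected_components_of[of "subtopology X R"] R_top by auto

lemma finite_comps: "finite comps"
proof (rule finite_imageD)
  show "finite ((\<lambda>C. W \<inter> C) ` comps)"
    by (rule finite_subset[of _ "Pow W"]) (use finite_W in auto)
  show "inj_on (\<lambda>C. W \<inter> C) comps"
    by (rule inj_onI) (use comp_vertex comp_unique in blast)
qed

text \<open>Each component contributes \<open>#arcs - #vertices + 2\<close>, and the components
  partition the real arcs and the real vertices. The subtraction is again moved to the other
  side.\<close>

lemma sum_betti_comps: "(\<Sum>C\<in>comps. betti1 (subtopology X C) + 1) + card (W \<inter> R) = card ER + 2 * card comps"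
proof -
  have "card (W \<inter> R) = (\<Sum>C\<in>comps. card (W \<inter> C))"
  proof -
    have "W \<inter> R = (\<Union>C\<in>comps. W \<inter> C)" using comp_ex comp_sub by blast
    moreover have "(W \<inter> C) \<inter> (W \<inter> C') = {}" if "C \<in> comps" "C' \<in> comps" "C \<noteq> C'" for C C'
      using that comp_unique by blast
    ultimately show ?thesis
      using finite_comps finite_W card_UN_disjoint[of comps "\<lambda>C. W \<inter> C"] by simp
  qed
  moreover have "card ER = (\<Sum>C\<in>comps. card (EC C))"
  proof -
    have "ER = (\<Union>C\<in>comps. EC C)"
    proof
      show "ER \<subseteq> (\<Union>C\<in>comps. EC C)"
      proof
        fix e assume e: "e \<in> ER"
        have "\<gamma> e 0 \<in> carc e" by (simp add: carc_eq ends_def)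
        moreover then obtain C where "C \<in> comps" "\<gamma> e 0 \<in> C" using comp_ex carc_R[OF e] by blast
        ultimately show "e \<in> (\<Union>C\<in>comps. EC C)" using carc_comp[OF _ e] e by (auto simp: EC_def)
      qed
    qed (auto simp: EC_def)
    moreover have "EC C \<inter> EC C' = {}" if "C \<in> comps" "C' \<in> comps" "C \<noteq> C'" for C C'
      using that comp_unique by (fastforce simp: EC_def carc_eq ends_def)
    moreover have "finite (EC C)" for C
      using finite_E ER_E by (auto simp: EC_def intro: finite_subset)
    ultimately show ?thesis
      using finite_comps card_UN_disjoint[of comps EC] by simp
  qed
  moreover have "(\<Sum>C\<in>comps. betti1 (subtopology X C) + 1) + (\<Sum>C\<in>comps. card (W \<inter> C)) = (\<Sum>C\<in>comps. card (EC C)) + 2 * card comps"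
  proof -
    have "(\<Sum>C\<in>comps. betti1 (subtopology X C) + 1 + card (W \<inter> C)) = (\<Sum>C\<in>comps. card (EC C) + 2)"
      using betti1_comp by (intro sum.cong) auto
    then show ?thesis by (simp only: sum.distrib) simp
  qed
  ultimately show ?thesis by simp
qed


text \<open>The vertices of the quotient multigraph.\<close>

definition vcls :: "'a \<Rightarrow> 'a set" where
  "vcls w = (if w \<in> R then connected_component_of_set (subtopology X R) w else {w, \<iota> w})"

lemma vcls_real: assumes "w \<in> C" "C \<in> comps" shows "vcls w = C"
proof -
  have "w \<in> R" using assms comp_sub by blast
  then have "connected_component_of_set (subtopology X R) w \<in> comps"
    "w \<in> connected_component_of_set (subtopology X R) w"
    using R_top by (auto simp: connected_components_of_def connected_component_of_refl)
  then show ?thesis using comp_unique assms \<open>w \<in> R\<close> by (auto simp: vcls_def)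
qed

lemma vcls_inv: "w \<in> W \<Longrightarrow> vcls (\<iota> w) = vcls w"
  using inv_R[of w] inv_inv[of w] W_sub by (auto simp: vcls_def R_def)

text \<open>Real arcs become loops of the quotient, so they cross no cut pulled back from
  it.\<close>

lemma vcls_ends_real: assumes "e \<in> ER" shows "vcls (\<gamma> e 0) = vcls (\<gamma> e 1)"
proof -
  have 01: "\<gamma> e 0 \<in> carc e" "\<gamma> e 1 \<in> carc e" by (simp_all add: carc_eq ends_def)
  then obtain C where C: "C \<in> comps" "\<gamma> e 0 \<in> C" using comp_ex carc_R[OF assms] by blast
  then show ?thesis using carc_comp[OF C(1) assms 01(1)] 01(2) vcls_real by blast
qed

text \<open>The sum is positive, hence not empty. This supplies the target for the walk along
  non-real arcs.\<close>

lemma M_real_vertex: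
  assumes M: "(\<Sum>C\<in>comps. betti1 (subtopology X C) + 1) = betti1 X + 1"
  shows "W \<inter> R \<noteq> {}"
proof -
  have "comps \<noteq> {}" using M by (metis add_is_0 one_neq_zero sum.empty)
  then show ?thesis using comp_vertex comp_sub by blast
qed

text \<open>\<open>U\<close> is the preimage under \<open>vcls\<close> of one side of the cut
  belonging to a bridge of the quotient. Invariance under \<iota> comes from
  \<open>vcls_inv\<close>, and the only arcs crossing it are the two lying over that bridge.\<close>

theorem M_bridge:
  assumes M: "(\<Sum>C\<in>comps. betti1 (subtopology X C) + 1) = betti1 X + 1"
    and e0: "e0 \<in> E" "e0 \<notin> ER"
  obtains U where "U \<subseteq> W" "\<And>w. w \<in> W \<Longrightarrow> \<iota> w \<in> U \<longleftrightarrow> w \<in> U"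
    "\<And>e. e \<in> E - {e0, tau e0} \<Longrightarrow> \<gamma> e 0 \<in> U \<longleftrightarrow> \<gamma> e 1 \<in> U" "\<not> (\<gamma> e0 0 \<in> U \<longleftrightarrow> \<gamma> e0 1 \<in> U)"
proof -
  have "\<exists>F\<subseteq>E - ER. (\<forall>e\<in>E - ER. e \<in> F \<longleftrightarrow> tau e \<notin> F) \<and> card (E - ER) = 2 * card F"
    by (rule involution_representatives) (use finite_E tau_nonreal tau_tau in auto)
  then obtain F where F: "F \<subseteq> E - ER" "\<And>e. e \<in> E - ER \<Longrightarrow> e \<in> F \<longleftrightarrow> tau e \<notin> F" "card (E - ER) = 2 * card F"
    by blast
  have "\<exists>V\<subseteq>W - R. (\<forall>w\<in>W - R. w \<in> V \<longleftrightarrow> \<iota> w \<notin> V) \<and> card (W - R) = 2 * card V"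
  proof (rule involution_representatives)
    fix w assume "w \<in> W - R"
    then have "w \<in> W" "w \<notin> R" "w \<in> topspace X" using W_sub by auto
    then show "\<iota> w \<in> W - R" "\<iota> (\<iota> w) = w" "\<iota> w \<noteq> w"
      using inv_W inv_R inv_inv by (auto simp: R_def)
  qed (use finite_W in auto)
  then obtain V where V: "V \<subseteq> W - R" "\<And>w. w \<in> W - R \<Longrightarrow> w \<in> V \<longleftrightarrow> \<iota> w \<notin> V" "card (W - R) = 2 * card V"
    by blast
  have finF: "finite F" and finV: "finite V"
    using F(1) V(1) finite_E finite_W by (auto intro: finite_subset)
  define N where "N = vcls ` V"
  define Q where "Q = comps \<union> N"
  have vclsV: "vcls w = {w, \<iota> w}" if "w \<in> W - R" for w using that by (simp add: vcls_def)
  have cardN: "card N = card V"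
    unfolding N_def
  proof (rule card_image, rule inj_onI)
    fix v w assume vw: "v \<in> V" "w \<in> V" "vcls v = vcls w"
    then have "{v, \<iota> v} = {w, \<iota> w}" using vclsV V(1) by auto
    then show "v = w" using vw V by (metis doubleton_eq_iff subsetD)
  qed
  have disj: "comps \<inter> N = {}"
    using comp_sub vclsV V(1) unfolding N_def by fastforce
  have QW: "vcls w \<in> Q" if "w \<in> W" for w
  proof (cases "w \<in> R")
    case True
    then show ?thesis using comp_ex vcls_real unfolding Q_def by (metis UnI1)
  next
    case False
    then have "w \<in> V \<or> \<iota> w \<in> V" using V(2) that by blast
    then show ?thesis
      using vcls_inv[OF that] unfolding Q_def N_def by (metis UnI2 imageI)
  qed
  have QE: "\<exists>w\<in>W. q = vcls w" if "q \<in> Q" for q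
  proof (cases "q \<in> comps")
    case True
    then show ?thesis using comp_vertex[OF True] vcls_real by blast
  next
    case False
    then show ?thesis using that V(1) unfolding Q_def N_def by blast
  qed
  \<comment> \<open>Real arcs and real vertices cancel between \<open>sum_betti_comps\<close> and
    \<open>betti1_graph\<close>; what remains is twice the desired equation.\<close>
  have cardQ: "card Q = card F + 1"
  proof -
    have "topspace X \<noteq> {}" using M_real_vertex[OF M] W_sub by blast
    then have "betti1 X + card W = card E + 1" by (rule betti1_graph[OF conn])
    moreover have "card W = card (W \<inter> R) + card (W - R)"
      using finite_W by (metis card_Int_Diff)
    moreover have "card E = card ER + card (E - ER)"
      using finite_E ER_E by (metis card_Int_Diff inf.absorb2)
    ultimately have "card F + 1 = card comps + card V"
      using M sum_betti_comps F(3) V(3) by simp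
    moreover have "card Q = card comps + card N"
      unfolding Q_def using finite_comps finV disj by (intro card_Un_disjoint) (auto simp: N_def)
    ultimately show ?thesis using cardN by simp
  qed
  \<comment> \<open>Conjugate arcs have ends in the same classes, so a cut condition on the
    representatives in \<open>F\<close> passes to every arc.\<close>
  have pull: "\<gamma> e 0 \<in> {w\<in>W. vcls w \<in> A} \<longleftrightarrow> \<gamma> e 1 \<in> {w\<in>W. vcls w \<in> A}"
    if e: "e \<in> E" and A: "e \<in> F \<Longrightarrow> vcls (\<gamma> e 0) \<in> A \<longleftrightarrow> vcls (\<gamma> e 1) \<in> A"
      "tau e \<in> F \<Longrightarrow> vcls (\<gamma> (tau e) 0) \<in> A \<longleftrightarrow> vcls (\<gamma> (tau e) 1) \<in> A" for e A
  proof -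
    have "vcls (\<gamma> e 0) \<in> A \<longleftrightarrow> vcls (\<gamma> e 1) \<in> A"
    proof (cases "e \<in> ER")
      case True then show ?thesis using vcls_ends_real by simp
    next
      case False
      then have "e \<in> F \<or> tau e \<in> F" using F(2) e by blast
      then show ?thesis
        using A tau_ends[OF e] vcls_inv ends_in_W[OF e] by metis
    qed
    then show ?thesis using ends_in_W[OF e] by simp
  qed
  define f0 where "f0 = (if e0 \<in> F then e0 else tau e0)"
  have f0: "f0 \<in> F" using F(2)[of e0] e0 by (auto simp: f0_def)
  have "\<exists>A\<subseteq>Q. (\<forall>f\<in>F - {f0}. vcls (\<gamma> f 0) \<in> A \<longleftrightarrow> vcls (\<gamma> f 1) \<in> A) \<and> \<not> (vcls (\<gamma> f0 0) \<in> A \<longleftrightarrow> vcls (\<gamma> f0 1) \<in> A)"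
  proof (rule tree_multigraph_bridge[OF _ finF _ _ cardQ f0])
    show "finite Q" using finite_comps finV by (simp add: Q_def N_def)
    show "vcls (\<gamma> f 0) \<in> Q \<and> vcls (\<gamma> f 1) \<in> Q" if "f \<in> F" for f
      using that QW ends_in_W F(1) by blast
    show "A = Q" if A: "A \<subseteq> Q" "A \<noteq> {}" "\<And>f. f \<in> F \<Longrightarrow> vcls (\<gamma> f 0) \<in> A \<longleftrightarrow> vcls (\<gamma> f 1) \<in> A" for A
    proof -
      have "{w\<in>W. vcls w \<in> A} = W"
      proof (rule connected_vertices[OF conn])
        show "{w\<in>W. vcls w \<in> A} \<noteq> {}" using A(1,2) QE by blast
        show "\<gamma> e 0 \<in> {w\<in>W. vcls w \<in> A} \<longleftrightarrow> \<gamma> e 1 \<in> {w\<in>W. vcls w \<in> A}" if "e \<in> E" for e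
          using pull[OF that] A(3) by blast
      qed auto
      then show ?thesis using A(1) QE by blast
    qed
  qed
  then obtain A where A: "A \<subseteq> Q" "\<And>f. f \<in> F - {f0} \<Longrightarrow> vcls (\<gamma> f 0) \<in> A \<longleftrightarrow> vcls (\<gamma> f 1) \<in> A"
    "\<not> (vcls (\<gamma> f0 0) \<in> A \<longleftrightarrow> vcls (\<gamma> f0 1) \<in> A)" by blast
  show thesis
  proof (rule that[of "{w\<in>W. vcls w \<in> A}"])
    show "\<iota> w \<in> {w\<in>W. vcls w \<in> A} \<longleftrightarrow> w \<in> {w\<in>W. vcls w \<in> A}" if "w \<in> W" for w
      using that vcls_inv inv_W by simp
    show "\<gamma> e 0 \<in> {w\<in>W. vcls w \<in> A} \<longleftrightarrow> \<gamma> e 1 \<in> {w\<in>W. vcls w \<in> A}" if e: "e \<in> E - {e0, tau e0}" for e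
    proof (rule pull)
      show "e \<in> E" using e by blast
      have f0': "f0 = e0 \<or> f0 = tau e0" by (simp add: f0_def)
      then have "e \<noteq> f0" using e by blast
      have "tau e \<noteq> f0"
      proof
        assume "tau e = f0"
        then have "e = tau f0" using tau_tau[of e] e by simp
        then show False using f0' tau_tau[OF e0(1)] e by auto
      qed
      show "vcls (\<gamma> e 0) \<in> A \<longleftrightarrow> vcls (\<gamma> e 1) \<in> A" if "e \<in> F"
        using A(2)[of e] that \<open>e \<noteq> f0\<close> by simp
      show "vcls (\<gamma> (tau e) 0) \<in> A \<longleftrightarrow> vcls (\<gamma> (tau e) 1) \<in> A" if "tau e \<in> F"
        using A(2)[of "tau e"] that \<open>tau e \<noteq> f0\<close> by simp
    qed
    show "\<not> (\<gamma> e0 0 \<in> {w\<in>W. vcls w \<in> A} \<longleftrightarrow> \<gamma> e0 1 \<in> {w\<in>W. vcls w \<in> A})"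
    proof -
      have "\<not> (vcls (\<gamma> e0 0) \<in> A \<longleftrightarrow> vcls (\<gamma> e0 1) \<in> A)"
      proof (cases "e0 \<in> F")
        case True
        then show ?thesis using A(3) by (simp add: f0_def)
      next
        case False
        then have "f0 = tau e0" by (simp add: f0_def)
        then show ?thesis
          using A(3) tau_ends[OF e0(1)] vcls_inv[OF ends_in_W(1)[OF e0(1)]] vcls_inv[OF ends_in_W(2)[OF e0(1)]] by auto
      qed
      then show ?thesis using ends_in_W[OF e0(1)] by simp
    qed
  qed auto
qed

end

section \<open>The topology and metric of a tropical curve\<close>

text \<open>An affine map serves for finite \<open>t\<close>. For \<open>t = \<infinity>\<close> the
  map \<open>a + x / (1 - x)\<close> is used, which blows up at 1 and so closes up continuously at
  infinity.\<close>

lemma ereal_interval_param: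
  fixes s t :: ereal
  assumes "0 \<le> s" "s < t"
  shows "\<exists>h::real \<Rightarrow> ereal. continuous_on {0..1} h \<and> h 0 = s \<and> h 1 = t \<and> inj_on h {0<..<1} \<and> h ` {0<..<1} = {s<..<t}"
proof -
  obtain a where a: "s = ereal a" "0 \<le> a"
    using assms by (cases s) auto
  show ?thesis
  proof (cases "t = \<infinity>")
    case False
    then obtain b where b: "t = ereal b" "a < b"
      using assms a by (cases t) auto
    let ?h = "\<lambda>x. ereal (a + x * (b - a))"
    have "?h ` {0<..<1} = {s<..<t}"
    proof (intro subset_antisym subsetI)
      fix y assume y: "y \<in> {s<..<t}"
      then obtain c where c: "y = ereal c" using a b by (cases y) auto
      have "(c - a) / (b - a) \<in> {0<..<1}" using y a b c by (simp add: field_simps)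
      moreover have "y = ?h ((c - a) / (b - a))" using b c by simp
      ultimately show "y \<in> ?h ` {0<..<1}" by blast
    next
      fix y assume "y \<in> ?h ` {0<..<1}"
      then obtain x where x: "0 < x" "x < 1" "y = ?h x" by auto
      have "0 < x * (b - a)" "0 < (1 - x) * (b - a)" using x b by auto
      then show "y \<in> {s<..<t}" using x(3) a b by (auto simp: algebra_simps)
    qed
    moreover have "inj_on ?h {0<..<1}" using b by (auto simp: inj_on_def)
    ultimately show ?thesis
      using a b by (intro exI[of _ ?h]) (auto intro!: continuous_intros)
  next
    case True
    let ?h = "\<lambda>x. if x = 1 then \<infinity> else ereal (a + x / (1 - x))"
    have "?h ` {0<..<1} = {s<..<t}"
    proof (intro subset_antisym subsetI)
      fix y assume y: "y \<in> {s<..<t}"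
      then obtain c where c: "y = ereal c" "a < c" using a True by (cases y) auto
      have "(c - a) / (c - a + 1) \<in> {0<..<1}" using c by (simp add: field_simps)
      moreover have "y = ?h ((c - a) / (c - a + 1))"
        using c by (simp add: field_simps)
      ultimately show "y \<in> ?h ` {0<..<1}" by blast
    next
      fix y assume "y \<in> ?h ` {0<..<1}"
      then obtain x where x: "0 < x" "x < 1" "y = ?h x" by auto
      then show "y \<in> {s<..<t}" using a True by auto
    qed
    moreover have "inj_on ?h {0<..<1}"
      by (auto simp: inj_on_def field_simps)
    moreover have "continuous_on {0..1} ?h"
      unfolding continuous_on_def
    proof
      fix x :: real assume x: "x \<in> {0..1}"
      show "(?h \<longlongrightarrow> ?h x) (at x within {0..1})"
      proof (cases "x = 1")
        case False
        have "((\<lambda>x. ereal (a + x / (1 - x))) \<longlongrightarrow> ereal (a + x / (1 - x))) (at x within {0..1})"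
          using False by (intro tendsto_intros) auto
        moreover have "\<forall>\<^sub>F y in at x within {0..1}. ereal (a + y / (1 - y)) = ?h y"
        proof -
          have "\<forall>\<^sub>F y in at x within {0..1}. y \<noteq> 1"
            using tendsto_imp_eventually_ne[OF tendsto_ident_at False] .
          then show ?thesis by (rule eventually_mono) auto
        qed
        ultimately show ?thesis
          using False by (auto intro: Lim_transform_eventually)
      next
        case True
        have "\<forall>\<^sub>F y in at x within {0..1}. ereal r < ?h y" for r
        proof -
          \<comment> \<open>Within \<open>d\<close> of 1 one has
            \<open>1 / (1 - y) > \<bar>r\<bar> + \<bar>a\<bar> + 2\<close>, and
            \<open>y / (1 - y)\<close> is smaller only by 1, so adding \<open>a\<close> still leaves
            a value above \<open>r\<close>.\<close>
          define d where "d = 1 / (\<bar>r\<bar> + \<bar>a\<bar> + 2)"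
          have "0 < d" by (simp add: d_def add_nonneg_pos)
          have "ereal r < ?h y" if "y \<in> {0..1}" "dist y x < d" for y
          proof (cases "y = 1")
            case False
            then have y: "0 < 1 - y" "1 - y < d" using that True by (auto simp: dist_real_def)
            then have "1 / d < 1 / (1 - y)" using \<open>0 < d\<close> by (simp add: frac_less2)
            then have "\<bar>r\<bar> + \<bar>a\<bar> + 2 < 1 / (1 - y)" by (simp add: d_def)
            moreover have "y / (1 - y) = 1 / (1 - y) - 1" using y by (simp add: field_simps)
            ultimately have "r < a + y / (1 - y)" by linarith
            then show ?thesis using False by simp
          qed auto
          then show ?thesis
            unfolding eventually_at using \<open>0 < d\<close> by blast
        qed
        then show ?thesis using True by (simp add: tendsto_PInfty)
      qed
    qed
    ultimately show ?thesis
      using a True by (intro exI[of _ ?h]) auto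
  qed
qed

text \<open>\<open>real_of_ereal\<close> is continuous only at finite values; the truncation keeps
  infinity away from it.\<close>

lemma continuous_on_real_min:
  assumes "A \<subseteq> {0..}"
  shows "continuous_on A (\<lambda>a. real_of_ereal (min a (ereal c)))"
proof -
  have "continuous_on A (\<lambda>a. min a (ereal c))"
    by (intro continuous_intros)
  moreover have "min a (ereal c) \<in> UNIV - {\<infinity>, -\<infinity>}" if "a \<in> A" for a
    using that assms by (auto simp: min_def)
  ultimately show ?thesis
    by (intro continuous_on_compose2[OF continuous_on_real]) auto
qed

lemma openin_gtop:
  "openin (gtop G) U \<longleftrightarrow> U \<subseteq> pts G \<and>
     (\<forall>e\<in>edges G. openin (top_of_set {0..len G e}) {a \<in> {0..len G e}. pos_pt G e a \<in> U})"
proof -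
  have "istopology (\<lambda>U. U \<subseteq> pts G \<and>
     (\<forall>e\<in>edges G. openin (top_of_set {0..len G e}) {a \<in> {0..len G e}. pos_pt G e a \<in> U}))"
    unfolding istopology_def
  proof (intro conjI allI impI ballI)
    fix S T e
    assume ST: "S \<subseteq> pts G \<and> (\<forall>e\<in>edges G. openin (top_of_set {0..len G e}) {a \<in> {0..len G e}. pos_pt G e a \<in> S})"
      "T \<subseteq> pts G \<and> (\<forall>e\<in>edges G. openin (top_of_set {0..len G e}) {a \<in> {0..len G e}. pos_pt G e a \<in> T})"
    then show "S \<inter> T \<subseteq> pts G" by blast
    assume e: "e \<in> edges G"
    have "{a \<in> {0..len G e}. pos_pt G e a \<in> S \<inter> T} =
      {a \<in> {0..len G e}. pos_pt G e a \<in> S} \<inter> {a \<in> {0..len G e}. pos_pt G e a \<in> T}" by blast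
    then show "openin (top_of_set {0..len G e}) {a \<in> {0..len G e}. pos_pt G e a \<in> S \<inter> T}"
      using ST e by (simp only:) (blast intro: openin_Int)
  next
    fix K e
    assume K: "\<forall>U\<in>K. U \<subseteq> pts G \<and> (\<forall>e\<in>edges G. openin (top_of_set {0..len G e}) {a \<in> {0..len G e}. pos_pt G e a \<in> U})"
    then show "\<Union>K \<subseteq> pts G" by blast
    assume e: "e \<in> edges G"
    have "{a \<in> {0..len G e}. pos_pt G e a \<in> \<Union>K} = (\<Union>U\<in>K. {a \<in> {0..len G e}. pos_pt G e a \<in> U})" by blast
    then show "openin (top_of_set {0..len G e}) {a \<in> {0..len G e}. pos_pt G e a \<in> \<Union>K}"
      using K e by (simp only:) (blast intro: openin_Union)
  qed
  then show ?thesis unfolding gtop_def by (simp add: topology_inverse')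
qed

section \<open>Points, continuous functions and separation on a tropical curve\<close>

locale tropical =
  fixes G :: "('v, 'e) tgraph"
  assumes tc: "tropical_curve G"
begin

lemma finite_edges: "finite (edges G)" and finite_verts: "finite (verts G)" "finite (infv G)"
  and verts_infv: "verts G \<inter> infv G = {}" and connected_gtop: "connected_space (gtop G)"
  using tc unfolding tropical_curve_def by auto

lemma
  assumes "e \<in> edges G"
  shows src_verts: "src G e \<in> verts G" and tgt_verts: "tgt G e \<in> verts G \<union> infv G" and len_pos: "0 < len G e"
    and len_inf: "len G e = \<infinity> \<longleftrightarrow> tgt G e \<in> infv G"
  using tc assms unfolding tropical_curve_def by auto

lemma pos_interior: "0 < a \<Longrightarrow> a < len G e \<Longrightarrow> pos_pt G e a = Inr e (real_of_ereal a)"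
  by (auto simp: pos_pt_def)

lemma pos_0: "pos_pt G e 0 = Vtx (src G e)" by (simp add: pos_pt_def)

lemma pos_len: "e \<in> edges G \<Longrightarrow> pos_pt G e (len G e) = Vtx (tgt G e)"
  using len_pos by (fastforce simp: pos_pt_def)

lemma pos_ereal: "0 < x \<Longrightarrow> ereal x < len G e \<Longrightarrow> pos_pt G e (ereal x) = Inr e x"
  by (simp add: pos_interior)

lemma pos_pts: "e \<in> edges G \<Longrightarrow> a \<in> {0..len G e} \<Longrightarrow> pos_pt G e a \<in> pts G"
proof -
  assume e: "e \<in> edges G" and a: "a \<in> {0..len G e}"
  consider "a = 0" | "a = len G e" | "0 < a" "a < len G e" using a by force
  then show ?thesis
  proof cases
    case 3
    then have "ereal (real_of_ereal a) = a" by (cases a) auto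
    with 3 e show ?thesis
      by (auto simp: pos_interior pts_def intro!: real_of_ereal_pos) (metis ereal_less(2) zero_ereal_def)
  qed (use e src_verts tgt_verts pos_0 pos_len in \<open>auto simp: pts_def\<close>)
qed

lemma pos_inj:
  assumes "0 < a" "a < len G e" "a' \<in> {0..len G e'}" "pos_pt G e a = pos_pt G e' a'"
  shows "e = e' \<and> a = a'"
proof -
  have "pos_pt G e a = Inr e (real_of_ereal a)" using assms pos_interior by blast
  then have a': "0 < a'" "a' < len G e'"
    using assms(3,4) by (auto simp: pos_pt_def less_le split: if_splits)
  then have "Inr e (real_of_ereal a) = (Inr e' (real_of_ereal a') :: ('v,'e) gpt)"
    using assms pos_interior by metis
  then show ?thesis using assms(1,2) a' by (cases a; cases a') auto
qed

lemma pts_cases: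
  assumes "p \<in> pts G"
  obtains v where "p = Vtx v" "v \<in> verts G \<union> infv G"
  | e x where "p = Inr e x" "e \<in> edges G" "0 < x" "ereal x < len G e" "p = pos_pt G e (ereal x)"
  using assms pos_ereal by (fastforce simp: pts_def)

lemma topspace_gtop: "topspace (gtop G) = pts G"
proof -
  have "openin (gtop G) (pts G)"
    unfolding openin_gtop
  proof (intro conjI ballI)
    fix e assume "e \<in> edges G"
    then have "{a \<in> {0..len G e}. pos_pt G e a \<in> pts G} = {0..len G e}" using pos_pts by blast
    then show "openin (top_of_set {0..len G e}) {a \<in> {0..len G e}. pos_pt G e a \<in> pts G}"
      by (metis openin_topspace topspace_euclidean_subtopology)
  qed simp
  then show ?thesis
    by (metis openin_gtop openin_subset openin_topspace subset_antisym)
qed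

lemma continuous_pos: "e \<in> edges G \<Longrightarrow> continuous_map (top_of_set {0..len G e}) (gtop G) (pos_pt G e)"
  unfolding continuous_map_def using pos_pts by (auto simp: openin_gtop topspace_gtop)

lemma continuous_from_gtop:
  assumes "\<And>p. p \<in> pts G \<Longrightarrow> f p \<in> topspace Z"
    and "\<And>e. e \<in> edges G \<Longrightarrow> continuous_map (top_of_set {0..len G e}) Z (\<lambda>a. f (pos_pt G e a))"
  shows "continuous_map (gtop G) Z f"
  unfolding continuous_map
proof (intro conjI allI impI)
  show "f ` topspace (gtop G) \<subseteq> topspace Z" using assms(1) topspace_gtop by auto
  fix U assume U: "openin Z U"
  show "openin (gtop G) {x \<in> topspace (gtop G). f x \<in> U}"
    unfolding openin_gtop
  proof (intro conjI ballI)
    fix e assume e: "e \<in> edges G"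
    have "openin (top_of_set {0..len G e}) {a \<in> topspace (top_of_set {0..len G e}). f (pos_pt G e a) \<in> U}"
      using assms(2)[OF e] U by (rule openin_continuous_map_preimage)
    moreover have "{a \<in> topspace (top_of_set {0..len G e}). f (pos_pt G e a) \<in> U}
       = {a \<in> {0..len G e}. pos_pt G e a \<in> {x \<in> topspace (gtop G). f x \<in> U}}"
      using pos_pts[OF e] topspace_gtop by auto
    ultimately show "openin (top_of_set {0..len G e}) {a \<in> {0..len G e}. pos_pt G e a \<in> {x \<in> topspace (gtop G). f x \<in> U}}"
      by simp
  qed (use topspace_gtop in auto)
qed

text \<open>A tent with slopes 1 and -1 centred at an interior point. It serves twice: it separates
  that point from all others, and as a 1-Lipschitz function it bounds \<open>gdist\<close> from
  below.\<close>

definition bump :: "'e \<Rightarrow> real \<Rightarrow> real \<Rightarrow> ('v, 'e) gpt \<Rightarrow> real" where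
  "bump e0 x0 \<epsilon> p = (case p of Vtx _ \<Rightarrow> 0 | Inr e y \<Rightarrow> if e = e0 then max 0 (\<epsilon> - \<bar>y - x0\<bar>) else 0)"

text \<open>Truncating at \<open>x0 + \<epsilon>\<close>, where the tent has come down to 0, makes
  one formula valid up to the infinite end of a leg.\<close>

lemma bump_pos:
  assumes e: "e \<in> edges G" and a: "a \<in> {0..len G e}" and "\<epsilon> \<le> x0" "ereal (x0 + \<epsilon>) \<le> len G e0" "0 < \<epsilon>"
  shows "bump e0 x0 \<epsilon> (pos_pt G e a) = (if e = e0 then max 0 (\<epsilon> - \<bar>real_of_ereal (min a (ereal (x0 + \<epsilon>))) - x0\<bar>) else 0)"
proof -
  consider "a = 0" | "a = len G e" | x where "0 < x" "ereal x < len G e" "a = ereal x"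
    using a by (cases a) force+
  then show ?thesis
  proof cases
    case 1 then show ?thesis using assms(3,5) by (simp add: pos_0[unfolded zero_ereal_def] bump_def zero_ereal_def min_def)
  next
    case 2 then show ?thesis using assms by (auto simp: pos_len bump_def min_def)
  next
    case 3
    then show ?thesis using assms(3,5) by (auto simp: pos_ereal bump_def min_def)
  qed
qed

lemma bump_radius:
  assumes "0 < x0" "ereal x0 < len G e0"
  obtains \<epsilon> where "0 < \<epsilon>" "\<epsilon> \<le> x0" "ereal (x0 + \<epsilon>) \<le> len G e0"
proof (cases "len G e0")
  case (real L)
  then show ?thesis using assms that[of "min x0 (L - x0)"] by auto
next
  case PInf
  then show ?thesis using assms that[of x0] by auto
qed (use assms in auto)

lemma continuous_bump:
  assumes "0 < \<epsilon>" "\<epsilon> \<le> x0" "ereal (x0 + \<epsilon>) \<le> len G e0"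
  shows "continuous_map (gtop G) euclideanreal (bump e0 x0 \<epsilon>)"
proof (rule continuous_from_gtop)
  fix e assume e: "e \<in> edges G"
  have "continuous_on {0..len G e} (\<lambda>a. if e = e0 then max 0 (\<epsilon> - \<bar>real_of_ereal (min a (ereal (x0 + \<epsilon>))) - x0\<bar>) else 0)"
    by (cases "e = e0") (auto intro!: continuous_intros continuous_on_real_min)
  then have "continuous_on {0..len G e} (\<lambda>a. bump e0 x0 \<epsilon> (pos_pt G e a))"
    by (rule continuous_on_eq) (use bump_pos[OF e _ assms(2,3,1)] in simp)
  then show "continuous_map (top_of_set {0..len G e}) euclideanreal (\<lambda>a. bump e0 x0 \<epsilon> (pos_pt G e a))"
    by simp
qed auto

definition half :: "'e \<Rightarrow> real" where
  "half e = (if len G e = \<infinity> then 1 else real_of_ereal (len G e) / 2)"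

lemma half: assumes "e \<in> edges G" shows "0 < half e" "ereal (2 * half e) \<le> len G e"
  using len_pos[OF assms] by (cases "len G e"; auto simp: half_def)+

text \<open>A function that is 1 at \<open>v\<close> and 0 at the other vertices. The two summands
  live on different sides of position \<open>half e\<close>, so a loop at \<open>v\<close> is
  handled correctly. On a leg the second summand is constantly 1 from position 2 on, which gives
  continuity at infinity.\<close>

definition hat :: "'v \<Rightarrow> ('v, 'e) gpt \<Rightarrow> real" where
  "hat v p = (case p of Vtx u \<Rightarrow> if u = v then 1 else 0
     | Inr e x \<Rightarrow> (if src G e = v then max 0 (1 - min x (half e) / half e) else 0)
       + (if tgt G e = v then max 0 (min x (2 * half e) / half e - 1) else 0))"

lemma continuous_hat: "continuous_map (gtop G) euclideanreal (hat v)"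
proof (rule continuous_from_gtop)
  fix e assume e: "e \<in> edges G"
  let ?f = "\<lambda>a. (if src G e = v then max 0 (1 - real_of_ereal (min a (ereal (half e))) / half e) else 0)
       + (if tgt G e = v then max 0 (real_of_ereal (min a (ereal (2 * half e))) / half e - 1) else 0)"
  note h = half[OF e]
  have eq: "hat v (pos_pt G e a) = ?f a" if a: "a \<in> {0..len G e}" for a
  proof -
    consider "a = 0" | "a = len G e" | x where "0 < x" "ereal x < len G e" "a = ereal x"
      using a by (cases a) force+
    then show ?thesis
    proof cases
      case 1 then show ?thesis using h by (simp add: pos_0[unfolded zero_ereal_def] hat_def zero_ereal_def min_def)
    next
      case 2
      have "min a (ereal (half e)) = ereal (half e)" "min a (ereal (2 * half e)) = ereal (2 * half e)"
        using h 2 order_trans[of "ereal (half e)" "ereal (2 * half e)" "len G e"] by (auto simp: min_def)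
      then show ?thesis using 2 e h by (simp add: pos_len hat_def)
    next
      case 3 then show ?thesis using h by (simp add: pos_ereal hat_def min_def)
    qed
  qed
  have "continuous_on {0..len G e} ?f"
    using h by (cases "src G e = v"; cases "tgt G e = v") (auto intro!: continuous_intros continuous_on_real_min)
  then have "continuous_on {0..len G e} (\<lambda>a. hat v (pos_pt G e a))"
    by (rule continuous_on_eq) (use eq in simp)
  then show "continuous_map (top_of_set {0..len G e}) euclideanreal (\<lambda>a. hat v (pos_pt G e a))"
    by simp
qed auto

text \<open>Continuous real functions separate points: tents take care of interior points, and
  \<open>hat\<close> distinguishes two vertices.\<close>

lemma Hausdorff_gtop: "Hausdorff_space (gtop G)"
proof -
  have sep: "\<exists>f. continuous_map (gtop G) euclideanreal f \<and> f p \<noteq> f q"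
    if pq: "p \<in> pts G" "q \<in> pts G" "p \<noteq> q" for p q
  proof -
    have inr: "\<exists>f. continuous_map (gtop G) euclideanreal f \<and> f p \<noteq> f q"
      if p: "p = Inr e x" "0 < x" "ereal x < len G e" and "p \<noteq> q" for e x p q
    proof -
      obtain \<epsilon> where \<epsilon>: "0 < \<epsilon>" "\<epsilon> \<le> x" "ereal (x + \<epsilon>) \<le> len G e"
        using bump_radius p by blast
      have "bump e x \<epsilon> p \<noteq> bump e x \<epsilon> q"
        using p \<open>p \<noteq> q\<close> \<epsilon>(1) by (auto simp: bump_def split: gpt.split)
      then show ?thesis using continuous_bump[OF \<epsilon>] by blast
    qed
    from pq(1) show ?thesis
    proof (cases rule: pts_cases)
      case (2 e x) then show ?thesis using inr pq by blast
    next
      case v: (1 v)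
      from pq(2) show ?thesis
      proof (cases rule: pts_cases)
        case (2 e x) then show ?thesis using inr[of q e x p] pq by metis
      next
        case (1 w)
        then have "hat v p \<noteq> hat v q" using v pq by (simp add: hat_def)
        then show ?thesis using continuous_hat by blast
      qed
    qed
  qed
  show ?thesis
    unfolding Hausdorff_space_def
  proof (intro allI impI, elim conjE)
    fix p q assume "p \<in> topspace (gtop G)" "q \<in> topspace (gtop G)" "p \<noteq> q"
    then obtain f where f: "continuous_map (gtop G) euclideanreal f" "f p \<noteq> f q"
      using sep topspace_gtop by blast
    obtain U V where UV: "open U" "open V" "f p \<in> U" "f q \<in> V" "U \<inter> V = {}"
      using hausdorff[OF f(2)] by blast
    let ?P = "\<lambda>U. {x \<in> topspace (gtop G). f x \<in> U}"
    have "openin (gtop G) (?P U)" "openin (gtop G) (?P V)"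
      using f(1) UV by (auto intro: openin_continuous_map_preimage)
    moreover have "disjnt (?P U) (?P V)" using UV by (auto simp: disjnt_def)
    moreover have "p \<in> ?P U" "q \<in> ?P V" using UV \<open>p \<in> topspace (gtop G)\<close> \<open>q \<in> topspace (gtop G)\<close> by auto
    ultimately show "\<exists>U V. openin (gtop G) U \<and> openin (gtop G) V \<and> p \<in> U \<and> q \<in> V \<and> disjnt U V" by blast
  qed
qed


section \<open>Subdividing a tropical curve at a finite set of points\<close>

definition reparam :: "ereal \<Rightarrow> ereal \<Rightarrow> real \<Rightarrow> ereal" where
  "reparam s t = (SOME h. continuous_on {0..1} h \<and> h 0 = s \<and> h 1 = t \<and> inj_on h {0<..<1} \<and> h ` {0<..<1} = {s<..<t})"

lemma reparam:
  assumes "0 \<le> s" "s < t"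
  shows "continuous_on {0..1} (reparam s t)" "reparam s t 0 = s" "reparam s t 1 = t"
    "inj_on (reparam s t) {0<..<1}" "reparam s t ` {0<..<1} = {s<..<t}"
  using someI_ex[OF ereal_interval_param[OF assms], folded reparam_def] by auto

text \<open>An arc is kept as an edge with two consecutive positions of \<open>W\<close>, so that
  its length and the slopes along it can be read off; \<open>apath\<close> merely supplies the
  parametrisation by the unit interval that \<open>graph_space\<close> expects.\<close>

definition arcs :: "('v, 'e) gpt set \<Rightarrow> ('e \<times> ereal \<times> ereal) set" where
  "arcs W = {(e, s, t). e \<in> edges G \<and> 0 \<le> s \<and> s < t \<and> t \<le> len G e \<and>
     pos_pt G e s \<in> W \<and> pos_pt G e t \<in> W \<and> (\<forall>r. s < r \<and> r < t \<longrightarrow> pos_pt G e r \<notin> W)}"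

definition apath :: "'e \<times> ereal \<times> ereal \<Rightarrow> real \<Rightarrow> ('v, 'e) gpt" where
  "apath = (\<lambda>(e, s, t) x. pos_pt G e (reparam s t x))"

lemma finite_positions:
  assumes "finite W" "e \<in> edges G"
  shows "finite {a \<in> {0..len G e}. pos_pt G e a \<in> W}"
proof (rule finite_subset)
  show "{a \<in> {0..len G e}. pos_pt G e a \<in> W} \<subseteq> {0, len G e} \<union> (\<lambda>p. case p of Inr e x \<Rightarrow> ereal x | _ \<Rightarrow> 0) ` W"
  proof
    fix a assume a: "a \<in> {a \<in> {0..len G e}. pos_pt G e a \<in> W}"
    then consider "a = 0" | "a = len G e" | x where "0 < x" "ereal x < len G e" "a = ereal x"
      by (cases a) force+
    then show "a \<in> {0, len G e} \<union> (\<lambda>p. case p of Inr e x \<Rightarrow> ereal x | _ \<Rightarrow> 0) ` W"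
    proof cases
      case 3
      then have "Inr e x \<in> W" using a pos_ereal by auto
      then show ?thesis using 3 by (force simp: image_iff)
    qed auto
  qed
qed (use assms in auto)

lemma finite_arcs:
  assumes "finite W"
  shows "finite (arcs W)"
proof (rule finite_subset)
  let ?P = "\<lambda>e. {a \<in> {0..len G e}. pos_pt G e a \<in> W}"
  show "arcs W \<subseteq> (\<Union>e\<in>edges G. {e} \<times> ?P e \<times> ?P e)"
    by (auto simp: arcs_def)
  show "finite (\<Union>e\<in>edges G. {e} \<times> ?P e \<times> ?P e)"
    using finite_positions[OF assms] finite_edges by auto
qed

text \<open>If two arcs on one edge overlapped without being equal, an end of one, which lies in
  \<open>W\<close>, would be interior to the other.\<close>

lemma arc_pos_unique:
  assumes "(e, s, t) \<in> arcs W" "(e', s', t') \<in> arcs W" "r \<in> {s<..<t}" "r' \<in> {s'<..<t'}"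
    and eq: "pos_pt G e r = pos_pt G e' r'"
  shows "e = e' \<and> s = s' \<and> t = t' \<and> r = r'"
proof -
  have "e = e' \<and> r = r'"
    by (rule pos_inj) (use assms in \<open>auto simp: arcs_def\<close>)
  moreover have "s = s'"
  proof (rule linorder_cases[of s s'])
    show "s < s' \<Longrightarrow> s = s'" "s' < s \<Longrightarrow> s = s'"
      using assms calculation unfolding arcs_def by (auto dest: less_trans)
  qed
  moreover have "t = t'"
  proof (rule linorder_cases[of t t'])
    show "t < t' \<Longrightarrow> t = t'" "t' < t \<Longrightarrow> t = t'"
      using assms calculation unfolding arcs_def by (auto dest: less_trans)
  qed
  ultimately show ?thesis by blast
qed

lemma arc_through:
  assumes W: "finite W" "Vtx ` (verts G \<union> infv G) \<subseteq> W" and e: "e \<in> edges G"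
    and x: "0 < x" "x < len G e" "pos_pt G e x \<notin> W"
  obtains s t where "(e, s, t) \<in> arcs W" "s < x" "x < t"
proof -
  let ?P = "{a \<in> {0..len G e}. pos_pt G e a \<in> W}"
  have fin: "finite ?P" using finite_positions W(1) e by blast
  have 0: "0 \<in> ?P" "len G e \<in> ?P"
    using W(2) e pos_0 pos_len src_verts tgt_verts len_pos[OF e] by auto
  have fin': "finite {a \<in> ?P. a < x}" "finite {a \<in> ?P. x < a}" by (auto intro: finite_subset[OF _ fin])
  define s where "s = Max {a \<in> ?P. a < x}"
  define t where "t = Min {a \<in> ?P. x < a}"
  have s: "s \<in> {a \<in> ?P. a < x}" "\<And>a. a \<in> ?P \<Longrightarrow> a < x \<Longrightarrow> a \<le> s"
    unfolding s_def using Max_in[of "{a \<in> ?P. a < x}"] Max_ge[of "{a \<in> ?P. a < x}"] fin' 0 x by blast+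
  have t: "t \<in> {a \<in> ?P. x < a}" "\<And>a. a \<in> ?P \<Longrightarrow> x < a \<Longrightarrow> t \<le> a"
    unfolding t_def using Min_in[of "{a \<in> ?P. x < a}"] Min_le[of "{a \<in> ?P. x < a}"] fin' 0 x by blast+
  have "pos_pt G e r \<notin> W" if r: "s < r" "r < t" for r
  proof
    assume "pos_pt G e r \<in> W"
    moreover have "0 \<le> r" "r \<le> len G e" using r s(1) t(1) by auto
    ultimately have "r \<in> ?P" by simp
    moreover have "r \<noteq> x" using \<open>pos_pt G e r \<in> W\<close> x(3) by blast
    ultimately show False using s(2)[of r] t(2)[of r] r by (metis linorder_neqE not_less)
  qed
  then have "(e, s, t) \<in> arcs W" using s(1) t(1) e by (auto simp: arcs_def)
  then show thesis using that s(1) t(1) by blast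
qed

lemma graph_space_arcs:
  assumes W: "finite W" "W \<subseteq> pts G" "Vtx ` (verts G \<union> infv G) \<subseteq> W"
  shows "graph_space (gtop G) W (arcs W) apath"
proof
  show "Hausdorff_space (gtop G)" by (rule Hausdorff_gtop)
  show "finite W" "W \<subseteq> topspace (gtop G)" using W topspace_gtop by auto
  show "finite (arcs W)" by (rule finite_arcs[OF W(1)])
next
  fix a assume "a \<in> arcs W"
  then obtain e s t where a: "a = (e, s, t)" "(e, s, t) \<in> arcs W" by (cases a) auto
  then have e: "e \<in> edges G" "0 \<le> s" "s < t" "t \<le> len G e" by (auto simp: arcs_def)
  note r = reparam[OF e(2,3)]
  have "reparam s t x \<in> {0..len G e}" if "x \<in> {0..1}" for x
  proof -
    have "x = 0 \<or> x = 1 \<or> x \<in> {0<..<1}" using that by auto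
    then have "reparam s t x \<in> {s..t}"
    proof (elim disjE)
      assume "x \<in> {0<..<1}"
      then have "reparam s t x \<in> {s<..<t}" using r(5) by blast
      then show ?thesis by auto
    qed (use r(2,3) e in auto)
    then show ?thesis using e by auto
  qed
  then have "continuous_map (top_of_set {0..1}) (top_of_set {0..len G e}) (reparam s t)"
    using r(1) by (auto simp: continuous_map_in_subtopology)
  then have "continuous_map (top_of_set {0..1}) (gtop G) (pos_pt G e \<circ> reparam s t)"
    using continuous_map_compose continuous_pos[OF e(1)] by blast
  then show "continuous_map (top_of_set {0..1}) (gtop G) (apath a)"
    by (simp add: apath_def a o_def)
  show "apath a 0 \<in> W" "apath a 1 \<in> W"
    using a r by (auto simp: apath_def arcs_def)
  show "apath a x \<notin> W" if x: "x \<in> {0<..<1}" for x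
  proof -
    have "reparam s t x \<in> {s<..<t}" using r(5) x by blast
    then show ?thesis using a by (auto simp: apath_def arcs_def)
  qed
  fix a' x x'
  assume "a' \<in> arcs W" and xs: "x \<in> {0<..<1::real}" "x' \<in> {0<..<1::real}" and eq: "apath a x = apath a' x'"
  then obtain e' s' t' where a': "a' = (e', s', t')" "(e', s', t') \<in> arcs W" by (cases a') auto
  then have e': "0 \<le> s'" "s' < t'" by (auto simp: arcs_def)
  note r' = reparam[OF e']
  have "reparam s t x \<in> {s<..<t}" "reparam s' t' x' \<in> {s'<..<t'}" using r(5) r'(5) xs by blast+
  with arc_pos_unique[OF a(2) a'(2)] eq
  have *: "e = e' \<and> s = s' \<and> t = t' \<and> reparam s t x = reparam s' t' x'"
    by (simp add: apath_def a(1) a'(1))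
  then show "a = a' \<and> x = x'"
    using a(1) a'(1) r(4) xs by (auto simp: inj_on_def)
next
  show "topspace (gtop G) \<subseteq> W \<union> (\<Union>a\<in>arcs W. apath a ` {0<..<1})"
  proof
    fix p assume "p \<in> topspace (gtop G)"
    then have "p \<in> pts G" using topspace_gtop by simp
    then show "p \<in> W \<union> (\<Union>a\<in>arcs W. apath a ` {0<..<1})"
    proof (cases rule: pts_cases)
      case (1 v) then show ?thesis using W(3) by blast
    next
      case (2 e x)
      show ?thesis
      proof (cases "p \<in> W")
        case False
        obtain s t where st: "(e, s, t) \<in> arcs W" "s < ereal x" "ereal x < t"
          using arc_through[OF W(1,3) 2(2), of "ereal x"] 2 False by auto
        then have "ereal x \<in> reparam s t ` {0<..<1}"
          using reparam(5)[of s t] by (auto simp: arcs_def)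
        then obtain y where "y \<in> {0<..<1}" "ereal x = reparam s t y" by blast
        then have "p = apath (e, s, t) y" using 2(5) by (simp add: apath_def)
        then show ?thesis using st(1) \<open>y \<in> {0<..<1}\<close> by blast
      qed simp
    qed
  qed
qed


text \<open>The tool for lower bounds on \<open>gdist\<close>, which is an infimum over chains: a
  test function that is 1-Lipschitz along every edge telescopes along each chain.\<close>

lemma gdist_ge:
  assumes lip: "\<And>e a b. e \<in> edges G \<Longrightarrow> a \<in> {0..len G e} \<Longrightarrow> b \<in> {0..len G e} \<Longrightarrow> a \<noteq> b \<Longrightarrow>
     ereal \<bar>F (pos_pt G e a) - F (pos_pt G e b)\<bar> \<le> \<bar>a - b\<bar>"
  shows "ereal \<bar>F p - F q\<bar> \<le> gdist G p q"
proof -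
  have l: "ereal \<bar>F x - F y\<bar> \<le> ldist G x y" for x y
    unfolding ldist_def
  proof (rule Inf_greatest)
    fix z assume "z \<in> {if a = b then 0 else \<bar>a - b\<bar> | e a b.
      e \<in> edges G \<and> a \<in> {0..len G e} \<and> b \<in> {0..len G e} \<and> pos_pt G e a = x \<and> pos_pt G e b = y}"
    then obtain e a b where *: "z = (if a = b then 0 else \<bar>a - b\<bar>)" "e \<in> edges G" "a \<in> {0..len G e}" "b \<in> {0..len G e}"
      "pos_pt G e a = x" "pos_pt G e b = y" by blast
    show "ereal \<bar>F x - F y\<bar> \<le> z"
    proof (cases "a = b")
      case True then show ?thesis using * by simp
    next
      case False then show ?thesis using * lip[OF *(2-4)] by simp
    qed
  qed
  have "ereal \<bar>F p - F q\<bar> \<le> sum_list (map2 (ldist G) (p # zs) (zs @ [q]))" for zs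
  proof (induction zs arbitrary: p)
    case Nil then show ?case using l[of p q] by simp
  next
    case (Cons z zs)
    have "ereal \<bar>F p - F q\<bar> \<le> ereal \<bar>F p - F z\<bar> + ereal \<bar>F z - F q\<bar>" by simp
    also have "\<dots> \<le> ldist G p z + sum_list (map2 (ldist G) (z # zs) (zs @ [q]))"
      using l[of p z] Cons.IH[of z] by (rule add_mono)
    finally show ?case by simp
  qed
  then show ?thesis
    unfolding gdist_def by (auto intro!: Inf_greatest)
qed

lemma gdist_edge_le:
  assumes e: "e \<in> edges G" and ab: "a \<in> {0..len G e}" "b \<in> {0..len G e}" "a \<noteq> b"
  shows "gdist G (pos_pt G e a) (pos_pt G e b) \<le> \<bar>a - b\<bar>"
proof (cases "pos_pt G e a = pos_pt G e b")
  case False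
  have "sum_list (map2 (ldist G) (pos_pt G e a # []) ([] @ [pos_pt G e b])) \<in>
    {sum_list (map2 (ldist G) (pos_pt G e a # zs) (zs @ [pos_pt G e b])) | zs. set zs \<subseteq> pts G}"
    by (intro CollectI exI[of _ "[]"]) simp
  then have "gdist G (pos_pt G e a) (pos_pt G e b) \<le> sum_list (map2 (ldist G) (pos_pt G e a # []) ([] @ [pos_pt G e b]))"
    unfolding gdist_def using False by (simp only: if_False) (auto intro: Inf_lower)
  also have "\<dots> = ldist G (pos_pt G e a) (pos_pt G e b)" by simp
  also have "\<dots> \<le> (if a = b then 0 else \<bar>a - b\<bar>)"
    unfolding ldist_def by (rule Inf_lower) (use e ab in blast)
  finally show ?thesis using ab by simp
qed (simp add: gdist_def)

text \<open>Any multiple of the indicator function of a point at infinity is 1-Lipschitz along the leg,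
  because \<open>\<bar>\<infinity> - b\<bar> = \<infinity>\<close>.\<close>

lemma gdist_infinite:
  assumes v: "v \<in> infv G" and q: "q \<noteq> Vtx v"
  shows "gdist G (Vtx v) q = \<infinity>"
proof (rule ereal_top)
  fix B :: real
  let ?F = "\<lambda>p::('v, 'e) gpt. if p = Vtx v then \<bar>B\<bar> else 0"
  have "ereal \<bar>?F (Vtx v) - ?F q\<bar> \<le> gdist G (Vtx v) q"
  proof (rule gdist_ge[where F = ?F])
    fix e a b assume *: "e \<in> edges G" "a \<in> {0..len G e}" "b \<in> {0..len G e}" "a \<noteq> b"
    have inf: "c = \<infinity>" if "c \<in> {0..len G e}" "pos_pt G e c = Vtx v" for c
    proof -
      have "src G e \<noteq> v" using src_verts[OF *(1)] v verts_infv by blast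
      then have "c \<noteq> 0" using that pos_0 by force
      then have "c = len G e" "tgt G e = v"
        using that by (auto simp: pos_pt_def split: if_splits)
      then show ?thesis using len_inf[OF *(1)] v by simp
    qed
    show "ereal \<bar>?F (pos_pt G e a) - ?F (pos_pt G e b)\<bar> \<le> \<bar>a - b\<bar>"
    proof (cases "a = \<infinity> \<or> b = \<infinity>")
      case True
      then have "\<bar>a - b\<bar> = \<infinity>" using *(2-4) by (cases a; cases b) auto
      then show ?thesis by simp
    next
      case False
      then have "pos_pt G e a \<noteq> Vtx v" "pos_pt G e b \<noteq> Vtx v" using inf *(2,3) by blast+
      then show ?thesis by (simp flip: zero_ereal_def)
    qed
  qed
  then have "ereal \<bar>B\<bar> \<le> gdist G (Vtx v) q" using q by simp
  then show "ereal B \<le> gdist G (Vtx v) q" by (rule order_trans[rotated]) simp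
qed

text \<open>The test function is the tent around \<open>x\<close>. The minimum with its height
  \<epsilon> is the price for possible shortcuts through the rest of the curve.\<close>

lemma gdist_edge_ge:
  assumes x: "0 < x" "ereal x < len G e" and \<epsilon>: "0 < \<epsilon>" "\<epsilon> \<le> x" "ereal (x + \<epsilon>) \<le> len G e"
  shows "ereal (min \<epsilon> \<bar>x - y\<bar>) \<le> gdist G (Inr e x) (Inr e y)"
proof -
  have "ereal \<bar>bump e x \<epsilon> (Inr e x) - bump e x \<epsilon> (Inr e y)\<bar> \<le> gdist G (Inr e x) (Inr e y)"
  proof (rule gdist_ge)
    fix e' a b assume *: "e' \<in> edges G" "a \<in> {0..len G e'}" "b \<in> {0..len G e'}" "a \<noteq> b"
    show "ereal \<bar>bump e x \<epsilon> (pos_pt G e' a) - bump e x \<epsilon> (pos_pt G e' b)\<bar> \<le> \<bar>a - b\<bar>"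
    proof (cases "e' = e")
      case True
      have fin: "min a (ereal (x + \<epsilon>)) = ereal u \<Longrightarrow> min b (ereal (x + \<epsilon>)) = ereal v \<Longrightarrow> ereal \<bar>u - v\<bar> \<le> \<bar>a - b\<bar>" for u v
        using * by (cases a; cases b) (auto simp: min_def split: if_splits)
      obtain u v where uv: "min a (ereal (x + \<epsilon>)) = ereal u" "min b (ereal (x + \<epsilon>)) = ereal v"
      proof -
        have "\<exists>u. min r (ereal (x + \<epsilon>)) = ereal u" if "0 \<le> r" for r
          using that by (cases r) (auto simp: min_def)
        then show ?thesis using that *(2,3) by (meson atLeastAtMost_iff)
      qed
      have "\<bar>max 0 (\<epsilon> - \<bar>u - x\<bar>) - max 0 (\<epsilon> - \<bar>v - x\<bar>)\<bar> \<le> \<bar>u - v\<bar>" by linarith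
      then show ?thesis
        using bump_pos[OF *(1,2) \<epsilon>(2,3,1)] bump_pos[OF *(1,3) \<epsilon>(2,3,1)] True fin[OF uv] uv
        by simp (metis ereal_less_eq(3) order_trans)
    next
      case False
      then show ?thesis
        using bump_pos[OF *(1,2) \<epsilon>(2,3,1)] bump_pos[OF *(1,3) \<epsilon>(2,3,1)] by (simp flip: zero_ereal_def)
    qed
  qed
  moreover have "\<bar>bump e x \<epsilon> (Inr e x) - bump e x \<epsilon> (Inr e y)\<bar> = min \<epsilon> \<bar>x - y\<bar>"
    using \<epsilon>(1) by (auto simp: bump_def min_def max_def)
  ultimately show ?thesis by simp
qed

end

section \<open>Isometric involutions and invariant subdivisions\<close>

locale real_tropical = tropical G for G :: "('v, 'e) tgraph" +
  fixes \<iota> :: "('v, 'e) gpt \<Rightarrow> ('v, 'e) gpt"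
  assumes rs: "real_structure G \<iota>"
begin

lemma iota: "p \<in> pts G \<Longrightarrow> \<iota> p \<in> pts G" "p \<in> pts G \<Longrightarrow> \<iota> (\<iota> p) = p"
  "continuous_map (gtop G) (gtop G) \<iota>"
  "p \<in> pts G \<Longrightarrow> q \<in> pts G \<Longrightarrow> gdist G (\<iota> p) (\<iota> q) = gdist G p q"
  using rs by (auto simp: real_structure_def)

text \<open>\<open>gdist\<close> agrees with arc length only locally (there may be shortcuts), hence the detour through
  local estimates and \<open>Bolzano\<close>.\<close>

lemma isometry_Lipschitz:
  assumes e: "e1 \<in> edges G" "e2 \<in> edges G"
    and \<phi>: "\<And>x. x \<in> {a..b} \<Longrightarrow> 0 < x \<and> ereal x < len G e1 \<and> 0 < \<phi> x \<and> ereal (\<phi> x) < len G e2 \<and> \<iota> (Inr e1 x) = Inr e2 (\<phi> x)"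
    and "a \<le> b"
  shows "\<bar>\<phi> b - \<phi> a\<bar> \<le> b - a"
proof -
  have loc: "\<exists>d>0. \<forall>y\<in>{a..b}. \<bar>x - y\<bar> < d \<longrightarrow> \<bar>\<phi> x - \<phi> y\<bar> \<le> \<bar>x - y\<bar>" if x: "x \<in> {a..b}" for x
  proof -
    obtain \<epsilon> where \<epsilon>: "0 < \<epsilon>" "\<epsilon> \<le> \<phi> x" "ereal (\<phi> x + \<epsilon>) \<le> len G e2"
      using bump_radius \<phi>[OF x] by blast
    have "\<bar>\<phi> x - \<phi> y\<bar> \<le> \<bar>x - y\<bar>" if y: "y \<in> {a..b}" "\<bar>x - y\<bar> < \<epsilon>" for y
    proof -
      have px: "Inr e1 x \<in> pts G" "Inr e1 y \<in> pts G"
        using \<phi>[OF x] \<phi>[OF y(1)] e by (auto simp: pts_def)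
      have "ereal (min \<epsilon> \<bar>\<phi> x - \<phi> y\<bar>) \<le> gdist G (Inr e2 (\<phi> x)) (Inr e2 (\<phi> y))"
        using gdist_edge_ge[OF _ _ \<epsilon>] \<phi>[OF x] by blast
      also have "\<dots> = gdist G (Inr e1 x) (Inr e1 y)"
        using iota(4)[OF px] \<phi>[OF x] \<phi>[OF y(1)] by simp
      also have "\<dots> \<le> ereal \<bar>x - y\<bar>"
      proof (cases "x = y")
        case False
        have "gdist G (pos_pt G e1 (ereal x)) (pos_pt G e1 (ereal y)) \<le> \<bar>ereal x - ereal y\<bar>"
          by (rule gdist_edge_le[OF e(1)]) (use \<phi>[OF x] \<phi>[OF y(1)] False in auto)
        then show ?thesis using pos_ereal \<phi>[OF x] \<phi>[OF y(1)] by simp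
      qed (simp add: gdist_def)
      \<comment> \<open>The right-hand side is below \<epsilon>, so the minimum on the left cannot
        be \<epsilon>.\<close>
      finally show ?thesis using y(2) by (simp add: min_def split: if_splits)
    qed
    then show ?thesis using \<epsilon>(1) by blast
  qed
  \<comment> \<open>The estimate passes to concatenated intervals and holds on small intervals
    around each point, by comparing both ends with that point; Bolzano's principle then yields all
    intervals.\<close>
  have "a \<le> u \<and> v \<le> b \<longrightarrow> \<bar>\<phi> v - \<phi> u\<bar> \<le> v - u" if "u \<le> v" for u v
    using that
  proof (induction rule: Bolzano)
    case (trans u v w)
    then show ?case by linarith
  next
    case (local x)
    show ?case
    proof (cases "x \<in> {a..b}")
      case True
      obtain d where d: "d > 0" "\<And>y. y \<in> {a..b} \<Longrightarrow> \<bar>x - y\<bar> < d \<Longrightarrow> \<bar>\<phi> x - \<phi> y\<bar> \<le> \<bar>x - y\<bar>"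
        using loc[OF True] by blast
      have "a \<le> u' \<and> v' \<le> b \<longrightarrow> \<bar>\<phi> v' - \<phi> u'\<bar> \<le> v' - u'" if "u' \<le> x \<and> x \<le> v' \<and> v' - u' < d" for u' v'
        using d(2)[of u'] d(2)[of v'] that True by auto
      then show ?thesis using d(1) by blast
    next
      case False
      then have "a \<le> u' \<and> v' \<le> b \<longrightarrow> \<bar>\<phi> v' - \<phi> u'\<bar> \<le> v' - u'" if "u' \<le> x \<and> x \<le> v' \<and> v' - u' < 1" for u' v'
        using that by auto
      then show ?thesis by (intro exI[of _ 1]) auto
    qed
  qed
  then show ?thesis using assms(4) by blast
qed

text \<open>In edge positions, \<iota> is a map of the first arc onto the second that does not
  increase distances, so the second arc is no longer than the first. Applied in both directions it
  gives equal lengths.\<close>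

lemma arc_length_le:
  assumes arcs: "(e1, s1, t1) \<in> arcs W1" "(e2, s2, t2) \<in> arcs W2"
    and im: "\<iota> ` pos_pt G e1 ` {s1<..<t1} = pos_pt G e2 ` {s2<..<t2}"
  shows "t2 - s2 \<le> t1 - s1"
proof -
  have e: "e1 \<in> edges G" "0 \<le> s1" "s1 < t1" "t1 \<le> len G e1" "e2 \<in> edges G" "0 \<le> s2" "s2 < t2" "t2 \<le> len G e2"
    using arcs by (auto simp: arcs_def)
  obtain a1 where a1: "s1 = ereal a1" "0 \<le> a1" using e by (cases s1) auto
  obtain a2 where a2: "s2 = ereal a2" "0 \<le> a2" using e by (cases s2) auto
  define \<phi> where "\<phi> x = (case \<iota> (Inr e1 x) of Inr _ y \<Rightarrow> y | _ \<Rightarrow> 0)" for x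
  have \<phi>: "0 < x \<and> ereal x < len G e1 \<and> 0 < \<phi> x \<and> ereal (\<phi> x) < len G e2 \<and> \<iota> (Inr e1 x) = Inr e2 (\<phi> x)"
    if x: "s1 < ereal x" "ereal x < t1" for x
  proof -
    have x0: "0 < x" "ereal x < len G e1" using x e a1 by (auto dest: less_le_trans)
    then have "\<iota> (Inr e1 x) \<in> pos_pt G e2 ` {s2<..<t2}"
      using im x pos_ereal[of x e1] by (metis (no_types, lifting) greaterThanLessThan_iff image_eqI)
    then obtain r where r: "s2 < r" "r < t2" "\<iota> (Inr e1 x) = pos_pt G e2 r" by auto
    then obtain y where y: "r = ereal y" using a2 by (cases r) auto
    have "0 < y" "ereal y < len G e2" using r y e a2 by (auto dest: less_le_trans)
    then show ?thesis using x0 r(3) y pos_ereal[of y e2] by (simp add: \<phi>_def)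
  qed
  have key: "ereal (v - u) \<le> t1 - s1" if uv: "s2 < ereal u" "u \<le> v" "ereal v < t2" for u v
  proof -
    have pre: "\<exists>x. s1 < ereal x \<and> ereal x < t1 \<and> \<phi> x = w" if w: "s2 < ereal w" "ereal w < t2" for w
    proof -
      have w0: "0 < w" "ereal w < len G e2" using w e a2 by (auto dest: less_le_trans)
      then have "Inr e2 w \<in> \<iota> ` pos_pt G e1 ` {s1<..<t1}"
        unfolding im using w pos_ereal[of w e2] by (metis greaterThanLessThan_iff image_eqI)
      then obtain r where r: "s1 < r" "r < t1" "Inr e2 w = \<iota> (pos_pt G e1 r)" by auto
      then obtain x where x: "r = ereal x" using a1 by (cases r) auto
      have "0 < x" "ereal x < len G e1" using r x e a1 by (auto dest: less_le_trans)
      then have "\<phi> x = w" using r(3) x pos_ereal[of x e1] unfolding \<phi>_def by (metis gpt.simps(6))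
      then show ?thesis using r x by auto
    qed
    obtain x y where xy: "s1 < ereal x" "ereal x < t1" "\<phi> x = u" "s1 < ereal y" "ereal y < t1" "\<phi> y = v"
      using pre[of u] pre[of v] uv by (metis ereal_less_eq(3) le_less_trans less_le_trans)
    have Lip: "\<bar>\<phi> d - \<phi> c\<bar> \<le> d - c" if "c \<le> d" "s1 < ereal c" "ereal d < t1" for c d
    proof (rule isometry_Lipschitz[OF e(1) e(5) _ that(1)])
      fix z assume "z \<in> {c..d}"
      then have "s1 < ereal z" "ereal z < t1"
        using that less_le_trans[of s1 "ereal c" "ereal z"] le_less_trans[of "ereal z" "ereal d" t1] by auto
      then show "0 < z \<and> ereal z < len G e1 \<and> 0 < \<phi> z \<and> ereal (\<phi> z) < len G e2 \<and> \<iota> (Inr e1 z) = Inr e2 (\<phi> z)"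
        by (rule \<phi>)
    qed
    have "v - u \<le> \<bar>y - x\<bar>"
      using Lip[of x y] Lip[of y x] xy by (cases "x \<le> y") auto
    also have "ereal \<bar>y - x\<bar> \<le> t1 - s1"
      using xy a1 by (cases t1) auto
    finally show ?thesis by simp
  qed
  show ?thesis
  proof (cases t2)
    case (real b2)
    then have "a2 < b2" using e a2 by simp
    show ?thesis
    proof (cases "t1 - s1")
      case (real l)
      have "b2 - a2 \<le> l"
      proof (rule field_le_epsilon)
        fix \<epsilon> :: real assume "0 < \<epsilon>"
        \<comment> \<open>The estimate \<open>key\<close> covers interior positions only, so both
          ends are approached with a margin \<delta> costing at most \<epsilon> in total.\<close>
        define \<delta> where "\<delta> = min (\<epsilon> / 2) ((b2 - a2) / 2)"
        have \<delta>: "0 < \<delta>" "2 * \<delta> \<le> \<epsilon>" "2 * \<delta> \<le> b2 - a2"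
          using \<open>0 < \<epsilon>\<close> \<open>a2 < b2\<close> by (auto simp: \<delta>_def min_def)
        have "ereal ((b2 - \<delta>) - (a2 + \<delta>)) \<le> t1 - s1"
          by (rule key) (use \<delta> a2 \<open>t2 = ereal b2\<close> in auto)
        then show "b2 - a2 \<le> l + \<epsilon>" using \<delta> real by simp
      qed
      then show ?thesis using real a2 \<open>t2 = ereal b2\<close> by simp
    qed (use e a1 in \<open>cases t1; auto\<close>)+
  next
    case PInf
    have "t1 - s1 = \<infinity>"
    proof (rule ereal_top)
      fix B :: real
      \<comment> \<open>For an infinite second arc, interior positions at arbitrarily large distance
        show that the first arc is infinite too.\<close>
      have "ereal ((a2 + 1 + max B 0) - (a2 + 1)) \<le> t1 - s1"
        by (rule key) (use a2 PInf in auto)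
      then have "ereal (max B 0) \<le> t1 - s1" by simp
      then show "ereal B \<le> t1 - s1" by (rule order_trans[rotated]) simp
    qed
    then show ?thesis by simp
  qed (use e in auto)
qed


text \<open>Two rounds of subdivision: first at an invariant vertex set containing
  \<open>W0\<close>, then at the isolated real points inside the arcs that are not real throughout.
  The second round removes the reversed arcs.\<close>

theorem ex_real_graph:
  assumes W0: "finite W0" "W0 \<subseteq> pts G"
  obtains W where "finite W" "W0 \<subseteq> W" "W \<subseteq> pts G" "Vtx ` (verts G \<union> infv G) \<subseteq> W"
    "real_graph (gtop G) W (arcs W) apath \<iota>"
proof -
  define V where "V = W0 \<union> Vtx ` (verts G \<union> infv G)"
  have V: "finite V" "V \<subseteq> pts G" using W0 finite_verts by (auto simp: V_def pts_def)
  define W1 where "W1 = V \<union> \<iota> ` V"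
  have W1: "finite W1" "W1 \<subseteq> pts G" "Vtx ` (verts G \<union> infv G) \<subseteq> W1" "W0 \<subseteq> W1" "\<And>w. w \<in> W1 \<Longrightarrow> \<iota> w \<in> W1"
    using V iota by (auto simp: W1_def V_def)
  have inv: "inv_graph (gtop G) W (arcs W) apath \<iota>"
    if "finite W" "W \<subseteq> pts G" "Vtx ` (verts G \<union> infv G) \<subseteq> W" "\<And>w. w \<in> W \<Longrightarrow> \<iota> w \<in> W" for W
    using graph_space_arcs[OF that(1-3)] that(4) iota by (simp add: inv_graph_def inv_graph_axioms_def topspace_gtop)
  interpret A: inv_graph "gtop G" W1 "arcs W1" apath \<iota> by (rule inv[OF W1(1-3,5)])
  \<comment> \<open>By \<open>two_fixpoints_arc\<close> each such arc carries at most one real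
    point, so \<open>P\<close> is finite; its points are fixed, so adding them keeps the vertex set
    invariant.\<close>
  define P where "P = (\<Union>e\<in>{e \<in> arcs W1. \<not> A.oarc e \<subseteq> A.R}. A.oarc e \<inter> A.R)"
  have finP: "finite P"
    unfolding P_def
  proof (rule finite_UN_I)
    show "finite {e \<in> arcs W1. \<not> A.oarc e \<subseteq> A.R}" using A.finite_E by simp
    fix e assume e: "e \<in> {e \<in> arcs W1. \<not> A.oarc e \<subseteq> A.R}"
    have "x = y" if "x \<in> A.oarc e \<inter> A.R" "y \<in> A.oarc e \<inter> A.R" for x y
      using A.two_fixpoints_arc[of e x y] e that by (auto simp: A.R_def)
    then show "finite (A.oarc e \<inter> A.R)"
      by (metis finite.emptyI finite_insert finite_subset insertI1 subsetI equals0I)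
  qed
  have PR: "P \<subseteq> A.R" by (auto simp: P_def)
  define W where "W = W1 \<union> P"
  have W: "finite W" "W \<subseteq> pts G" "Vtx ` (verts G \<union> infv G) \<subseteq> W" "\<And>w. w \<in> W \<Longrightarrow> \<iota> w \<in> W"
    using W1 finP PR by (auto simp: W_def A.R_def topspace_gtop)
  interpret B: inv_graph "gtop G" W "arcs W" apath \<iota> by (rule inv[OF W])
  have "real_graph (gtop G) W (arcs W) apath \<iota>"
  proof
    show "connected_space (gtop G)" by (rule connected_gtop)
    fix e assume e: "e \<in> arcs W" "\<iota> ` B.oarc e = B.oarc e"
    obtain x where x: "x \<in> B.oarc e" "\<iota> x = x" using B.invariant_arc_fixpoint[OF e] by blast
    have xt: "x \<in> topspace (gtop G)" "x \<notin> W" using x B.oarc_sub[OF e(1)] B.oarc_W[OF e(1)] by auto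
    then obtain e1 where e1: "e1 \<in> arcs W1" "x \<in> A.oarc e1" using A.topspace_eq unfolding W_def by blast
    \<comment> \<open>Otherwise the fixed point \<open>x\<close> would belong to \<open>P\<close>,
      hence to \<open>W\<close>, although it is interior to an arc of \<open>W\<close>.\<close>
    have "A.oarc e1 \<subseteq> A.R"
      using e1 x(2) xt unfolding W_def P_def A.R_def by blast
    moreover have "B.oarc e \<subseteq> A.oarc e1"
      by (rule A.connected_sub_oarc[OF B.connected_oarc[OF e(1)] _ e1(1) x(1) e1(2)])
        (use B.oarc_W[OF e(1)] in \<open>auto simp: W_def\<close>)
    ultimately show "B.oarc e \<subseteq> B.R" unfolding A.R_def B.R_def by blast
  qed
  moreover have "W0 \<subseteq> W" using W1(4) by (auto simp: W_def)
  ultimately show thesis using that W(1-3) by blast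
qed

end

section \<open>Sums of clamped linear functions\<close>

text \<open>The primitive of the indicator function of the interval from \<open>s\<close> to
  \<open>t\<close>, vanishing up to \<open>s\<close>. The value \<open>t = \<infinity>\<close> is
  allowed and gives a function that keeps growing along a leg.\<close>

definition clamp :: "ereal \<Rightarrow> ereal \<Rightarrow> real \<Rightarrow> real" where
  "clamp s t x = real_of_ereal (min (max (ereal x) s) t) - real_of_ereal s"

lemma clamp_cases:
  assumes "0 \<le> s" "s < t"
  shows "ereal x \<le> s \<Longrightarrow> clamp s t x = 0"
    "s \<le> ereal x \<Longrightarrow> ereal x \<le> t \<Longrightarrow> clamp s t x = x - real_of_ereal s"
    "t \<le> ereal x \<Longrightarrow> clamp s t x = real_of_ereal (t - s)"
  using assms by (cases s; cases t; auto simp: clamp_def min_def max_def)+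

lemma clamp_fwd:
  assumes "0 \<le> s" "s < t"
  shows "\<forall>\<^sub>F h in at_right 0. clamp s t (x + h) - clamp s t x = (if s \<le> ereal x \<and> ereal x < t then 1 else 0) * h"
proof -
  obtain a where a: "s = ereal a" using assms by (cases s) auto
  obtain d where d: "d > 0" "\<And>h. 0 < h \<Longrightarrow> h < d \<Longrightarrow> (ereal x < s \<longrightarrow> ereal (x + h) \<le> s) \<and> (ereal x < t \<longrightarrow> ereal (x + h) \<le> t)"
  proof (cases t)
    case (real b)
    then show thesis
      by (rule_tac that[of "min (if x < a then a - x else 1) (if x < b then b - x else 1)"]) (use a in \<open>auto split: if_splits\<close>)
  next
    case PInf
    then show thesis by (rule_tac that[of "if x < a then a - x else 1"]) (use a in \<open>auto split: if_splits\<close>)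
  qed (use assms in auto)
  have "clamp s t (x + h) - clamp s t x = (if s \<le> ereal x \<and> ereal x < t then 1 else 0) * h" if h: "0 < h" "h < d" for h
  proof -
    have xh: "ereal x \<le> ereal (x + h)" using h by simp
    consider "ereal x < s" | "s \<le> ereal x" "ereal x < t" | "t \<le> ereal x" by force
    then show ?thesis
    proof cases
      case 1
      then have "ereal (x + h) \<le> s" using d(2)[OF h] by simp
      then show ?thesis using clamp_cases[OF assms] 1 by auto
    next
      case 2
      then have "ereal (x + h) \<le> t" "s \<le> ereal (x + h)" using d(2)[OF h] order_trans[OF _ xh] by blast+
      then show ?thesis using clamp_cases(2)[OF assms] 2 by auto
    next
      case 3
      then have "t \<le> ereal (x + h)" using xh order_trans by blast
      then show ?thesis using clamp_cases(3)[OF assms] 3 by auto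
    qed
  qed
  then show ?thesis using d(1) by (auto simp: eventually_at_right_field)
qed

lemma clamp_bwd:
  assumes "0 \<le> s" "s < t"
  shows "\<forall>\<^sub>F h in at_right 0. clamp s t (x - h) - clamp s t x = (if s < ereal x \<and> ereal x \<le> t then -1 else 0) * h"
proof -
  obtain a where a: "s = ereal a" using assms by (cases s) auto
  obtain d where d: "d > 0" "\<And>h. 0 < h \<Longrightarrow> h < d \<Longrightarrow> (s < ereal x \<longrightarrow> s \<le> ereal (x - h)) \<and> (t < ereal x \<longrightarrow> t \<le> ereal (x - h))"
  proof (cases t)
    case (real b)
    then show thesis
      by (rule_tac that[of "min (if a < x then x - a else 1) (if b < x then x - b else 1)"]) (use a in \<open>auto split: if_splits\<close>)
  next
    case PInf
    then show thesis by (rule_tac that[of "if a < x then x - a else 1"]) (use a in \<open>auto split: if_splits\<close>)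
  qed (use assms in auto)
  have "clamp s t (x - h) - clamp s t x = (if s < ereal x \<and> ereal x \<le> t then -1 else 0) * h" if h: "0 < h" "h < d" for h
  proof -
    have xh: "ereal (x - h) \<le> ereal x" using h by simp
    consider "ereal x \<le> s" | "s < ereal x" "ereal x \<le> t" | "t < ereal x" by force
    then show ?thesis
    proof cases
      case 1
      then have "ereal (x - h) \<le> s" using xh order_trans by blast
      then show ?thesis using clamp_cases(1)[OF assms] 1 by auto
    next
      case 2
      then have "s \<le> ereal (x - h)" "ereal (x - h) \<le> t" using d(2)[OF h] order_trans[OF xh] by blast+
      then show ?thesis using clamp_cases(2)[OF assms] 2 by auto
    next
      case 3
      then have "t \<le> ereal (x - h)" using d(2)[OF h] by simp
      then show ?thesis using clamp_cases(3)[OF assms] 3 by auto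
    qed
  qed
  then show ?thesis using d(1) by (auto simp: eventually_at_right_field)
qed

text \<open>The difference has the sign convention of \<open>slope_inf\<close>: the outgoing slope
  at infinity is minus the eventual slope.\<close>

lemma clamp_inf:
  assumes "0 \<le> s" "s < t"
  shows "\<forall>\<^sub>F x in at_top. clamp s t x - clamp s t (x + 1) = (if t = \<infinity> then -1 else 0)"
proof (cases t)
  case (real b)
  show ?thesis
    using eventually_ge_at_top[of b]
  proof eventually_elim
    case (elim x)
    then show ?case using clamp_cases(3)[OF assms] real by simp
  qed
next
  case PInf
  obtain a where a: "s = ereal a" using assms by (cases s) auto
  show ?thesis
    using eventually_ge_at_top[of a]
  proof eventually_elim
    case (elim x)
    then show ?case using clamp_cases(2)[OF assms] PInf a by simp
  qed
qed (use assms in auto)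

lemma clamp_affine:
  assumes st: "0 \<le> s" "s < t" and xy: "x \<le> y"
    and S: "real_of_ereal s \<notin> {x<..<y}" "real_of_ereal t \<notin> {x<..<y}" "0 \<le> x"
  shows "affine_int_on {x..y} (clamp s t)"
proof -
  obtain a where a: "s = ereal a" using st by (cases s) auto
  consider "y \<le> a" | "a \<le> x" "t \<le> ereal x" | "a \<le> x" "ereal y \<le> t"
    using S a st by (cases t) force+
  then show ?thesis
  proof cases
    case 1
    then have "\<forall>z\<in>{x..y}. clamp s t z = of_int 0 * z + 0" using clamp_cases(1)[OF st] a by auto
    then show ?thesis unfolding affine_int_on_def by blast
  next
    case 2
    have "clamp s t z = of_int 0 * z + real_of_ereal (t - s)" if "z \<in> {x..y}" for z
      using clamp_cases(3)[OF st, of z] 2(2) that order_trans[of t "ereal x" "ereal z"] by simp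
    then show ?thesis unfolding affine_int_on_def by blast
  next
    case 3
    have "clamp s t z = of_int 1 * z + (- a)" if "z \<in> {x..y}" for z
      using clamp_cases(2)[OF st, of z] 3 that a order_trans[of "ereal z" "ereal y" t] by simp
    then show ?thesis unfolding affine_int_on_def by blast
  qed
qed

text \<open>A segment \<open>(\<epsilon>, e, s, t)\<close> contributes slope \<open>\<epsilon>\<close> between the positions \<open>s\<close> and \<open>t\<close> of \<open>e\<close>.\<close>

type_synonym 'e seg = "int \<times> 'e \<times> ereal \<times> ereal"

fun seg_val :: "'e seg list \<Rightarrow> 'e \<Rightarrow> real \<Rightarrow> real" where
  "seg_val [] e x = 0"
| "seg_val ((\<epsilon>, e', s, t) # L) e x = (if e' = e then of_int \<epsilon> * clamp s t x else 0) + seg_val L e x"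

text \<open>The weight \<open>c\<close> is instantiated with a one-sided slope of
  \<open>clamp s t\<close> at a fixed position; the sum is then the corresponding slope of
  \<open>seg_val\<close>.\<close>

fun seg_sum :: "(ereal \<Rightarrow> ereal \<Rightarrow> real) \<Rightarrow> 'e seg list \<Rightarrow> 'e \<Rightarrow> real" where
  "seg_sum c [] e = 0"
| "seg_sum c ((\<epsilon>, e', s, t) # L) e = (if e' = e then of_int \<epsilon> * c s t else 0) + seg_sum c L e"

definition valid_seg :: "('v, 'e) tgraph \<Rightarrow> 'e seg \<Rightarrow> bool" where
  "valid_seg G = (\<lambda>(\<epsilon>, e, s, t). e \<in> edges G \<and> 0 \<le> s \<and> s < t \<and> t \<le> len G e)"

abbreviation delta :: "'p \<Rightarrow> 'p \<Rightarrow> int" where "delta q p \<equiv> (if p = q then 1 else 0)"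

text \<open>The divisor of the function described by the list: leaving the segment's start the slope
  is \<epsilon>, while the outgoing slope at its far end is -\<epsilon>.\<close>

fun seg_div :: "('v, 'e) tgraph \<Rightarrow> 'e seg list \<Rightarrow> ('v, 'e) gpt \<Rightarrow> int" where
  "seg_div G [] p = 0"
| "seg_div G ((\<epsilon>, e, s, t) # L) p = \<epsilon> * (delta (pos_pt G e s) p - delta (pos_pt G e t) p) + seg_div G L p"

lemma seg_val_affine:
  assumes "\<And>l. l \<in> set L \<Longrightarrow> valid_seg G l" "x \<le> y" "0 \<le> x"
    and "\<And>\<epsilon> e' s t. (\<epsilon>, e', s, t) \<in> set L \<Longrightarrow> real_of_ereal s \<notin> {x<..<y} \<and> real_of_ereal t \<notin> {x<..<y}"
  shows "affine_int_on {x..y} (\<lambda>z. K + seg_val L e z)"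
  using assms
proof (induction L)
  case Nil
  have "\<forall>z\<in>{x..y}. K + seg_val [] e z = of_int 0 * z + K" by simp
  then show ?case unfolding affine_int_on_def by blast
next
  case (Cons l L)
  obtain \<epsilon> e' s t where l: "l = (\<epsilon>, e', s, t)" by (cases l) auto
  have "affine_int_on {x..y} (\<lambda>z. K + seg_val L e z)"
    using Cons by force
  then obtain m c where mc: "\<forall>z\<in>{x..y}. K + seg_val L e z = of_int m * z + c" unfolding affine_int_on_def by blast
  have v: "0 \<le> s" "s < t" using Cons.prems(1)[of l] by (auto simp: valid_seg_def l)
  have "affine_int_on {x..y} (clamp s t)"
    using clamp_affine[OF v Cons.prems(2)] Cons.prems(3,4) l by auto
  then obtain m' c' where mc': "\<forall>z\<in>{x..y}. clamp s t z = of_int m' * z + c'" unfolding affine_int_on_def by blast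
  show ?case
  proof (cases "e' = e")
    case True
    have "K + seg_val (l # L) e z = of_int (\<epsilon> * m' + m) * z + (of_int \<epsilon> * c' + c)" if "z \<in> {x..y}" for z
      using mc mc' that True by (simp add: l algebra_simps)
    then show ?thesis unfolding affine_int_on_def by blast
  next
    case False
    then show ?thesis using mc unfolding affine_int_on_def l by auto
  qed
qed

lemma seg_val_fwd:
  assumes "\<forall>l\<in>set L. valid_seg G l"
  shows "\<forall>\<^sub>F h in at_right 0. seg_val L e (x + h) - seg_val L e x = seg_sum (\<lambda>s t. if s \<le> ereal x \<and> ereal x < t then 1 else 0) L e * h"
  using assms
proof (induction L)
  case (Cons l L)
  obtain \<epsilon> e' s t where l: "l = (\<epsilon>, e', s, t)" by (cases l) auto
  have v: "0 \<le> s" "s < t" using Cons.prems by (auto simp: valid_seg_def l)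
  have "\<forall>\<^sub>F h in at_right 0. seg_val L e (x + h) - seg_val L e x = seg_sum (\<lambda>s t. if s \<le> ereal x \<and> ereal x < t then 1 else 0) L e * h"
    using Cons by simp
  with clamp_fwd[OF v, of x] show ?case
  proof eventually_elim
    case (elim h)
    have "of_int \<epsilon> * clamp s t (x + h) - of_int \<epsilon> * clamp s t x = of_int \<epsilon> * ((if s \<le> ereal x \<and> ereal x < t then 1 else 0) * h)"
      by (simp only: right_diff_distrib[symmetric] elim(1))
    then show ?case using elim(2) by (simp add: l algebra_simps)
  qed
qed simp

lemma seg_val_bwd:
  assumes "\<forall>l\<in>set L. valid_seg G l"
  shows "\<forall>\<^sub>F h in at_right 0. seg_val L e (x - h) - seg_val L e x = seg_sum (\<lambda>s t. if s < ereal x \<and> ereal x \<le> t then -1 else 0) L e * h"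
  using assms
proof (induction L)
  case (Cons l L)
  obtain \<epsilon> e' s t where l: "l = (\<epsilon>, e', s, t)" by (cases l) auto
  have v: "0 \<le> s" "s < t" using Cons.prems by (auto simp: valid_seg_def l)
  have "\<forall>\<^sub>F h in at_right 0. seg_val L e (x - h) - seg_val L e x = seg_sum (\<lambda>s t. if s < ereal x \<and> ereal x \<le> t then -1 else 0) L e * h"
    using Cons by simp
  with clamp_bwd[OF v, of x] show ?case
  proof eventually_elim
    case (elim h)
    have "of_int \<epsilon> * clamp s t (x - h) - of_int \<epsilon> * clamp s t x = of_int \<epsilon> * ((if s < ereal x \<and> ereal x \<le> t then -1 else 0) * h)"
      by (simp only: right_diff_distrib[symmetric] elim(1))
    then show ?case using elim(2) by (simp add: l algebra_simps)
  qed
qed simp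

lemma seg_val_inf:
  assumes "\<forall>l\<in>set L. valid_seg G l"
  shows "\<forall>\<^sub>F x in at_top. seg_val L e x - seg_val L e (x + 1) = seg_sum (\<lambda>s t. if t = \<infinity> then -1 else 0) L e"
  using assms
proof (induction L)
  case (Cons l L)
  obtain \<epsilon> e' s t where l: "l = (\<epsilon>, e', s, t)" by (cases l) auto
  have v: "0 \<le> s" "s < t" using Cons.prems by (auto simp: valid_seg_def l)
  have "\<forall>\<^sub>F x in at_top. seg_val L e x - seg_val L e (x + 1) = seg_sum (\<lambda>s t. if t = \<infinity> then -1 else 0) L e"
    using Cons by simp
  with clamp_inf[OF v] show ?case
  proof eventually_elim
    case (elim x)
    have "of_int \<epsilon> * clamp s t x - of_int \<epsilon> * clamp s t (x + 1) = of_int \<epsilon> * (if t = \<infinity> then -1 else 0)"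
      by (simp only: right_diff_distrib[symmetric] elim(1))
    then show ?case using elim(2) by (simp add: l algebra_simps)
  qed
qed simp

lemma seg_sum_cong:
  "(\<And>\<epsilon> s t. (\<epsilon>, e, s, t) \<in> set L \<Longrightarrow> c s t = d s t) \<Longrightarrow> seg_sum c L e = seg_sum d L e"
proof (induction L)
  case (Cons l L)
  obtain \<epsilon> e' s t where l: "l = (\<epsilon>, e', s, t)" by (cases l) auto
  have "seg_sum c L e = seg_sum d L e" using Cons.prems by (intro Cons.IH) auto
  moreover have "e' = e \<Longrightarrow> c s t = d s t" using Cons.prems l by auto
  ultimately show ?case by (simp add: l)
qed simp

lemma seg_sum_add: "seg_sum c L e + seg_sum d L e = seg_sum (\<lambda>s t. c s t + d s t) L e"
  by (induction c L e rule: seg_sum.induct) (auto simp: algebra_simps)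

lemma seg_val_append: "seg_val (L @ M) e x = seg_val L e x + seg_val M e x"
  by (induction L e x rule: seg_val.induct) auto

lemma seg_div_append: "seg_div G (L @ M) p = seg_div G L p + seg_div G M p"
  by (induction G L p rule: seg_div.induct) auto

definition seg_neg :: "'e seg list \<Rightarrow> 'e seg list" where
  "seg_neg = map (\<lambda>(\<epsilon>, r). (- \<epsilon>, r))"

lemma seg_val_neg: "seg_val (seg_neg L) e x = - seg_val L e x"
  by (induction L e x rule: seg_val.induct) (auto simp: seg_neg_def)

lemma seg_div_neg: "seg_div G (seg_neg L) p = - seg_div G L p"
  by (induction G L p rule: seg_div.induct) (auto simp: seg_neg_def algebra_simps)

section \<open>Linear equivalence through explicit slope segments\<close>

context tropical
begin

text \<open>Linear equivalence through functions given by segments; transitivity is concatenation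
  of lists, so additivity of one-sided slopes of general rational functions is not needed.\<close>

definition slope_equiv :: "(('v, 'e) gpt \<Rightarrow> int) \<Rightarrow> (('v, 'e) gpt \<Rightarrow> int) \<Rightarrow> bool" where
  "slope_equiv D1 D2 \<longleftrightarrow> (\<exists>L f K. (\<forall>l\<in>set L. valid_seg G l) \<and>
     (\<forall>e\<in>edges G. \<forall>x\<in>edom G e. along G f e x = K e + seg_val L e x) \<and>
     (\<forall>p\<in>pts G. D2 p - D1 p = seg_div G L p))"

lemma slope_equiv_refl: "slope_equiv D D"
  unfolding slope_equiv_def
  by (rule exI[of _ "[]"], rule exI[of _ "\<lambda>_. 0"], rule exI[of _ "\<lambda>_. 0"]) (simp add: along_def)

lemma slope_equiv_trans:
  assumes "slope_equiv D1 D2" "slope_equiv D2 D3"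
  shows "slope_equiv D1 D3"
proof -
  obtain L f K where 1: "\<forall>l\<in>set L. valid_seg G l" "\<forall>e\<in>edges G. \<forall>x\<in>edom G e. along G f e x = K e + seg_val L e x"
    "\<forall>p\<in>pts G. D2 p - D1 p = seg_div G L p" using assms(1) unfolding slope_equiv_def by blast
  obtain M g J where 2: "\<forall>l\<in>set M. valid_seg G l" "\<forall>e\<in>edges G. \<forall>x\<in>edom G e. along G g e x = J e + seg_val M e x"
    "\<forall>p\<in>pts G. D3 p - D2 p = seg_div G M p" using assms(2) unfolding slope_equiv_def by blast
  show ?thesis
    unfolding slope_equiv_def
  proof (intro exI conjI ballI)
    show "valid_seg G l" if "l \<in> set (L @ M)" for l using that 1 2 by auto
    show "along G (\<lambda>p. f p + g p) e x = (\<lambda>e. K e + J e) e + seg_val (L @ M) e x" if "e \<in> edges G" "x \<in> edom G e" for e x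
      using 1(2) 2(2) that by (simp add: along_def seg_val_append)
    show "D3 p - D1 p = seg_div G (L @ M) p" if "p \<in> pts G" for p
      using bspec[OF 1(3) that] bspec[OF 2(3) that] by (simp add: seg_div_append)
  qed
qed

lemma slope_equiv_sym:
  assumes "slope_equiv D1 D2"
  shows "slope_equiv D2 D1"
proof -
  obtain L f K where 1: "\<forall>l\<in>set L. valid_seg G l" "\<forall>e\<in>edges G. \<forall>x\<in>edom G e. along G f e x = K e + seg_val L e x"
    "\<forall>p\<in>pts G. D2 p - D1 p = seg_div G L p" using assms(1) unfolding slope_equiv_def by blast
  show ?thesis
    unfolding slope_equiv_def
  proof (intro exI conjI ballI)
    show "valid_seg G l" if "l \<in> set (seg_neg L)" for l using that 1 by (auto simp: valid_seg_def seg_neg_def)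
    show "along G (\<lambda>p. - f p) e x = (\<lambda>e. - K e) e + seg_val (seg_neg L) e x" if "e \<in> edges G" "x \<in> edom G e" for e x
      using 1(2) that by (simp add: along_def seg_val_neg)
    show "D1 p - D2 p = seg_div G (seg_neg L) p" if "p \<in> pts G" for p
      using bspec[OF 1(3) that] by (simp add: seg_div_neg)
  qed
qed

lemma slope_equiv_diff:
  assumes "slope_equiv D1 D2" "\<And>p. D2 p - D1 p = D2' p - D1' p"
  shows "slope_equiv D1' D2'"
  using assms unfolding slope_equiv_def by simp

lemma pos_eq_vtx:
  assumes "valid_seg G (\<epsilon>, e, s, t)"
  shows "pos_pt G e s = Vtx v \<longleftrightarrow> s = 0 \<and> src G e = v" "pos_pt G e t = Vtx v \<longleftrightarrow> t = len G e \<and> tgt G e = v"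
  using assms by (auto simp: valid_seg_def pos_pt_def)

lemma seg_div_Vtx:
  assumes "\<And>l. l \<in> set L \<Longrightarrow> valid_seg G l"
  shows "real_of_int (seg_div G L (Vtx v)) =
    (\<Sum>e\<in>{e\<in>edges G. src G e = v}. seg_sum (\<lambda>s t. if s = 0 then 1 else 0) L e) +
    (\<Sum>e\<in>{e\<in>edges G. tgt G e = v}. seg_sum (\<lambda>s t. if t = len G e then -1 else 0) L e)"
  using assms
proof (induction L)
  case (Cons l L)
  obtain \<epsilon> e' s t where l: "l = (\<epsilon>, e', s, t)" by (cases l) auto
  have v: "valid_seg G (\<epsilon>, e', s, t)" using Cons.prems l by auto
  have e': "e' \<in> edges G" using v by (simp add: valid_seg_def)
  have S: "(\<Sum>e\<in>{e\<in>edges G. P e}. if e' = e then c e else 0) = (if P e' then c e' else 0)" for P and c :: "'e \<Rightarrow> real"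
    using e' finite_edges by (simp add: sum.delta')
  have IH: "real_of_int (seg_div G L (Vtx v)) =
    (\<Sum>e\<in>{e\<in>edges G. src G e = v}. seg_sum (\<lambda>s t. if s = 0 then 1 else 0) L e) +
    (\<Sum>e\<in>{e\<in>edges G. tgt G e = v}. seg_sum (\<lambda>s t. if t = len G e then -1 else 0) L e)"
    using Cons by simp
  have d: "delta (pos_pt G e' s) (Vtx v) = (if s = 0 \<and> src G e' = v then 1 else 0)"
    "delta (pos_pt G e' t) (Vtx v) = (if t = len G e' \<and> tgt G e' = v then 1 else 0)"
    using pos_eq_vtx[OF v] by (metis (full_types))+
  show ?case
    unfolding l by (simp only: seg_div.simps seg_sum.simps sum.distrib S of_int_add IH d) auto
qed simp

lemma seg_div_Inr:
  assumes "\<And>l. l \<in> set L \<Longrightarrow> valid_seg G l" and e: "e \<in> edges G" "0 < x" "ereal x < len G e"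
  shows "real_of_int (seg_div G L (Inr e x)) = seg_sum (\<lambda>s t. (if s = ereal x then 1 else 0) - (if t = ereal x then 1 else 0)) L e"
  using assms(1)
proof (induction L)
  case (Cons l L)
  obtain \<epsilon> e' s t where l: "l = (\<epsilon>, e', s, t)" by (cases l) auto
  have v: "e' \<in> edges G" "0 \<le> s" "s < t" "t \<le> len G e'" using Cons.prems[of l] by (auto simp: valid_seg_def l)
  have "pos_pt G e' a = Inr e x \<longleftrightarrow> e' = e \<and> a = ereal x" if "a \<in> {0..len G e'}" for a
  proof
    assume "pos_pt G e' a = Inr e x"
    then have "pos_pt G e (ereal x) = pos_pt G e' a" using pos_ereal e by simp
    then show "e' = e \<and> a = ereal x" using pos_inj[of "ereal x" e a e'] e that by auto
  qed (use pos_ereal e in auto)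
  from this[of s] this[of t] have d: "delta (pos_pt G e' s) (Inr e x) = (if e' = e \<and> s = ereal x then 1 else 0)"
    "delta (pos_pt G e' t) (Inr e x) = (if e' = e \<and> t = ereal x then 1 else 0)"
    using v by (auto simp: eq_commute[of "Inr e x"])
  show ?case
    unfolding l using Cons by (simp only: seg_div.simps seg_sum.simps of_int_add d) auto
qed simp

theorem slope_equiv_imp_lin_equiv:
  assumes "slope_equiv D1 D2"
  shows "lin_equiv G D1 D2"
proof -
  obtain L f K where L: "\<And>l. l \<in> set L \<Longrightarrow> valid_seg G l"
    and f: "\<And>e x. e \<in> edges G \<Longrightarrow> x \<in> edom G e \<Longrightarrow> along G f e x = K e + seg_val L e x"
    and D: "\<And>p. p \<in> pts G \<Longrightarrow> D2 p - D1 p = seg_div G L p"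
    using assms unfolding slope_equiv_def by blast
  have L': "\<forall>l\<in>set L. valid_seg G l" using L by blast
  have "rational_fun G f"
    unfolding rational_fun_def pw_affine_int_def
  proof
    fix e assume e: "e \<in> edges G"
    \<comment> \<open>The ends of all segments, on whatever edge, serve as breakpoints. An infinite
      end is turned into 0 by \<open>real_of_ereal\<close>, which only adds a harmless
      breakpoint.\<close>
    let ?S = "(\<lambda>(\<epsilon>, e, s, t). real_of_ereal s) ` set L \<union> (\<lambda>(\<epsilon>, e, s, t). real_of_ereal t) ` set L"
    have "affine_int_on {x..y} (along G f e)"
      if xy: "x \<in> edom G e" "y \<in> edom G e" "x \<le> y" and S: "{x<..<y} \<inter> ?S = {}" for x y
    proof -
      have "affine_int_on {x..y} (\<lambda>z. K e + seg_val L e z)"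
      proof (rule seg_val_affine[OF L xy(3)])
        show "0 \<le> x" using xy by (simp add: edom_def)
        show "real_of_ereal s \<notin> {x<..<y} \<and> real_of_ereal t \<notin> {x<..<y}" if "(\<epsilon>, e', s, t) \<in> set L" for \<epsilon> e' s t
          using S that by (fastforce simp: image_iff disjoint_iff)
      qed
      moreover have "along G f e z = K e + seg_val L e z" if "z \<in> {x..y}" for z
      proof (rule f[OF e])
        have "ereal z \<le> ereal y" using that by simp
        then show "z \<in> edom G e" using xy that order_trans[of "ereal z" "ereal y" "len G e"] by (auto simp: edom_def)
      qed
      ultimately show ?thesis unfolding affine_int_on_def by simp
    qed
    then show "\<exists>S. finite S \<and> (\<forall>x\<in>edom G e. \<forall>y\<in>edom G e. x \<le> y \<longrightarrow> {x<..<y} \<inter> S = {} \<longrightarrow> affine_int_on {x..y} (along G f e))"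
      by (intro exI[of _ ?S]) auto
  qed
  moreover have fwd: "slope_fwd (along G f e) x = seg_sum (\<lambda>s t. if s \<le> ereal x \<and> ereal x < t then 1 else 0) L e"
    if e: "e \<in> edges G" and x: "0 \<le> x" "ereal x < len G e" for e x
  proof -
    let ?m = "seg_sum (\<lambda>s t. if s \<le> ereal x \<and> ereal x < t then 1 else 0) L e"
    have "\<forall>\<^sub>F h in at_right 0. x + h \<in> edom G e"
    proof -
      obtain d where "d > 0" "ereal (x + d) \<le> len G e"
      proof (cases "len G e")
        case (real l) then show thesis using that[of "l - x"] x by auto
      next
        case PInf then show thesis using that[of 1] by auto
      qed (use x in auto)
      then have "x + h \<in> edom G e" if "0 < h" "h < d" for h
        using that x order_trans[of "ereal (x + h)" "ereal (x + d)" "len G e"] by (auto simp: edom_def)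
      then show ?thesis using \<open>d > 0\<close> by (auto simp: eventually_at_right_field)
    qed
    note ev = this
    have xe: "x \<in> edom G e" using x by (simp add: edom_def)
    from ev have "\<forall>\<^sub>F h in at_right 0. (along G f e (x + h) - along G f e x) / h = ?m"
      using seg_val_fwd[of L G e x, OF L'] eventually_at_right_less[of 0]
      by eventually_elim (simp add: f[OF e] xe)
    then have "((\<lambda>h. (along G f e (x + h) - along G f e x) / h) \<longlongrightarrow> ?m) (at_right 0)"
      by (rule tendsto_eventually)
    then show ?thesis unfolding slope_fwd_def by (intro tendsto_Lim) auto
  qed
  moreover have bwd: "slope_bwd (along G f e) x = seg_sum (\<lambda>s t. if s < ereal x \<and> ereal x \<le> t then -1 else 0) L e"
    if e: "e \<in> edges G" and x: "0 < x" "ereal x \<le> len G e" for e x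
  proof -
    let ?m = "seg_sum (\<lambda>s t. if s < ereal x \<and> ereal x \<le> t then -1 else 0) L e"
    have "\<forall>\<^sub>F h in at_right 0. x - h \<in> edom G e"
    proof -
      have "x - h \<in> edom G e" if "0 < h" "h < x" for h
        using that x order_trans[of "ereal (x - h)" "ereal x" "len G e"] by (auto simp: edom_def)
      then show ?thesis using x(1) by (auto simp: eventually_at_right_field)
    qed
    note ev = this
    have xe: "x \<in> edom G e" using x by (simp add: edom_def)
    from ev have "\<forall>\<^sub>F h in at_right 0. (along G f e (x - h) - along G f e x) / h = ?m"
      using seg_val_bwd[of L G e x, OF L'] eventually_at_right_less[of 0]
      by eventually_elim (simp add: f[OF e] xe)
    then have "((\<lambda>h. (along G f e (x - h) - along G f e x) / h) \<longlongrightarrow> ?m) (at_right 0)"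
      by (rule tendsto_eventually)
    then show ?thesis unfolding slope_bwd_def by (intro tendsto_Lim) auto
  qed
  moreover have inf: "slope_inf (along G f e) = seg_sum (\<lambda>s t. if t = \<infinity> then -1 else 0) L e"
    if e: "e \<in> edges G" and i: "len G e = \<infinity>" for e
  proof -
    let ?m = "seg_sum (\<lambda>s t. if t = \<infinity> then -1 else 0) L e"
    have "\<forall>\<^sub>F x in at_top. along G f e x - along G f e (x + 1) = ?m"
      using seg_val_inf[of L G e, OF L'] eventually_ge_at_top[of 0]
      by eventually_elim (simp add: f[OF e] edom_def i)
    then have "((\<lambda>x. along G f e x - along G f e (x + 1)) \<longlongrightarrow> ?m) at_top"
      by (rule tendsto_eventually)
    then show ?thesis unfolding slope_inf_def by (intro tendsto_Lim) auto
  qed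
  have Del: "real_of_int (seg_div G L p) = Delta G f p" if p: "p \<in> pts G" for p
    using p
  proof (cases rule: pts_cases)
    case (1 v)
    have a: "slope_fwd (along G f e) 0 = seg_sum (\<lambda>s t. if s = 0 then 1 else 0) L e" if "e \<in> edges G" for e
    proof -
      have "slope_fwd (along G f e) 0 = seg_sum (\<lambda>s t. if s \<le> ereal 0 \<and> ereal 0 < t then 1 else 0) L e"
        by (rule fwd) (use that len_pos[OF that] in \<open>auto simp flip: zero_ereal_def\<close>)
      also have "\<dots> = seg_sum (\<lambda>s t. if s = 0 then 1 else 0) L e"
        by (rule seg_sum_cong) (use L in \<open>fastforce simp: valid_seg_def simp flip: zero_ereal_def\<close>)
      finally show ?thesis .
    qed
    have b: "(if len G e = \<infinity> then slope_inf (along G f e) else slope_bwd (along G f e) (real_of_ereal (len G e)))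
       = seg_sum (\<lambda>s t. if t = len G e then -1 else 0) L e" if e: "e \<in> edges G" for e
    proof (cases "len G e = \<infinity>")
      case True then show ?thesis using inf[OF e] by simp
    next
      case False
      then obtain l where l: "len G e = ereal l" "0 < l" using len_pos[OF e] by (cases "len G e") auto
      have "slope_bwd (along G f e) l = seg_sum (\<lambda>s t. if s < ereal l \<and> ereal l \<le> t then -1 else 0) L e"
        by (rule bwd) (use e l in auto)
      also have "\<dots> = seg_sum (\<lambda>s t. if t = len G e then -1 else 0) L e"
        by (rule seg_sum_cong) (use L l in \<open>fastforce simp: valid_seg_def\<close>)
      finally show ?thesis using l by simp
    qed
    show ?thesis
      using p unfolding 1(1) Delta_def by (simp add: seg_div_Vtx[OF L] a b)
  next
    case (2 e x)
    have "Delta G f p = slope_fwd (along G f e) x + slope_bwd (along G f e) x"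
      using p unfolding 2(1) Delta_def by simp
    also have "\<dots> = seg_sum (\<lambda>s t. (if s \<le> ereal x \<and> ereal x < t then 1 else 0) + (if s < ereal x \<and> ereal x \<le> t then -1 else 0)) L e"
      using fwd[of e x] bwd[of e x] 2 by (simp add: seg_sum_add)
    \<comment> \<open>A segment running through the point has opposite outgoing slopes in the two
      directions, which cancel; only segments that start or end there survive.\<close>
    also have "\<dots> = seg_sum (\<lambda>s t. (if s = ereal x then 1 else 0) - (if t = ereal x then 1 else 0)) L e"
      by (rule seg_sum_cong) (use L in \<open>fastforce simp: valid_seg_def\<close>)
    finally show ?thesis using seg_div_Inr[OF L 2(2-4)] 2(1) by simp
  qed
  have "\<forall>p\<in>pts G. real_of_int (D2 p - D1 p) = Delta G f p"
    using D Del by metis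
  then show ?thesis
    using \<open>rational_fun G f\<close> unfolding lin_equiv_def by blast
qed

end

section \<open>Moving conjugate pairs to real points\<close>

context tropical
begin

lemma apath_ends:
  assumes "(e, s, t) \<in> arcs W"
  shows "apath (e, s, t) 0 = pos_pt G e s" "apath (e, s, t) 1 = pos_pt G e t"
    "apath (e, s, t) ` {0<..<1} = pos_pt G e ` {s<..<t}"
proof -
  have st: "0 \<le> s" "s < t" using assms by (auto simp: arcs_def)
  show "apath (e, s, t) 0 = pos_pt G e s" "apath (e, s, t) 1 = pos_pt G e t"
    using reparam[OF st] by (auto simp: apath_def)
  show "apath (e, s, t) ` {0<..<1} = pos_pt G e ` {s<..<t}"
    unfolding reparam(5)[OF st, symmetric] by (auto simp: apath_def)
qed

lemma arcs_disjoint: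
  assumes "(e, s, t) \<in> arcs W" "(e, s', t') \<in> arcs W" "(s, t) \<noteq> (s', t')"
  shows "t \<le> s' \<or> t' \<le> s"
proof (rule ccontr)
  assume "\<not> ?thesis"
  then have "max s s' < min t t'" using assms by (auto simp: arcs_def)
  then obtain r where "max s s' < r" "r < min t t'" using dense by blast
  then have "r \<in> {s<..<t}" "r \<in> {s'<..<t'}" by auto
  then show False using arc_pos_unique[OF assms(1,2)] assms(3) by blast
qed

text \<open>Different arcs on one edge do not overlap, so the clamped function of one is constant
  along the other.\<close>

lemma clamp_arc:
  assumes "(e, s, t) \<in> arcs W" "(e, s', t') \<in> arcs W" "t = ereal b" "s = ereal a"
  shows "clamp s' t' b - clamp s' t' a = (if (s, t) = (s', t') then b - a else 0)"
proof -
  have st: "s < t" "0 \<le> s'" "s' < t'" using assms by (auto simp: arcs_def)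
  show ?thesis
  proof (cases "(s, t) = (s', t')")
    case True
    then show ?thesis using clamp_cases[OF st(2,3)] assms st(1) by auto
  next
    case False
    then consider "t \<le> s'" | "t' \<le> s" using arcs_disjoint[OF assms(1,2)] by blast
    then show ?thesis
    proof cases
      case 1
      then have "ereal b \<le> s'" "ereal a \<le> s'" using assms(3,4) st(1) order_trans[of "ereal a" "ereal b" s'] by auto
      then show ?thesis using clamp_cases(1)[OF st(2,3)] False by auto
    next
      case 2
      then have "t' \<le> ereal b" "t' \<le> ereal a" using assms(3,4) st(1) order_trans[of t' "ereal a" "ereal b"] by auto
      then show ?thesis using clamp_cases(3)[OF st(2,3)] False by auto
    qed
  qed
qed

text \<open>Vertex values \<rho> and \<open>seg_val\<close> have the same increment over each arc,
  so along an edge they differ by a constant. This makes a function prescribed by \<rho> at the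
  vertices well defined on the edges.\<close>

lemma potential_along_edge:
  assumes W: "finite W" "Vtx ` (verts G \<union> infv G) \<subseteq> W"
    and L: "\<And>\<epsilon> e s t. (\<epsilon>, e, s, t) \<in> set L \<Longrightarrow> (e, s, t) \<in> arcs W"
    and \<rho>: "\<And>e s a b. (e, s, ereal b) \<in> arcs W \<Longrightarrow> s = ereal a \<Longrightarrow>
       \<rho> (pos_pt G e (ereal b)) - \<rho> (pos_pt G e s) = seg_val L e b - seg_val L e a"
    and e: "e \<in> edges G" and x: "0 \<le> x" "ereal x \<le> len G e" "pos_pt G e (ereal x) \<in> W"
  shows "\<rho> (pos_pt G e (ereal x)) = \<rho> (Vtx (src G e)) + seg_val L e x"
proof (rule ccontr)
  \<comment> \<open>Induction along the positions of \<open>W\<close> on the edge, in minimal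
    counterexample form: the position of \<open>W\<close> just before the least bad one is good, and
    the two bound an arc. Infinity is excluded because values there are not compared.\<close>
  let ?bad = "{a \<in> {0..len G e}. pos_pt G e a \<in> W \<and> a \<noteq> \<infinity> \<and> \<rho> (pos_pt G e a) \<noteq> \<rho> (Vtx (src G e)) + seg_val L e (real_of_ereal a)}"
  let ?P = "{a \<in> {0..len G e}. pos_pt G e a \<in> W}"
  have finP: "finite ?P" using finite_positions W(1) e by blast
  have finb: "finite ?bad" by (rule finite_subset[OF _ finP]) auto
  assume "\<rho> (pos_pt G e (ereal x)) \<noteq> \<rho> (Vtx (src G e)) + seg_val L e x"
  then have "ereal x \<in> ?bad" using x by simp
  then have ne: "?bad \<noteq> {}" by blast
  define m where "m = Min ?bad"
  have m: "m \<in> ?bad" "\<And>a. a \<in> ?bad \<Longrightarrow> m \<le> a"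
    unfolding m_def using Min_in[OF finb ne] Min_le[OF finb] by blast+
  obtain b where b: "m = ereal b" using m(1) by (cases m) auto
  have L0: "seg_val L e 0 = 0"
    using L
  proof (induction L)
    case (Cons l L)
    obtain \<epsilon> e' s t where l: "l = (\<epsilon>, e', s, t)" by (cases l) auto
    have "(e', s, t) \<in> arcs W" using Cons.prems l by auto
    then have "clamp s t 0 = 0" using clamp_cases(1)[of s t 0] by (auto simp: arcs_def simp flip: zero_ereal_def)
    moreover have "seg_val L e 0 = 0" using Cons by auto
    ultimately show ?case by (simp add: l)
  qed simp
  have "m \<noteq> 0" using m(1) pos_0 L0 by auto
  then have m0: "0 < m" using m(1) by auto
  let ?Q = "{a \<in> ?P. a < m}"
  have finQ: "finite ?Q" by (rule finite_subset[OF _ finP]) auto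
  have "0 \<in> ?Q" using m0 pos_0 W(2) src_verts[OF e] len_pos[OF e] by auto
  then have neQ: "?Q \<noteq> {}" by blast
  define s where "s = Max ?Q"
  have s: "s \<in> ?Q" "\<And>a. a \<in> ?Q \<Longrightarrow> a \<le> s"
    unfolding s_def using Max_in[OF finQ neQ] Max_ge[OF finQ] by blast+
  obtain a where a: "s = ereal a" using s(1) b by (cases s) auto
  have "pos_pt G e r \<notin> W" if r: "s < r" "r < m" for r
  proof
    assume "pos_pt G e r \<in> W"
    then have "r \<in> ?Q" using r s(1) m(1) by auto
    then show False using s(2)[of r] r by simp
  qed
  then have arc: "(e, s, ereal b) \<in> arcs W" using s(1) m(1) e b by (auto simp: arcs_def)
  have "s \<notin> ?bad"
  proof
    assume "s \<in> ?bad"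
    then have "m \<le> s" by (rule m(2))
    then show False using s(1) by (simp add: not_le[symmetric])
  qed
  then have "\<rho> (pos_pt G e s) = \<rho> (Vtx (src G e)) + seg_val L e a" using s(1) a by simp
  then have "\<rho> (pos_pt G e m) = \<rho> (Vtx (src G e)) + seg_val L e b" using \<rho>[OF arc a] b by simp
  then show False using m(1) b by simp
qed

end

context real_tropical
begin

definition conj_pair :: "('v, 'e) gpt \<Rightarrow> ('v, 'e) gpt \<Rightarrow> int" where
  "conj_pair w p = delta w p + delta (\<iota> w) p"

text \<open>A point at infinity has infinite \<open>gdist\<close> to every other point, whereas the
  finite end of a leg arc has neighbours at finite distance; an isometry cannot exchange
  them.\<close>

lemma infinite_end:
  assumes arcs: "(e1, s1, \<infinity>) \<in> arcs W" "(e2, s2, \<infinity>) \<in> arcs W"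
  shows "\<iota> (pos_pt G e1 \<infinity>) \<noteq> pos_pt G e2 s2"
proof
  assume eq: "\<iota> (pos_pt G e1 \<infinity>) = pos_pt G e2 s2"
  have e: "e1 \<in> edges G" "len G e1 = \<infinity>" "e2 \<in> edges G" "len G e2 = \<infinity>" "0 \<le> s2" "s2 < \<infinity>"
    using arcs by (auto simp: arcs_def)
  obtain a where a: "s2 = ereal a" "0 \<le> a" using e by (cases s2) auto
  define v where "v = tgt G e1"
  have v: "pos_pt G e1 \<infinity> = Vtx v" "v \<in> infv G"
    using pos_len[OF e(1)] len_inf[OF e(1)] e(2) by (simp_all add: v_def)
  \<comment> \<open>A neighbour at distance at most 1 from the finite end; any interior position
    further along the leg would serve.\<close>
  let ?q = "pos_pt G e2 (ereal (a + 1))"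
  have q: "?q = Inr e2 (a + 1)" using pos_ereal[of "a + 1" e2] a e by simp
  have pts: "Vtx v \<in> pts G" "?q \<in> pts G" "pos_pt G e2 s2 \<in> pts G"
    using v(2) pos_pts[OF e(3)] a e by (auto simp: pts_def)
  have "gdist G (pos_pt G e2 s2) ?q \<le> \<bar>s2 - ereal (a + 1)\<bar>"
    by (rule gdist_edge_le) (use e a in auto)
  then have fin: "gdist G (pos_pt G e2 s2) ?q \<noteq> \<infinity>" using a by auto
  have "\<iota> ?q \<noteq> Vtx v"
  proof
    assume "\<iota> ?q = Vtx v"
    then have "\<iota> (\<iota> ?q) = pos_pt G e2 s2" using eq v by simp
    then have "?q = pos_pt G e2 s2" using iota(2) pts by simp
    then show False using pos_inj[of "ereal (a + 1)" e2 s2 e2] a e by auto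
  qed
  then have "gdist G (Vtx v) (\<iota> ?q) = \<infinity>" using gdist_infinite v(2) by blast
  moreover have "gdist G (Vtx v) (\<iota> ?q) = gdist G (\<iota> (Vtx v)) ?q"
    using iota(4)[of "Vtx v" "\<iota> ?q"] iota(1,2)[OF pts(2)] pts by simp
  ultimately show False using fin eq v by simp
qed

text \<open>For finite arcs the function is \<rho> = \<open>l\<close> times the indicator of one
  side of the bridge cut, interpolated along the arc and its conjugate. For infinite arcs the cut is
  visible at once: beyond the arc there is only the point at infinity, so the function climbs along
  both legs and is 0 elsewhere.\<close>

theorem arc_ends_equiv:
  assumes W: "finite W" "Vtx ` (verts G \<union> infv G) \<subseteq> W" and rg: "real_graph (gtop G) W (arcs W) apath \<iota>"
    and M: "s_inv G \<iota> = genus G + 1"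
    and a: "a \<in> arcs W" "a \<notin> real_graph.ER (gtop G) (arcs W) apath \<iota>"
  shows "slope_equiv (conj_pair (apath a 0)) (conj_pair (apath a 1))"
proof -
  interpret B: real_graph "gtop G" W "arcs W" apath \<iota> by (rule rg)
  have BR: "B.R = realpts G \<iota>" by (simp add: B.R_def realpts_def topspace_gtop)
  have MB: "(\<Sum>C\<in>B.comps. betti1 (subtopology (gtop G) C) + 1) = betti1 (gtop G) + 1"
    using M by (simp add: s_inv_def genus_def BR)
  obtain e1 s1 t1 where a1: "a = (e1, s1, t1)" by (cases a) auto
  obtain e2 s2 t2 where a2: "B.tau a = (e2, s2, t2)" by (cases "B.tau a") auto
  have arc1: "(e1, s1, t1) \<in> arcs W" using a(1) a1 by simp
  have arc2: "(e2, s2, t2) \<in> arcs W" using B.tau_E[OF a(1)] a2 by simp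
  have neq: "(e1, s1, t1) \<noteq> (e2, s2, t2)" using B.tau_nonreal(2)[of a] a a1 a2 by auto
  have im: "\<iota> ` pos_pt G e1 ` {s1<..<t1} = pos_pt G e2 ` {s2<..<t2}"
    using B.inv_oarc[OF a(1)] apath_ends(3)[OF arc1] apath_ends(3)[OF arc2]
    unfolding a2 unfolding a1 by (simp add: B.oarc_def)
  have im': "\<iota> ` pos_pt G e2 ` {s2<..<t2} = pos_pt G e1 ` {s1<..<t1}"
    using B.inv_oarc[OF B.tau_E[OF a(1)], unfolded B.tau_tau[OF a(1)]] apath_ends(3)[OF arc1] apath_ends(3)[OF arc2]
    unfolding a2 unfolding a1 by (simp add: B.oarc_def)
  have len_eq: "t1 - s1 = t2 - s2"
    using arc_length_le[OF arc1 arc2 im] arc_length_le[OF arc2 arc1 im'] by (rule antisym[rotated])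
  have e: "e1 \<in> edges G" "0 \<le> s1" "s1 < t1" "t1 \<le> len G e1" "e2 \<in> edges G" "0 \<le> s2" "s2 < t2" "t2 \<le> len G e2"
    using arc1 arc2 by (auto simp: arcs_def)
  obtain x1 where x1: "s1 = ereal x1" "0 \<le> x1" using e by (cases s1) auto
  obtain x2 where x2: "s2 = ereal x2" "0 \<le> x2" using e by (cases s2) auto
  define u v where "u = pos_pt G e1 s1" and "v = pos_pt G e1 t1"
  have uv: "apath a 0 = u" "apath a 1 = v" using apath_ends[OF arc1] by (simp_all add: u_def v_def a1)
  have ends: "pos_pt G e2 s2 = \<iota> u \<and> pos_pt G e2 t2 = \<iota> v \<or> pos_pt G e2 s2 = \<iota> v \<and> pos_pt G e2 t2 = \<iota> u"
    using B.tau_ends[OF a(1)] apath_ends[OF arc2] uv a2 by simp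
  have valid: "valid_seg G (\<epsilon>, e1, s1, t1)" "valid_seg G (\<epsilon>, e2, s2, t2)" for \<epsilon>
    using e by (auto simp: valid_seg_def)
  show ?thesis
  proof (cases "t1 = \<infinity>")
    case True
    then have t2: "t2 = \<infinity>" using len_eq x1 x2 by (cases t2) auto
    have inf: "len G e1 = \<infinity>" "len G e2 = \<infinity>" using e True t2 by auto
    \<comment> \<open>Two infinite arcs cannot be matched in opposite directions, so both functions
      climb away from \<open>u\<close> and \<iota> \<open>u\<close>.\<close>
    have ends': "pos_pt G e2 s2 = \<iota> u" "pos_pt G e2 t2 = \<iota> v"
      using ends infinite_end[of e1 s1 W e2 s2] arc1 arc2 True t2 by (auto simp: v_def)
    \<comment> \<open>The function is unbounded on the two legs; its values at infinity do not enter \<open>Delta\<close>.\<close>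
    define L where "L = [(1::int, e1, s1, t1), (1, e2, s2, t2)]"
    define f where "f p = (case p of Vtx _ \<Rightarrow> 0 | Inr e x \<Rightarrow> seg_val L e x)" for p :: "('v, 'e) gpt"
    have L0: "seg_val L e 0 = 0" for e
      using clamp_cases(1)[OF e(2,3), of 0] clamp_cases(1)[OF e(6,7), of 0] e by (simp add: L_def flip: zero_ereal_def)
    have "along G f e x = 0 + seg_val L e x" if "e \<in> edges G" "x \<in> edom G e" for e x
    proof -
      consider "x = 0" | "ereal x = len G e" | "0 < x" "ereal x < len G e"
        using \<open>x \<in> edom G e\<close> by (force simp: edom_def)
      then show ?thesis
      proof cases
        case 1 then show ?thesis using L0 by (simp add: along_def f_def pos_0 flip: zero_ereal_def)
      next
        case 2
        then have "e \<noteq> e1" "e \<noteq> e2" using inf by auto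
        then show ?thesis using 2 pos_len[OF that(1)] by (simp add: along_def f_def L_def)
      next
        case 3 then show ?thesis by (simp add: along_def f_def pos_ereal)
      qed
    qed
    then have "slope_equiv (conj_pair v) (conj_pair u)"
      unfolding slope_equiv_def using valid
      by (intro exI[of _ L] exI[of _ f] exI[of _ "\<lambda>_. 0"]) (auto simp: L_def conj_pair_def ends' u_def[symmetric] v_def[symmetric])
    then show ?thesis using slope_equiv_sym uv by simp
  next
    case False
    then obtain y1 where y1: "t1 = ereal y1" using e by (cases t1) auto
    obtain y2 where y2: "t2 = ereal y2" using len_eq y1 x1 x2 e by (cases t2) auto
    define l where "l = y1 - x1"
    have l: "y1 - x1 = l" "y2 - x2 = l" using len_eq x1 x2 y1 y2 by (auto simp: l_def)
    obtain U where U: "U \<subseteq> W" "\<And>w. w \<in> W \<Longrightarrow> \<iota> w \<in> U \<longleftrightarrow> w \<in> U"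
      "\<And>b. b \<in> arcs W - {a, B.tau a} \<Longrightarrow> apath b 0 \<in> U \<longleftrightarrow> apath b 1 \<in> U" "\<not> (apath a 0 \<in> U \<longleftrightarrow> apath a 1 \<in> U)"
      using B.M_bridge[OF MB a] by blast
    define \<sigma> :: "('v, 'e) gpt \<Rightarrow> int" where "\<sigma> p = (if p \<in> U then 1 else 0)" for p
    have uvW: "u \<in> W" "v \<in> W" using arc1 by (auto simp: u_def v_def arcs_def)
    have \<sigma>\<iota>: "\<sigma> (\<iota> u) = \<sigma> u" "\<sigma> (\<iota> v) = \<sigma> v" using U(2) uvW by (auto simp: \<sigma>_def)
    define \<epsilon>1 where "\<epsilon>1 = \<sigma> v - \<sigma> u"
    \<comment> \<open>The conjugate arc may run against the direction of its edge. Reading its slope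
      from the side on which each end lies covers both orientations.\<close>
    define \<epsilon>2 where "\<epsilon>2 = \<sigma> (pos_pt G e2 t2) - \<sigma> (pos_pt G e2 s2)"
    have \<epsilon>1: "\<epsilon>1 = 1 \<or> \<epsilon>1 = -1" using U(4) uv by (auto simp: \<epsilon>1_def \<sigma>_def)
    define L where "L = [(\<epsilon>1, e1, s1, t1), (\<epsilon>2, e2, s2, t2)]"
    \<comment> \<open>The two arcs crossing the cut both have length \<open>l\<close>, so slopes 1
      or -1 on them produce exactly this jump.\<close>
    define \<rho> where "\<rho> p = l * of_int (\<sigma> p)" for p
    define f where "f p = (case p of Vtx _ \<Rightarrow> \<rho> p | Inr e x \<Rightarrow> \<rho> (Vtx (src G e)) + seg_val L e x)" for p
    have pot: "\<rho> (pos_pt G e (ereal x)) = \<rho> (Vtx (src G e)) + seg_val L e x"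
      if "e \<in> edges G" "0 \<le> x" "ereal x \<le> len G e" "pos_pt G e (ereal x) \<in> W" for e x
    proof (rule potential_along_edge[OF W _ _ that])
      show "(e, s, t) \<in> arcs W" if "(\<epsilon>, e, s, t) \<in> set L" for \<epsilon> e s t
        using that arc1 arc2 by (auto simp: L_def)
      fix e s c b assume arc: "(e, s, ereal b) \<in> arcs W" and sc: "s = ereal c"
      have c1: "e1 = e \<Longrightarrow> clamp s1 t1 b - clamp s1 t1 c = (if (s, ereal b) = (s1, t1) then b - c else 0)"
        using clamp_arc[OF arc _ refl sc] arc1 by blast
      have c2: "e2 = e \<Longrightarrow> clamp s2 t2 b - clamp s2 t2 c = (if (s, ereal b) = (s2, t2) then b - c else 0)"
        using clamp_arc[OF arc _ refl sc] arc2 by blast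
      have sv: "seg_val L e b - seg_val L e c = (if e1 = e then of_int \<epsilon>1 * (clamp s1 t1 b - clamp s1 t1 c) else 0)
          + (if e2 = e then of_int \<epsilon>2 * (clamp s2 t2 b - clamp s2 t2 c) else 0)"
        by (simp add: L_def algebra_simps)
      consider "(e, s, ereal b) = (e1, s1, t1)" | "(e, s, ereal b) = (e2, s2, t2)"
        | "(e, s, ereal b) \<noteq> (e1, s1, t1)" "(e, s, ereal b) \<noteq> (e2, s2, t2)" by blast
      then show "\<rho> (pos_pt G e (ereal b)) - \<rho> (pos_pt G e s) = seg_val L e b - seg_val L e c"
      proof cases
        case 1
        then have "b - c = l" "e2 = e \<Longrightarrow> (s, ereal b) \<noteq> (s2, t2)" using l x1 y1 sc neq by auto
        then have "seg_val L e b - seg_val L e c = of_int \<epsilon>1 * l"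
          unfolding sv using c1 c2 1 by auto
        moreover have "\<rho> (pos_pt G e (ereal b)) - \<rho> (pos_pt G e s) = of_int \<epsilon>1 * l"
          using 1 by (simp add: \<rho>_def \<epsilon>1_def u_def v_def algebra_simps)
        ultimately show ?thesis by simp
      next
        case 2
        then have "b - c = l" "e1 = e \<Longrightarrow> (s, ereal b) \<noteq> (s1, t1)" using l x2 y2 sc neq by auto
        then have "seg_val L e b - seg_val L e c = of_int \<epsilon>2 * l"
          unfolding sv using c1 c2 2 by auto
        moreover have "\<rho> (pos_pt G e (ereal b)) - \<rho> (pos_pt G e s) = of_int \<epsilon>2 * l"
          using 2 by (simp add: \<rho>_def \<epsilon>2_def algebra_simps)
        ultimately show ?thesis by simp
      next
        case 3
        then have "seg_val L e b - seg_val L e c = 0"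
          unfolding sv using c1 c2 by auto
        moreover have "\<sigma> (pos_pt G e (ereal b)) = \<sigma> (pos_pt G e s)"
          using U(3)[of "(e, s, ereal b)"] 3 arc a1 a2 apath_ends[OF arc] by (simp add: \<sigma>_def)
        ultimately show ?thesis by (simp add: \<rho>_def)
      qed
    qed
    have al: "along G f e x = \<rho> (Vtx (src G e)) + seg_val L e x" if "e \<in> edges G" "x \<in> edom G e" for e x
    proof -
      have x: "0 \<le> x" "ereal x \<le> len G e" using that(2) by (auto simp: edom_def)
      note vtx = pos_len[OF that(1)] src_verts[OF that(1)] tgt_verts[OF that(1)]
      from x consider w where "pos_pt G e (ereal x) = Vtx w" "Vtx w \<in> W" | "0 < x" "ereal x < len G e"
        using pos_0[of e] vtx W(2)
        by (cases "x = 0"; cases "ereal x = len G e") (auto simp flip: zero_ereal_def)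
      then show ?thesis
      proof cases
        case 1 then show ?thesis using pot[OF that(1) x] by (simp add: along_def f_def)
      next
        case 2 then show ?thesis by (simp add: along_def f_def pos_ereal)
      qed
    qed
    \<comment> \<open>If the conjugate arc is reversed, its slope changes sign and its ends change
      places, so the contribution to the divisor is the same.\<close>
    have sd: "seg_div G L p = \<epsilon>1 * (conj_pair u p - conj_pair v p)" for p
      using ends
    proof
      assume *: "pos_pt G e2 s2 = \<iota> u \<and> pos_pt G e2 t2 = \<iota> v"
      then have "\<epsilon>2 = \<epsilon>1" using \<sigma>\<iota> by (simp add: \<epsilon>1_def \<epsilon>2_def)
      then show ?thesis using * by (simp add: L_def conj_pair_def u_def[symmetric] v_def[symmetric] algebra_simps)
    next
      assume *: "pos_pt G e2 s2 = \<iota> v \<and> pos_pt G e2 t2 = \<iota> u"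
      then have "\<epsilon>2 = - \<epsilon>1" using \<sigma>\<iota> by (simp add: \<epsilon>1_def \<epsilon>2_def)
      then show ?thesis using * by (simp add: L_def conj_pair_def u_def[symmetric] v_def[symmetric] algebra_simps)
    qed
    have main: "slope_equiv D1 D2" if "\<And>p. D2 p - D1 p = \<epsilon>1 * (conj_pair u p - conj_pair v p)" for D1 D2
      unfolding slope_equiv_def using valid al sd that
      by (intro exI[of _ L] exI[of _ f] exI[of _ "\<lambda>e. \<rho> (Vtx (src G e))"]) (auto simp: L_def)
    from \<epsilon>1 show ?thesis
    proof
      assume "\<epsilon>1 = 1"
      then have "slope_equiv (conj_pair v) (conj_pair u)" by (intro main) simp
      then show ?thesis using slope_equiv_sym uv by simp
    next
      assume "\<epsilon>1 = -1"
      then show ?thesis unfolding uv by (intro main) simp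
    qed
  qed
qed

theorem conj_pair_equiv_real:
  assumes M: "s_inv G \<iota> = genus G + 1" and p: "p \<in> pts G"
  shows "\<exists>r\<in>realpts G \<iota>. slope_equiv (conj_pair p) (\<lambda>q. 2 * delta r q)"
proof -
  obtain W where W: "finite W" "{p} \<subseteq> W" "W \<subseteq> pts G" "Vtx ` (verts G \<union> infv G) \<subseteq> W"
    and rg: "real_graph (gtop G) W (arcs W) apath \<iota>"
    using ex_real_graph[of "{p}"] p by blast
  interpret B: real_graph "gtop G" W "arcs W" apath \<iota> by (rule rg)
  have BR: "B.R = realpts G \<iota>" by (simp add: B.R_def realpts_def topspace_gtop)
  have MB: "(\<Sum>C\<in>B.comps. betti1 (subtopology (gtop G) C) + 1) = betti1 (gtop G) + 1"
    using M by (simp add: s_inv_def genus_def BR)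
  define U where "U = {w \<in> W. slope_equiv (conj_pair p) (conj_pair w)}"
  have "U \<inter> B.R \<noteq> {}"
  proof
    assume dis: "U \<inter> B.R = {}"
    \<comment> \<open>If the class \<open>U\<close> had no real vertex, a real arc would have
      neither end in it, and \<open>arc_ends_equiv\<close> keeps non-real arcs from leaving it;
      connectedness would then put all vertices in \<open>U\<close>, including a real one.\<close>
    have "U = W"
    proof (rule B.connected_vertices[OF connected_gtop])
      show "U \<noteq> {}" using W(2) slope_equiv_refl by (auto simp: U_def)
      fix a assume a: "a \<in> arcs W"
      show "apath a 0 \<in> U \<longleftrightarrow> apath a 1 \<in> U"
      proof (cases "a \<in> B.ER")
        case True
        have "apath a 0 \<in> B.carc a" "apath a 1 \<in> B.carc a" by (auto simp: B.carc_def)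
        then show ?thesis using B.carc_R[OF True] dis by blast
      next
        case False
        then have "slope_equiv (conj_pair (apath a 0)) (conj_pair (apath a 1))"
          using arc_ends_equiv W rg M a by blast
        then show ?thesis
          using B.ends_in_W[OF a] slope_equiv_trans slope_equiv_sym unfolding U_def by blast
      qed
    qed (auto simp: U_def)
    then show False using B.M_real_vertex[OF MB] dis by blast
  qed
  then obtain r where r: "r \<in> U" "r \<in> B.R" by blast
  then have "conj_pair r = (\<lambda>q. 2 * delta r q)" by (auto simp: conj_pair_def B.R_def)
  then have "slope_equiv (conj_pair p) (\<lambda>q. 2 * delta r q)" using r(1) by (simp add: U_def)
  then show ?thesis using r(2) BR by blast
qed

theorem real_effective_equiv_totally_real:
  assumes M: "s_inv G \<iota> = genus G + 1" and D: "real_divisor G \<iota> D" "effective D"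
  shows "\<exists>D'. totally_real_divisor G \<iota> D' \<and> effective D' \<and> slope_equiv D D'"
  using D
\<comment> \<open>The measure is the degree of the part of \<open>D\<close> outside
  \<Gamma>(\<real>); trading \<open>p\<close> and its conjugate for \<open>2r\<close> lowers
  it.\<close>
proof (induction "nat (\<Sum>p\<in>{p. D p \<noteq> 0} - realpts G \<iota>. D p)" arbitrary: D rule: less_induct)
  case less
  have fin: "finite {p. D p \<noteq> 0}" and sub: "{p. D p \<noteq> 0} \<subseteq> pts G" and real: "\<And>p. p \<in> pts G \<Longrightarrow> D (\<iota> p) = D p"
    and eff: "\<And>p. 0 \<le> D p"
    using less.prems by (auto simp: real_divisor_def divisor_def effective_def)
  show ?case
  proof (cases "{p. D p \<noteq> 0} \<subseteq> realpts G \<iota>")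
    case True
    then show ?thesis using less.prems slope_equiv_refl by (auto simp: totally_real_divisor_def)
  next
    case False
    then obtain p where p: "D p \<noteq> 0" "p \<notin> realpts G \<iota>" by blast
    then have pp: "p \<in> pts G" "\<iota> p \<noteq> p" using sub by (auto simp: realpts_def)
    obtain r where r: "r \<in> realpts G \<iota>" "slope_equiv (conj_pair p) (\<lambda>q. 2 * delta r q)"
      using conj_pair_equiv_real[OF M pp(1)] by blast
    have rr: "r \<in> pts G" "\<iota> r = r" using r(1) by (auto simp: realpts_def)
    define D1 where "D1 q = D q - conj_pair p q + 2 * delta r q" for q
    \<comment> \<open>Reality puts the conjugate point into the divisor as well; since it differs
      from \<open>p\<close>, the whole pair can be subtracted without losing effectivity.\<close>
    have Dp: "D p \<ge> 1" "D (\<iota> p) \<ge> 1" using p(1) eff[of p] real[OF pp(1)] by linarith+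
    have eff1: "effective D1"
      unfolding effective_def
    proof
      fix q
      have "conj_pair p q \<le> D q"
        using Dp eff[of q] pp(2) by (auto simp: conj_pair_def)
      then show "0 \<le> D1 q" by (simp add: D1_def)
    qed
    have supp1: "{q. D1 q \<noteq> 0} \<subseteq> insert r {q. D q \<noteq> 0}"
      using Dp by (auto simp: D1_def conj_pair_def split: if_splits)
    have real1: "real_divisor G \<iota> D1"
      unfolding real_divisor_def divisor_def
    proof (intro conjI ballI)
      show "finite {q. D1 q \<noteq> 0}" using supp1 fin finite_subset by blast
      show "{q. D1 q \<noteq> 0} \<subseteq> pts G" using supp1 sub rr(1) by blast
      fix q assume q: "q \<in> pts G"
      have "\<iota> q = p \<longleftrightarrow> q = \<iota> p" "\<iota> q = \<iota> p \<longleftrightarrow> q = p" "\<iota> q = r \<longleftrightarrow> q = r"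
        using iota(2)[OF q] iota(2)[OF pp(1)] rr(2) by metis+
      then show "D1 (\<iota> q) = D1 q" using real[OF q] by (simp add: D1_def conj_pair_def)
    qed
    let ?S = "{q. D q \<noteq> 0} - realpts G \<iota>"
    have "(\<Sum>q\<in>{q. D1 q \<noteq> 0} - realpts G \<iota>. D1 q) = (\<Sum>q\<in>?S. D1 q)"
      using fin supp1 r(1) by (intro sum.mono_neutral_left) auto
    also have "\<dots> < (\<Sum>q\<in>?S. D q)"
    proof (rule sum_strict_mono_ex1)
      show "\<forall>q\<in>?S. D1 q \<le> D q" using r(1) by (auto simp: D1_def conj_pair_def)
      show "\<exists>q\<in>?S. D1 q < D q" using p pp r(1) by (intro bexI[of _ p]) (auto simp: D1_def conj_pair_def)
    qed (use fin in auto)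
    finally have "nat (\<Sum>q\<in>{q. D1 q \<noteq> 0} - realpts G \<iota>. D1 q) < nat (\<Sum>q\<in>?S. D q)"
      using sum_nonneg[of "{q. D1 q \<noteq> 0} - realpts G \<iota>" D1] eff1 by (simp add: effective_def)
    from less.hyps[OF this real1 eff1]
    obtain D' where D': "totally_real_divisor G \<iota> D'" "effective D'" "slope_equiv D1 D'" by blast
    have "slope_equiv D D1"
      by (rule slope_equiv_diff[OF r(2)]) (simp add: D1_def)
    then show ?thesis using D' slope_equiv_trans by blast
  qed
qed

end

theorem theorem5:
  fixes G :: "('v, 'e) tgraph"
    and \<iota> :: "('v, 'e) gpt \<Rightarrow> ('v, 'e) gpt"
    and D :: "('v, 'e) gpt \<Rightarrow> int"
  assumes "metric_graph G \<or> tropical_curve G"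
    and "real_structure G \<iota>"
    and "M_curve G \<iota>"
    and "real_divisor G \<iota> D"
    and "effective D"
  shows "\<exists>D'. totally_real_divisor G \<iota> D' \<and> effective D' \<and> lin_equiv G D D'"
proof -
  interpret real_tropical G \<iota>
    using assms(1,2) by unfold_locales (auto simp: metric_graph_def)
  show ?thesis
    using real_effective_equiv_totally_real[of D] slope_equiv_imp_lin_equiv assms(3-5) unfolding M_curve_def by blast
qed

end
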